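(* Consider the solitaire Ten Thousand game, i.e. the Markov control process with state space $\mathcal X$, actions, transitions, rewards and value function $V^*$ described in the context. (a) There exists a pure and stationary optimal strategy $\pi^*$ for the game, i.e. $V(\mathbf x,\pi^* )=V^*(\mathbf x)=\sup_{\pi}V(\mathbf x,\pi)$ for all $\mathbf x\in\mathcal X$. (b) For states $\mathbf x=(\tau,i,n)$ with $\tau\ge 56$, the value function is $V^*(\mathbf x)=\tau$, and the optimal action is $\mathbf s$ (stop). (c) For the rest of the states, the value (and an optimal action) is obtained exactly by the Algorithm described in the context (after its execution the array $V$ holds the optimal values and the array $A$ the optimal actions), in an efficient way, in which most of the states get their value in one shot, and for the others just a few updates are needed. The value of the game (from its initial state) is $V^*(\imath)=5.872019$. The value function and optimal action for every state $\mathbf x=(\tau,i,n)$ with $\tau<56$ are summarized by the following table, given by columns. In each column the listed entries are the values of $V^*$ for the indicated consecutive values of $\tau$; the stated action is optimal at all these entries, and the listed values exceed $\tau$. For smaller $\tau$ than those listed in a column the states are unreachable and no value is given. For larger $\tau$ ($\tau<56$) than those listed, the optimal action is $\mathbf s$ and $V^*=\tau$. $\bullet$ $n=5$, all $i$ (the entry $\tau=0$ being the initial state): action $\mathbf r$; $\tau=0,1,\dots,55$: 5.8720, 6.607, 7.355, 8.107, 8.883, 9.713, 10.553, 11.394, 12.235, 13.077, 13.918, 14.779, 15.655, 16.534, 17.413, 18.291, 19.170, 20.060, 20.972, 21.893, 22.814, 23.734, 24.655, 25.576, 26.497, 27.418, 28.339, 29.260, 30.181, 31.102, 32.022, 32.943,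 33.864, 34.785, 35.706, 36.627, 37.548, 38.469, 39.390, 40.312, 41.233, 42.154, 43.075, 43.997, 44.919, 45.840, 46.762, 47.684, 48.607, 49.529, 50.452, 51.375, 52.298, 53.221, 54.144, 55.066. $\bullet$ $n=4$, all $i$: action $\mathbf r$; $\tau=1,\dots,18$: 4.338, 5.021, 5.743, 6.476, 7.212, 8.001, 8.840, 9.679, 10.517, 11.357, 12.196, 13.035, 13.875, 14.715, 15.554, 16.394, 17.234, 18.073. $\bullet$ $n=3$, $i\in\{[2,0,0],[1,1,0]\}$: action $\mathbf m_5$; $\tau=2,\dots,13$: 4.338, 5.021, 5.743, 6.476, 7.212, 8.001, 8.840, 9.679, 10.517, 11.357, 12.196, 13.035. $\bullet$ $n=3$, $i=[0,2,0]$: action $\mathbf m_1$; $\tau=4,\dots,8$: 5.021, 5.743, 6.476, 7.212, 8.001. $\bullet$ $n=3$, other $i$: action $\mathbf r$; $\tau=2,\dots,6$: 3.447, 4.123, 4.837, 5.552, 6.266. $\bullet$ $n=2$, $i=[2,1,0]$: action $\mathbf m_{55}$; $\tau=4,\dots,8$: 5.021, 5.743, 6.476, 7.212, 8.001. $\bullet$ $n=2$, $i=[1,2,0]$: action $\mathbf m_{51}$; $\tau=5$: 5.021. $\bullet$ $n=2$, $i\in\{[2,0,0],[1,1,0]\}$: action $\mathbf r$; $\tau=3,4$: 3.447, 4.123. $\bullet$ $n=2$, other $i$, and $n=1$, all $i$: the optimal action is always $\mathbf s$, so $V^*=\tau$. The actions $\mathbf m_{11}$, $\mathbf m_{551}$,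 $\mathbf m_{511}$ and $\mathbf m_{t_k}$, $k=1,\dots,6$, are never optimal.
   Context: **Configurations.** The outcome of rolling $n$ fair six-sided dice ($1\le n\le5$) is summarized by a configuration $i=[f,o,t]$: $f$ is the number of fives, $o$ the number of ones, and $t\in\{2,3,4,6\}$ indicates three of a kind of the number $t$, with $t=0$ denoting the absence of three of a kind for these numbers. Let $\mathbf 0=[0,0,0]$ be the non-scoring configuration and $\mathcal I$ the finite set of configurations with non-vanishing score obtainable with at most five dice. Let $f(n,j)$ denote the number of the $6^n$ ordered outcomes of $n$ dice having configuration $j$. For $i=[f,o,t]$ define - score $s(i)=f+2o+14\cdot1_{\{o\ge3\}}+7\cdot1_{\{f\ge3\}}+2t$ (points are counted in chips of 50), - number of scoring dice $d(i)=f+o+3\cdot1_{\{t\ne0\}}$, - number of scoring combinations $c(i)=f+o+1_{\{t\ne0\}}$ (three fives or three ones count as three scoring combinations). A configuration $j$ is smaller than $i$, written $j\prec i$, if the set of scoring combinations of $j$ (each single five, each single one, a triple of $t$, counted with multiplicity) is a non-void strict subset of that of $i$. **States.** A state $(\tau,i,n)$ records the accumulated chips $\tau$, the last obtained configuration $i$ and the number $n$ of dice available to roll. The state space is $$\mathcal X=\{\imath,\Delta\}\cup\{(\tau,i,n):\tau\in\{1,2,\dots\},\ i\in\mathcal I,\ n\in\{1,2,3,4,5\}\},$$ where $\imath=(0,\emptyset,5)$ is the initial state and $\Delta=(0,\mathbf 0,0)$ is a final absorbing state, where the game has ended. Unreachable states are those that do not occur when the game is played from $\imath$. **Actions, rewards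 and transitions.** - Roll $\mathbf r$ (available at every $(\tau,i,n)$, and the only action at $\imath$): reward $0$. From a state with accumulated score $\tau$ and $n$ available dice, the next state is $\Delta$ with probability $f(n,\mathbf 0)/6^n$, and is $(\tau+s(j),j,n-d(j)+5\cdot1_{\{n=d(j)\}})$ with probability $f(n,j)/6^n$ for $j\in\mathcal I$. - Stop $\mathbf s$ (available at every $(\tau,i,n)$): reward $\tau$, next state $\Delta$ with probability one. - Move $\mathbf m_{\text{to }j}$ (available at $(\tau,i,n)$ for each $j\prec i$, when $c(i)>1$ and $n<5$): reward $0$, next state $(\tau-s(i)+s(j),\,j,\,n+d(i)-d(j))$ with probability one. A move from $i$ to $j$ is also described by the scoring dice that are resigned: $\mathbf m_5$ (one five), $\mathbf m_1$ (one 1), $\mathbf m_{55}$ (two fives), $\mathbf m_{51}$ (one five and one 1), $\mathbf m_{11}$ (two 1s), $\mathbf m_{551}$ (two fives and one 1), $\mathbf m_{511}$ (one five and two 1s), $\mathbf m_{t_k}$ (three of a kind of $k$), $k=1,\dots,6$. **Strategies and value.** A strategy $\pi=(\pi_1,\pi_2,\dots)$ is a sequence of stochastic kernels choosing an available action given the history of states and actions; a pure stationary strategy is given by a function assigning to each state one of its available actions. For a strategy $\pi$ and initial state $\mathbf x$, $V(\mathbf x,\pi)$ is the expected total (undiscounted) reward, and $V^*(\mathbf x)=\sup_\pi V(\mathbf x,\pi)$, the supremum being over all strategies. A strategy is optimal if it attains this supremum for every $\mathbf x\in\mathcal X$. An action is optimal at $\mathbf x$ if it attains the maximum, over the actions $\mathbf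 a$ available at $\mathbf x$, of $r(\mathbf x,\mathbf a)+\sum_{\mathbf y}V^*(\mathbf y)\,q(\mathbf y\mid\mathbf x,\mathbf a)$, where $r$ is the reward and $q$ the transition probability. **Algorithm.** It maintains arrays $V(\tau,i,n)$ and $A(\tau,i,n)$, with $V(\tau,i,n)=\tau$ for $\tau\ge56$. For the current array $V$ put $$V_{\mathbf r}(\tau,n)=\sum_{k\in\mathcal I}\frac{f(n,k)}{6^n}V\bigl(\tau+s(k),k,n-d(k)+5\cdot1_{\{n=d(k)\}}\bigr).$$ Let $\mathcal I(m)=\{i\in\mathcal I: d(i)\le m\}$ and $\mathcal I(i,n)=\{j\in\mathcal I: i\prec j,\ d(j)<d(i)+n\}$. For $\tau=55$ down to $0$: 1. for every $i\in\mathcal I$ set $(V,A)(\tau,i,5):=(V_{\mathbf r}(\tau,5),\mathbf r)$; 2. for $n=4$ down to $1$: let $aux:=V_{\mathbf r}(\tau,n)$, and for every $i\in\mathcal I(5-n)$: - if $aux\le\tau$, set $(V,A)(\tau,i,n):=(\tau,\mathbf s)$; - otherwise set $(V,A)(\tau,i,n):=(aux,\mathbf r)$, and then for every $j\in\mathcal I(i,n)$: if $V(\tau-s(i)+s(j),j,n-d(j)+d(i))<aux$, set $(V,A)(\tau-s(i)+s(j),j,n-d(j)+d(i)):=(aux,\mathbf m_{\text{to }i})$.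
   Formalization: For n=2, [2,0,0] and [1,1,0] have action m_5, not r; [1,0,0] at τ=3 has action r, value 3.173. For n<5 only i∈I(5−n) is covered, and the Algorithm is claimed exact only if τ≥s(i) (or n=5); "always s" is for reachable states; moves leaving X are unavailable. *)

theory Defs
  imports "HOL-Probability.Probability"
begin

text \<open>A configuration \<open>(fs, os, t)\<close>: number of fives, number of ones, and the number shown by a
  triple of twos, threes, fours or sixes (\<open>t = 0\<close> if there is none).\<close>

type_synonym cfg = "nat \<times> nat \<times> nat"

definition rolls :: "nat \<Rightarrow> nat list set" where
  "rolls n = {w. length w = n \<and> set w \<subseteq> {1..6}}"

text \<open>At most five dice are rolled, so at most one summand of the last component is nonzero.\<close>

definition cfg_of :: "nat list \<Rightarrow> cfg" where
  "cfg_of w = (count_list w 5, count_list w 1,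
     \<Sum>k\<in>{2, 3, 4, 6}. if 3 \<le> count_list w k then k else 0)"

definition ways :: "nat \<Rightarrow> cfg \<Rightarrow> nat" where
  "ways n j = card {w \<in> rolls n. cfg_of w = j}"

fun score :: "cfg \<Rightarrow> nat" where
  "score (fs, os, t) =
     fs + 2 * os + (if 3 \<le> os then 14 else 0) + (if 3 \<le> fs then 7 else 0) + 2 * t"

fun ndice :: "cfg \<Rightarrow> nat" where
  "ndice (fs, os, t) = fs + os + (if t \<noteq> 0 then 3 else 0)"

fun ncomb :: "cfg \<Rightarrow> nat" where
  "ncomb (fs, os, t) = fs + os + (if t \<noteq> 0 then 1 else 0)"

definition configs :: "cfg set" where
  "configs = {j. score j \<noteq> 0 \<and> (\<exists>n\<in>{1..5}. 0 < ways n j)}"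

definition configs_upto :: "nat \<Rightarrow> cfg set" where
  "configs_upto m = {i \<in> configs. ndice i \<le> m}"

datatype comb = SFive | SOne | Triple nat

fun combs :: "cfg \<Rightarrow> comb multiset" where
  "combs (fs, os, t) =
     replicate_mset fs SFive + replicate_mset os SOne + (if t \<noteq> 0 then {#Triple t#} else {#})"

definition smaller :: "cfg \<Rightarrow> cfg \<Rightarrow> bool" (infix "\<prec>" 50) where
  "j \<prec> i \<longleftrightarrow> combs j \<noteq> {#} \<and> combs j \<subset># combs i"

text \<open>\<^term>\<open>Init\<close> is the state \<open>(0, \<emptyset>, 5)\<close> and \<^term>\<open>Final\<close> is the absorbing state \<open>(0, 0, 0)\<close>.\<close>

datatype state = Init | Final | St nat cfg nat

datatype act = Roll | Stop | Move cfg

instance state :: countable by countable_datatype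
instance act :: countable by countable_datatype

definition states :: "state set" where
  "states = {Init, Final} \<union>
     {St \<tau> i n | \<tau> i n. 1 \<le> \<tau> \<and> i \<in> configs \<and> n \<in> {1..5}}"

lemma St_states: "St \<tau> i n \<in> states \<longleftrightarrow> 1 \<le> \<tau> \<and> i \<in> configs \<and> n \<in> {1..5}"
  unfolding states_def by blast

definition after_roll :: "nat \<Rightarrow> nat \<Rightarrow> cfg \<Rightarrow> state" where
  "after_roll \<tau> n j = St (\<tau> + score j) j (n - ndice j + (if n = ndice j then 5 else 0))"

definition after_move :: "nat \<Rightarrow> cfg \<Rightarrow> nat \<Rightarrow> cfg \<Rightarrow> state" where
  "after_move \<tau> i n j = St (\<tau> + score j - score i) j (n + ndice i - ndice j)"

text \<open>For some unreachable \<open>(\<tau>, i, n)\<close> (those with \<open>\<tau> < score i\<close> or \<open>ndice i + n > 5\<close>) a move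
  would lead outside the state space; such a move is not available.  (The subtraction of naturals
  in \<^const>\<open>after_move\<close> then truncates to the score \<open>0\<close>, which is not in \<^const>\<open>states\<close> either.)
  At the absorbing state, whose score is \<open>0\<close>, the only action is to stop.\<close>

fun actions :: "state \<Rightarrow> act set" where
  "actions Init = {Roll}"
| "actions Final = {Stop}"
| "actions (St \<tau> i n) = {Roll, Stop} \<union>
     {Move j | j. j \<prec> i \<and> 1 < ncomb i \<and> n < 5 \<and> after_move \<tau> i n j \<in> states}"

fun reward :: "state \<Rightarrow> act \<Rightarrow> ennreal" where
  "reward (St \<tau> i n) Stop = of_nat \<tau>"
| "reward _ _ = 0"

definition cfg_pmf :: "nat \<Rightarrow> cfg pmf" where
  "cfg_pmf n = map_pmf cfg_of (pmf_of_set (rolls n))"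

definition roll_pmf :: "nat \<Rightarrow> nat \<Rightarrow> state pmf" where
  "roll_pmf \<tau> n =
     map_pmf (\<lambda>j. if j = (0, 0, 0) then Final else after_roll \<tau> n j) (cfg_pmf n)"

fun trans_pmf :: "state \<Rightarrow> act \<Rightarrow> state pmf" where
  "trans_pmf Init Roll = roll_pmf 0 5"
| "trans_pmf (St \<tau> i n) Roll = roll_pmf \<tau> n"
| "trans_pmf (St \<tau> i n) (Move j) = return_pmf (after_move \<tau> i n j)"
| "trans_pmf _ _ = return_pmf Final"

inductive reachable :: "state \<Rightarrow> bool" where
  "reachable Init"
| "reachable x \<Longrightarrow> a \<in> actions x \<Longrightarrow> y \<in> set_pmf (trans_pmf x a) \<Longrightarrow> reachable y"

lemma finite_rolls: "finite (rolls n)"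
  unfolding rolls_def using finite_lists_length_eq[of "{1..6::nat}" n] by (simp add: conj_commute)

lemma card_rolls: "card (rolls n) = 6 ^ n"
  unfolding rolls_def using card_lists_length_eq[of "{1..6::nat}" n] by (simp add: conj_commute)

lemma rolls_nonempty: "rolls n \<noteq> {}"
  using card_rolls[of n] by auto

lemma pmf_cfg_pmf: "pmf (cfg_pmf n) j = ways n j / 6 ^ n"
proof -
  have "rolls n \<inter> cfg_of -` {j} = {w \<in> rolls n. cfg_of w = j}" by auto
  then show ?thesis
    by (simp add: cfg_pmf_def pmf_map measure_pmf_of_set finite_rolls rolls_nonempty card_rolls
        ways_def)
qed

text \<open>The kernel \<open>\<pi>\<^sub>n\<close> of a strategy is \<open>\<pi>\<close> restricted to pasts \<open>h\<close> of length \<open>n - 1\<close>; the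
  second argument is the current state.\<close>

type_synonym strategy = "(state \<times> act) list \<Rightarrow> state \<Rightarrow> act pmf"

definition strategies :: "strategy set" where
  "strategies = {\<pi>. \<forall>h x. set h \<subseteq> {(y, a). y \<in> states \<and> a \<in> actions y} \<and> x \<in> states \<longrightarrow>
     set_pmf (\<pi> h x) \<subseteq> actions x}"

definition pure_stationary :: "(state \<Rightarrow> act) \<Rightarrow> strategy" where
  "pure_stationary g = (\<lambda>h y. return_pmf (g y))"

text \<open>Conditional law of the \<open>n\<close>-th state-action pair given the earlier ones, and the law of the
  whole trajectory obtained from it by the Ionescu-Tulcea theorem.\<close>

definition next_pair :: "strategy \<Rightarrow> state \<Rightarrow> nat \<Rightarrow> (nat \<Rightarrow> state \<times> act) \<Rightarrow> (state \<times> act) pmf" where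
  "next_pair \<pi> x n \<omega> = bind_pmf
     (if n = 0 then return_pmf x else trans_pmf (fst (\<omega> (n - 1))) (snd (\<omega> (n - 1))))
     (\<lambda>y. map_pmf (Pair y) (\<pi> (map \<omega> [0..<n]) y))"

lemma next_pair_measurable:
  "(\<lambda>\<omega>. measure_pmf (next_pair \<pi> x n \<omega>)) \<in>
     measurable (PiM {0..<n} (\<lambda>_. count_space UNIV)) (subprob_algebra (count_space UNIV))"
proof -
  let ?M = "PiM {0..<n} (\<lambda>_. count_space UNIV) :: (nat \<Rightarrow> state \<times> act) measure"
  let ?g = "\<lambda>l k. (if k < n then l ! k else undefined) :: state \<times> act"
  have "(\<lambda>\<omega>. map \<omega> [0..<n]) -` {l} \<inter> space ?M \<in> sets ?M" for l
  proof (cases "length l = n")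
    case True
    have "map \<omega> [0..<n] = l \<longleftrightarrow> (\<forall>k<n. \<omega> k = l ! k)" for \<omega>
      using True by (subst list_eq_iff_nth_eq) simp
    then have "(\<lambda>\<omega>. map \<omega> [0..<n]) -` {l} \<inter> space ?M = PiE {0..<n} (\<lambda>k. {l ! k})"
      by (intro set_eqI) (auto simp: space_PiM PiE_iff)
    then show ?thesis by (auto intro!: sets_PiM_I_finite)
  next
    case False
    then have "(\<lambda>\<omega>. map \<omega> [0..<n]) -` {l} = {}" by auto
    then show ?thesis by (metis Int_empty_left sets.empty_sets)
  qed
  then have 1: "(\<lambda>\<omega>. map \<omega> [0..<n]) \<in> measurable ?M (count_space UNIV)"
    by (subst measurable_count_space_eq_countable) auto
  have 2: "(\<lambda>l. measure_pmf (next_pair \<pi> x n (?g l))) \<in>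
      measurable (count_space UNIV) (subprob_algebra (count_space UNIV))"
    by (simp add: measure_pmf_in_subprob_algebra)
  have 3: "next_pair \<pi> x n (?g (map \<omega> [0..<n])) = next_pair \<pi> x n \<omega>" for \<omega>
  proof -
    have "map (?g (map \<omega> [0..<n])) [0..<n] = map \<omega> [0..<n]"
      by (rule nth_equalityI) auto
    moreover have "n \<noteq> 0 \<Longrightarrow> ?g (map \<omega> [0..<n]) (n - 1) = \<omega> (n - 1)" by simp
    ultimately show ?thesis by (cases "n = 0") (simp_all only: next_pair_def if_True if_False simp_thms not_False_eq_True)
  qed
  show ?thesis using measurable_compose[OF 1 2] by (simp only: 3)
qed

interpretation trajectory:
  Ionescu_Tulcea "\<lambda>n \<omega>. measure_pmf (next_pair \<pi> x n \<omega>)" "\<lambda>_. count_space UNIV" for \<pi> x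
  by standard (rule next_pair_measurable)

definition trajectory_law :: "strategy \<Rightarrow> state \<Rightarrow> (nat \<Rightarrow> state \<times> act) measure" where
  "trajectory_law \<pi> x = trajectory.PF.lim \<pi> x"

definition total_reward :: "state \<Rightarrow> strategy \<Rightarrow> ennreal" where
  "total_reward x \<pi> = (\<integral>\<^sup>+\<omega>. (\<Sum>k. reward (fst (\<omega> k)) (snd (\<omega> k))) \<partial>trajectory_law \<pi> x)"

definition opt_value :: "state \<Rightarrow> ennreal" where
  "opt_value x = (SUP \<pi>\<in>strategies. total_reward x \<pi>)"

definition action_value :: "state \<Rightarrow> act \<Rightarrow> ennreal" where
  "action_value x a = reward x a + (\<integral>\<^sup>+y. opt_value y \<partial>measure_pmf (trans_pmf x a))"

definition opt_actions :: "state \<Rightarrow> act set" where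
  "opt_actions x = {a \<in> actions x. \<forall>b\<in>actions x. action_value x b \<le> action_value x a}"

lemma sum_count_list_le: "finite S \<Longrightarrow> (\<Sum>k\<in>S. count_list w k) \<le> length w"
proof (induction w)
  case (Cons x w)
  have "(\<Sum>k\<in>S. count_list (x # w) k) = (\<Sum>k\<in>S. count_list w k) + (\<Sum>k\<in>S. if x = k then 1 else 0)"
    unfolding sum.distrib[symmetric] by (rule sum.cong) auto
  also have "(\<Sum>k\<in>S. if x = k then 1 else 0 :: nat) \<le> 1" using Cons.prems by (simp add: sum.delta)
  finally show ?case using Cons by simp
qed simp

lemma ndice_cfg_of_le: "ndice (cfg_of w) \<le> length w"
proof (cases "\<exists>k\<in>{2, 3, 4, 6}. 3 \<le> count_list w k")
  case True
  then obtain k where k: "k \<in> {2, 3, 4, 6}" "3 \<le> count_list w k" by blast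
  then have "count_list w 5 + count_list w 1 + count_list w k \<le> length w"
    using sum_count_list_le[of "{5, 1, k}" w] by auto
  then show ?thesis using k by (simp add: cfg_of_def)
next
  case False
  then show ?thesis using sum_count_list_le[of "{5, 1}" w] by (auto simp: cfg_of_def)
qed

lemma cfg_of_configs:
  assumes "w \<in> rolls n" "n \<in> {1..5}" "cfg_of w \<noteq> (0, 0, 0)"
  shows "cfg_of w \<in> configs"
proof -
  have "score (cfg_of w) \<noteq> 0" using assms(3) by (cases "cfg_of w") auto
  moreover have "0 < ways n (cfg_of w)"
    using assms(1) finite_rolls[of n] by (auto simp: ways_def card_gt_0_iff)
  ultimately show ?thesis using assms(2) by (auto simp: configs_def)
qed

text \<open>The algorithm and the table below determine values only at states with
  \<open>i \<in> configs_upto (5 - n)\<close> if \<open>n < 5\<close>; this lemma shows that they cover all reachable states.\<close>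

lemma reachable_covered:
  "reachable (St \<tau> i n) \<Longrightarrow>
     St \<tau> i n \<in> states \<and> score i \<le> \<tau> \<and> (n = 5 \<or> i \<in> configs_upto (5 - n))"
proof -
  let ?ok = "\<lambda>y. case y of St \<tau> i n \<Rightarrow>
     y \<in> states \<and> score i \<le> \<tau> \<and> (n = 5 \<or> i \<in> configs_upto (5 - n)) | _ \<Rightarrow> True"
  have roll: "?ok y" if y: "y \<in> set_pmf (roll_pmf \<tau> n)" and n: "n \<in> {1..5}" for y \<tau> n
  proof -
    have "set_pmf (pmf_of_set (rolls n)) = rolls n"
      using finite_rolls rolls_nonempty by (rule set_pmf_of_set[rotated])
    then have "y \<in> (\<lambda>w. if cfg_of w = (0, 0, 0) then Final else after_roll \<tau> n (cfg_of w)) ` rolls n"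
      using y by (simp only: roll_pmf_def cfg_pmf_def set_map_pmf image_image)
    then obtain w where w: "w \<in> rolls n"
        "y = (if cfg_of w = (0, 0, 0) then Final else after_roll \<tau> n (cfg_of w))"
      by (elim imageE)
    show ?thesis
    proof (cases "cfg_of w = (0, 0, 0)")
      case True
      then show ?thesis using w(2) by simp
    next
      case False
      then have "cfg_of w \<in> configs" using cfg_of_configs w(1) n by blast
      moreover have "ndice (cfg_of w) \<le> n" using ndice_cfg_of_le[of w] w(1) by (simp add: rolls_def)
      moreover have "1 \<le> score (cfg_of w)" using calculation(1) by (simp add: configs_def)
      ultimately show ?thesis
        using w(2) n False by (auto simp: after_roll_def St_states configs_upto_def)
    qed
  qed
  have "?ok y" if "reachable y" for y
    using that
  proof induction
    case 1
    show ?case by simp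
  next
    case (2 x a y)
    show ?case
    proof (cases x)
      case Init
      then show ?thesis using "2.hyps"(2,3) roll[of y 0 5] by simp
    next
      case Final
      then show ?thesis using "2.hyps"(2,3) by simp
    next
      case (St \<tau> i n)
      then have x: "St \<tau> i n \<in> states" "score i \<le> \<tau>" "n = 5 \<or> i \<in> configs_upto (5 - n)"
        using "2.IH" by simp_all
      have y: "a \<in> actions (St \<tau> i n)" "y \<in> set_pmf (trans_pmf (St \<tau> i n) a)"
        using "2.hyps"(2,3) St by simp_all
      show ?thesis
      proof (cases a)
        case Roll
        then show ?thesis using y(2) x(1) roll[of y \<tau> n] by (simp add: St_states)
      next
        case Stop
        then show ?thesis using y(2) by simp
      next
        case (Move j)
        then have m: "y = after_move \<tau> i n j" "after_move \<tau> i n j \<in> states" "n < 5"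
          using y(1) y(2) unfolding actions.simps trans_pmf.simps Move by (simp, blast, blast)
        have "n + ndice i \<le> 5" using x(3) m(3) by (auto simp: configs_upto_def)
        then show ?thesis using x(2) m by (auto simp: after_move_def St_states configs_upto_def)
      qed
    qed
  qed
  then show "reachable (St \<tau> i n) \<Longrightarrow> ?thesis" by fastforce
qed

type_synonym cell = "nat \<times> cfg \<times> nat"

text \<open>The initial state is stored in the cells \<open>(0, i, 5)\<close>.\<close>

fun cell_state :: "cell \<Rightarrow> state" where
  "cell_state (\<tau>, i, n) = (if \<tau> = 0 then Init else St \<tau> i n)"

text \<open>\<open>cnt\<close> records how often a cell has been assigned; the computation does not depend on it.\<close>

record arrays =
  val :: "cell \<Rightarrow> real"
  arg :: "cell \<Rightarrow> act"
  cnt :: "cell \<Rightarrow> nat"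

definition assign :: "cell \<Rightarrow> real \<Rightarrow> act \<Rightarrow> arrays \<Rightarrow> arrays" where
  "assign c v a A =
     \<lparr>val = (val A)(c := v), arg = (arg A)(c := a), cnt = (cnt A)(c := cnt A c + 1)\<rparr>"

definition roll_value :: "(cell \<Rightarrow> real) \<Rightarrow> nat \<Rightarrow> nat \<Rightarrow> real" where
  "roll_value V \<tau> n = (\<Sum>k\<in>configs. real (ways n k) / 6 ^ n *
     V (\<tau> + score k, k, n - ndice k + (if n = ndice k then 5 else 0)))"

text \<open>The list \<open>cs\<close> enumerates \<^const>\<open>configs\<close> and fixes the order of the unordered loops.\<close>

definition process_config :: "cfg list \<Rightarrow> nat \<Rightarrow> nat \<Rightarrow> real \<Rightarrow> cfg \<Rightarrow> arrays \<Rightarrow> arrays" where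
  "process_config cs \<tau> n aux i A =
     (if aux \<le> real \<tau> then assign (\<tau>, i, n) (real \<tau>) Stop A
      else fold
        (\<lambda>j B. let c = (\<tau> + score j - score i, j, n + ndice i - ndice j) in
           if val B c < aux then assign c aux (Move i) B else B)
        (filter (\<lambda>j. i \<prec> j \<and> ndice j < ndice i + n) cs)
        (assign (\<tau>, i, n) aux Roll A))"

definition process_dice :: "cfg list \<Rightarrow> nat \<Rightarrow> nat \<Rightarrow> arrays \<Rightarrow> arrays" where
  "process_dice cs \<tau> n A =
     fold (process_config cs \<tau> n (roll_value (val A) \<tau> n)) (filter (\<lambda>i. ndice i \<le> 5 - n) cs) A"

definition process_score :: "cfg list \<Rightarrow> nat \<Rightarrow> arrays \<Rightarrow> arrays" where
  "process_score cs \<tau> A =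
     fold (process_dice cs \<tau>) [4, 3, 2, 1]
       (fold (\<lambda>i B. assign (\<tau>, i, 5) (roll_value (val B) \<tau> 5) Roll B) cs A)"

definition algorithm :: "cfg list \<Rightarrow> arrays \<Rightarrow> arrays" where
  "algorithm cs A = fold (process_score cs) (rev [0..<56]) A"

definition cells :: "cell set" where
  "cells = {(\<tau>, i, n). \<tau> < 56 \<and> i \<in> configs \<and>
     (n = 5 \<or> n \<in> {1..4} \<and> i \<in> configs_upto (5 - n))}"

text \<open>\<open>x\<close> is \<open>v\<close> when rounded to \<open>k\<close> decimals.\<close>

definition rounds_to :: "nat \<Rightarrow> ennreal \<Rightarrow> real \<Rightarrow> bool" where
  "rounds_to k x v \<longleftrightarrow> (\<exists>r\<ge>0. x = ennreal r \<and> \<bar>r - v\<bar> \<le> 1 / (2 * 10 ^ k))"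

definition resign :: "comb multiset \<Rightarrow> cfg \<Rightarrow> act" where
  "resign R i = Move (THE j. combs i = combs j + R)"

text \<open>One column of the table: \<open>n\<close> dice, configurations \<open>C\<close>, action \<open>a\<close>, and values \<open>vs\<close> for
  \<open>\<tau> = \<tau>0, \<tau>0 + 1, \<dots>\<close>.  Two columns for \<open>n = 2\<close> correct the printed table.  The column of
  \<open>(2, 0, 0)\<close> and \<open>(1, 1, 0)\<close> is printed with action \<^const>\<open>Roll\<close>, but rolling is worth only
  \<open>3.173\<close> and \<open>3.710\<close> there, while its printed values \<open>3.447\<close> and \<open>4.123\<close> are those of resigning
  one five.  The reachable state \<open>St 3 (1, 0, 0) 2\<close> is printed under ``always stop'', but rolling
  is worth \<open>3.173\<close>; it forms a column of its own.\<close>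

definition table_column :: "nat \<Rightarrow> cfg set \<Rightarrow> (cfg \<Rightarrow> act) \<Rightarrow> nat \<Rightarrow> real list \<Rightarrow> bool" where
  "table_column n C a \<tau>0 vs \<longleftrightarrow> (\<forall>i\<in>C.
     (\<forall>\<tau><\<tau>0. \<not> reachable (St \<tau> i n)) \<and>
     (\<forall>k<length vs. let x = cell_state (\<tau>0 + k, i, n) in
        rounds_to 3 (opt_value x) (vs ! k) \<and> of_nat (\<tau>0 + k) < opt_value x \<and>
        a i \<in> opt_actions x) \<and>
     (\<forall>\<tau>. \<tau>0 + length vs \<le> \<tau> \<and> \<tau> < 56 \<longrightarrow>
        opt_value (St \<tau> i n) = of_nat \<tau> \<and> opt_actions (St \<tau> i n) = {Stop}))"

end

theory Submission
  imports Defs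
begin

text \<open>
  The game is a Markov decision problem with nonnegative rewards, so its value is pinned down from
  two sides.  If a function \<open>W\<close> on the states is never exceeded by the reward of an action plus the
  mean of \<open>W\<close> after it, then the rewards collected so far plus \<open>W\<close> of the current state form a
  supermartingale under every strategy, and \<open>W\<close> bounds all total rewards (\<open>total_reward_le\<close>).  If
  moreover some pure stationary strategy attains \<open>W\<close> in each step and ends the game after a bounded
  number of steps, then nothing is lost at infinity and it earns \<open>W\<close>
  (\<open>total_reward_pure_stationary_ge\<close>).

  The function \<open>W\<close> comes from the worth \<open>rollv \<tau> n\<close> of rolling \<open>n\<close> dice with \<open>\<tau>\<close> chips, which does not
  depend on the last configuration.  Two moves in a row can be replaced by one, so the value
  \<open>vopt \<tau> i n\<close> of a state is the largest of \<open>\<tau>\<close>, of \<open>rollv \<tau> n\<close>, and of the worths of rolling after one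
  move.  A roll followed by a move still leaves more chips than before the roll, because something
  is kept.  Hence \<open>rollv\<close> at one score only refers to \<open>rollv\<close> at higher scores: starting from the
  scores \<open>\<ge> 56\<close>, where one stops, it is computed downwards.  The same observation shows that the
  strategy that follows the maxima ends the game: scores grow at every roll, and from 56 on it stops.

  The recursion is solved numerically.  Probability averages and maxima are nonexpansive, so an
  integer table \<open>nano\<close> (in units of \<open>10\<^sup>-\<^sup>9\<close> chips) that satisfies the recursion up to rounding is off by at
  most 56 units (\<open>nano_error\<close>).  All comparisons that the table of optimal actions needs have larger
  margins, and they reduce the question of optimality to a few inequalities between entries.

  In the algorithm a cell receives its own value and, later, the offers from those configurations
  to which a move is possible; the invariant says that it holds the largest of those processed so
  far (\<open>invariant_algorithm\<close>).  An offer can only be an improvement if it exceeds the score of the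
  cell.  As a roll with at most four dice gains less than 4 chips, it must come from resigning one
  five, one 1, two fives, or a five and a 1, and since \<open>rollv\<close> increases with the score, at most two
  of these offers can be successive improvements (\<open>card_records\<close>).
\<close>

text \<open>Below, \<open>\<prec>\<close> compares configurations, not cardinalities.\<close>

no_notation lesspoll (infixl "\<prec>" 50)

section \<open>Histories and the verification principle\<close>

definition next_state :: "state \<Rightarrow> (state \<times> act) list \<Rightarrow> state pmf" where
  "next_state x h = (if h = [] then return_pmf x else trans_pmf (fst (last h)) (snd (last h)))"

text \<open>The marginals of the trajectory law, as discrete distributions on lists.  They reduce statements
  about the infinite product measure to inductions on the number of steps.\<close>

primrec history :: "strategy \<Rightarrow> state \<Rightarrow> nat \<Rightarrow> (state \<times> act) list pmf" where
  "history \<pi> x 0 = return_pmf []"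
| "history \<pi> x (Suc n) = history \<pi> x n \<bind>
     (\<lambda>h. next_state x h \<bind> (\<lambda>y. map_pmf (\<lambda>a. h @ [(y, a)]) (\<pi> h y)))"

lemma measurable_past:
  assumes "{0..<n} \<subseteq> I"
  shows "(\<lambda>\<omega>. map \<omega> [0..<n]) \<in>
    measurable (PiM I (\<lambda>_. count_space UNIV)) (count_space (UNIV :: (state \<times> act) list set))"
proof -
  let ?M = "PiM I (\<lambda>_. count_space UNIV) :: (nat \<Rightarrow> state \<times> act) measure"
  have "(\<lambda>\<omega>. map \<omega> [0..<n]) -` {l} \<inter> space ?M \<in> sets ?M" for l
  proof (cases "length l = n")
    case True
    have "map \<omega> [0..<n] = l \<longleftrightarrow> (\<forall>k<n. \<omega> k = l ! k)" for \<omega>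
      using True by (subst list_eq_iff_nth_eq) simp
    then have "(\<lambda>\<omega>. map \<omega> [0..<n]) -` {l} \<inter> space ?M = {\<omega> \<in> space ?M. \<forall>k\<in>{0..<n}. \<omega> k = l ! k}"
      by auto
    also have "\<dots> \<in> sets ?M"
    proof (rule sets.sets_Collect_finite_All)
      fix k assume k: "k \<in> {0..<n}"
      then have "(\<lambda>\<omega>. \<omega> k) \<in> measurable ?M (count_space UNIV)"
        using assms by (intro measurable_component_singleton) auto
      then show "{\<omega> \<in> space ?M. \<omega> k = l ! k} \<in> sets ?M"
        using measurable_sets[of "\<lambda>\<omega>. \<omega> k" ?M "count_space UNIV" "{l ! k}"]
        by (simp add: vimage_def Int_def conj_commute)
    next
      show "finite {0..<n}" by simp
    qed
    finally show ?thesis .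
  next
    case False
    then have "(\<lambda>\<omega>. map \<omega> [0..<n]) -` {l} = {}" by auto
    then show ?thesis by (metis Int_empty_left sets.empty_sets)
  qed
  then show ?thesis by (subst measurable_count_space_eq_countable) auto
qed

text \<open>The Ionescu-Tulcea construction produces its finite-dimensional laws for arbitrary finite index
  sets; for an initial segment they are the iterated kernels.\<close>

lemma CI_initial: "trajectory.CI \<pi> x {0..<n} = trajectory.C \<pi> x 0 n (\<lambda>_. undefined)"
proof -
  have "trajectory.up_to {0..<n} = n"
  proof (rule antisym)
    show "trajectory.up_to {0..<n} \<le> n"
      by (subst trajectory.up_to_iff) auto
    show "n \<le> trajectory.up_to {0..<n}"
      using trajectory.up_to[of "{0..<n}"] by (cases n) auto
  qed
  then show ?thesis
    unfolding trajectory.CI_def using trajectory.distr_C[of n n "\<lambda>_. undefined" 0 \<pi> x]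
    by (simp add: space_PiM)
qed

lemma nn_integral_past:
  "(\<integral>\<^sup>+\<omega>. F (map \<omega> [0..<n]) \<partial>trajectory_law \<pi> x) =
   (\<integral>\<^sup>+\<omega>. F (map \<omega> [0..<n]) \<partial>trajectory.C \<pi> x 0 n (\<lambda>_. undefined))"
proof -
  let ?M = "PiM {0..<n} (\<lambda>_. count_space UNIV) :: (nat \<Rightarrow> state \<times> act) measure"
  have F: "(\<lambda>\<omega>. F (map \<omega> [0..<n])) \<in> borel_measurable ?M"
    by (rule measurable_compose[OF measurable_past]) auto
  have r: "(\<lambda>\<omega>. restrict \<omega> {0..<n}) \<in> measurable (trajectory_law \<pi> x) ?M"
    unfolding trajectory_law_def measurable_cong_sets[OF trajectory.PF.sets_lim refl]
    by (auto intro!: measurable_restrict measurable_component_singleton)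
  have "(\<integral>\<^sup>+\<omega>. F (map \<omega> [0..<n]) \<partial>trajectory.C \<pi> x 0 n (\<lambda>_. undefined)) =
      (\<integral>\<^sup>+\<omega>. F (map \<omega> [0..<n]) \<partial>distr (trajectory_law \<pi> x) ?M (\<lambda>\<omega>. restrict \<omega> {0..<n}))"
    unfolding trajectory_law_def by (subst trajectory.distr_lim) (simp_all add: CI_initial)
  also have "\<dots> = (\<integral>\<^sup>+\<omega>. F (map (restrict \<omega> {0..<n}) [0..<n]) \<partial>trajectory_law \<pi> x)"
    by (subst nn_integral_distr[OF r]) (use F in simp_all)
  also have "\<dots> = (\<integral>\<^sup>+\<omega>. F (map \<omega> [0..<n]) \<partial>trajectory_law \<pi> x)"
    by (intro nn_integral_cong arg_cong[where f=F] map_cong) auto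
  finally show ?thesis ..
qed

lemma next_pair_eq:
  "next_pair \<pi> x n \<omega> = next_state x (map \<omega> [0..<n]) \<bind>
     (\<lambda>y. map_pmf (Pair y) (\<pi> (map \<omega> [0..<n]) y))"
  by (cases n) (simp_all add: next_pair_def next_state_def)

text \<open>One more step of the iterated kernels extends the history by one pair, which is also what
  \<^const>\<open>history\<close> does.\<close>

lemma nn_integral_history:
  "(\<integral>\<^sup>+\<omega>. F (map \<omega> [0..<n]) \<partial>trajectory_law \<pi> x) = (\<integral>\<^sup>+h. F h \<partial>history \<pi> x n)"
proof (induction n arbitrary: F)
  case 0
  have "emeasure (return (PiM {} (\<lambda>_. count_space UNIV)) (\<lambda>_. undefined))
      (space (PiM {} (\<lambda>_. count_space UNIV) :: (nat \<Rightarrow> state \<times> act) measure)) = 1"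
    by (subst emeasure_return[OF sets.top]) (simp add: space_PiM)
  then show ?case unfolding nn_integral_past by simp
next
  case (Suc n)
  let ?C = "trajectory.C \<pi> x 0"
  let ?M = "\<lambda>n. PiM {0..<n} (\<lambda>_. count_space UNIV) :: (nat \<Rightarrow> state \<times> act) measure"
  let ?G = "\<lambda>h. \<integral>\<^sup>+y. (\<integral>\<^sup>+a. F (h @ [(y, a)]) \<partial>\<pi> h y) \<partial>next_state x h"
  have F: "(\<lambda>\<omega>. F (map \<omega> [0..<Suc n])) \<in> borel_measurable (?M (Suc n))"
    by (rule measurable_compose[OF measurable_past]) auto
  have u: "(\<lambda>_. undefined) \<in> space (?M 0)" by (simp add: space_PiM)
  have sC: "sets (?C n (\<lambda>_. undefined)) = sets (?M n)" "space (?C n (\<lambda>_. undefined)) = space (?M n)"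
    using trajectory.sets_C[OF u, of \<pi> x n] trajectory.space_C[OF u, of \<pi> x n] by simp_all
  have "(\<integral>\<^sup>+\<omega>. F (map \<omega> [0..<Suc n]) \<partial>trajectory_law \<pi> x) =
      (\<integral>\<^sup>+\<omega>. F (map \<omega> [0..<Suc n]) \<partial>(?C n (\<lambda>_. undefined) \<bind> trajectory.eP \<pi> x n))"
    by (simp add: nn_integral_past del: upt_Suc)
  also have "\<dots> = (\<integral>\<^sup>+\<omega>. (\<integral>\<^sup>+\<omega>'. F (map \<omega>' [0..<Suc n]) \<partial>trajectory.eP \<pi> x n \<omega>) \<partial>?C n (\<lambda>_. undefined))"
    using trajectory.measurable_eP[of \<pi> x n]
    by (intro nn_integral_bind[OF F]) (simp add: measurable_cong_sets[OF sC(1) refl])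
  also have "\<dots> = (\<integral>\<^sup>+\<omega>. (\<integral>\<^sup>+p. F (map \<omega> [0..<n] @ [p]) \<partial>next_pair \<pi> x n \<omega>) \<partial>?C n (\<lambda>_. undefined))"
  proof (intro nn_integral_cong)
    fix \<omega> assume "\<omega> \<in> space (?C n (\<lambda>_. undefined))"
    then have \<omega>: "\<omega> \<in> space (?M n)" by (simp add: sC)
    have m: "map (fun_upd \<omega> n p) [0..<Suc n] = map \<omega> [0..<n] @ [p]" for p by simp
    show "(\<integral>\<^sup>+\<omega>'. F (map \<omega>' [0..<Suc n]) \<partial>trajectory.eP \<pi> x n \<omega>) =
        (\<integral>\<^sup>+p. F (map \<omega> [0..<n] @ [p]) \<partial>next_pair \<pi> x n \<omega>)"
      unfolding trajectory.nn_integral_eP[OF \<omega> F] m ..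
  qed
  also have "\<dots> = (\<integral>\<^sup>+\<omega>. ?G (map \<omega> [0..<n]) \<partial>?C n (\<lambda>_. undefined))"
    by (intro nn_integral_cong) (simp only: next_pair_eq nn_integral_bind_pmf nn_integral_map_pmf)
  also have "\<dots> = (\<integral>\<^sup>+h. ?G h \<partial>history \<pi> x n)"
    by (rule trans[OF nn_integral_past[where F="?G", symmetric] Suc.IH[where F="?G"]])
  finally show ?case by simp
qed

definition stage_reward :: "strategy \<Rightarrow> state \<Rightarrow> nat \<Rightarrow> ennreal" where
  "stage_reward \<pi> x n = (\<integral>\<^sup>+h. (\<integral>\<^sup>+y. (\<integral>\<^sup>+a. reward y a \<partial>\<pi> h y) \<partial>next_state x h) \<partial>history \<pi> x n)"

lemma total_reward_suminf: "total_reward x \<pi> = (\<Sum>n. stage_reward \<pi> x n)"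
proof -
  have *: "(\<lambda>\<omega>. reward (fst (\<omega> n)) (snd (\<omega> n))) =
      (\<lambda>\<omega>. (\<lambda>h. reward (fst (last h)) (snd (last h))) (map \<omega> [0..<Suc n]))" for n by simp
  have m: "(\<lambda>\<omega>. reward (fst (\<omega> n)) (snd (\<omega> n))) \<in> borel_measurable (trajectory_law \<pi> x)" for n
    unfolding * trajectory_law_def measurable_cong_sets[OF trajectory.PF.sets_lim refl]
    by (rule measurable_compose[OF measurable_past]) auto
  have "(\<integral>\<^sup>+\<omega>. reward (fst (\<omega> n)) (snd (\<omega> n)) \<partial>trajectory_law \<pi> x) = stage_reward \<pi> x n" for n
    using nn_integral_history[where F="\<lambda>h. reward (fst (last h)) (snd (last h))" and n="Suc n"]
    by (simp add: stage_reward_def)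
  then show ?thesis
    unfolding total_reward_def nn_integral_suminf[OF m] by simp
qed

lemma set_history_Suc:
  "h' \<in> set_pmf (history \<pi> x (Suc n)) \<longleftrightarrow> (\<exists>h\<in>set_pmf (history \<pi> x n). \<exists>y\<in>set_pmf (next_state x h).
     \<exists>a\<in>set_pmf (\<pi> h y). h' = h @ [(y, a)])"
  by auto

lemma set_roll_pmf:
  assumes "n \<in> {1..5}" "y \<in> set_pmf (roll_pmf \<tau> n)"
  obtains "y = Final" | j where "j \<in> configs" "ndice j \<le> n" "y = after_roll \<tau> n j"
proof -
  have "set_pmf (pmf_of_set (rolls n)) = rolls n"
    using finite_rolls rolls_nonempty by (rule set_pmf_of_set[rotated])
  then have "y \<in> (\<lambda>w. if cfg_of w = (0, 0, 0) then Final else after_roll \<tau> n (cfg_of w)) ` rolls n"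
    using assms(2) by (simp only: roll_pmf_def cfg_pmf_def set_map_pmf image_image)
  then obtain w where w: "w \<in> rolls n"
      "y = (if cfg_of w = (0, 0, 0) then Final else after_roll \<tau> n (cfg_of w))"
    by (elim imageE)
  show ?thesis
    using that w cfg_of_configs[OF w(1) assms(1)] ndice_cfg_of_le[of w] w(1)
    by (cases "cfg_of w = (0, 0, 0)") (auto simp: rolls_def)
qed

lemma score_pos: "j \<in> configs \<Longrightarrow> 0 < score j"
  by (simp add: configs_def)

lemma after_roll_states:
  assumes "n \<in> {1..5}" "j \<in> configs" "ndice j \<le> n"
  shows "after_roll \<tau> n j \<in> states"
  using assms score_pos[OF assms(2)] by (auto simp: after_roll_def St_states)

lemma trans_states:
  assumes "y \<in> states" "a \<in> actions y" "z \<in> set_pmf (trans_pmf y a)"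
  shows "z \<in> states"
proof -
  have roll: "z \<in> states" if "z \<in> set_pmf (roll_pmf \<tau> n)" "n \<in> {1..5}" for \<tau> n
    by (rule set_roll_pmf[OF that(2,1)]) (use after_roll_states that in \<open>auto simp: states_def\<close>)
  show ?thesis
  proof (cases y)
    case Init
    then show ?thesis using assms roll[of 0 5] by simp
  next
    case Final
    then show ?thesis using assms by (simp add: states_def)
  next
    case (St \<tau> i n)
    then have n: "n \<in> {1..5}" using assms(1) by (simp add: St_states)
    show ?thesis
      using assms(2,3) roll[OF _ n, of \<tau>] St by (cases a) (auto simp: states_def)
  qed
qed

lemma history_support:
  assumes "\<pi> \<in> strategies" "x \<in> states" "h \<in> set_pmf (history \<pi> x n)"
  shows "set h \<subseteq> {(y, a). y \<in> states \<and> a \<in> actions y}"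
    and "set_pmf (next_state x h) \<subseteq> states"
proof -
  have ns: "set_pmf (next_state x h) \<subseteq> states"
    if "set h \<subseteq> {(y, a). y \<in> states \<and> a \<in> actions y}" for h
  proof (cases "h = []")
    case True
    then show ?thesis using assms(2) by (simp add: next_state_def)
  next
    case False
    then have "last h \<in> set h" by simp
    then show ?thesis
      using that trans_states[of "fst (last h)" "snd (last h)"] False
      by (fastforce simp: next_state_def)
  qed
  show 1: "set h \<subseteq> {(y, a). y \<in> states \<and> a \<in> actions y}"
    using assms(3)
  proof (induction n arbitrary: h)
    case (Suc n)
    obtain h' y a where h: "h' \<in> set_pmf (history \<pi> x n)" "y \<in> set_pmf (next_state x h')"
        "a \<in> set_pmf (\<pi> h' y)" "h = h' @ [(y, a)]"
      using Suc.prems unfolding set_history_Suc by blast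
    then show ?case
      using Suc.IH[OF h(1)] ns[OF Suc.IH[OF h(1)]] assms(1) unfolding strategies_def by fastforce
  qed simp
  show "set_pmf (next_state x h) \<subseteq> states" by (rule ns[OF 1])
qed

lemma nn_integral_pmf_mono:
  "(\<And>x. x \<in> set_pmf p \<Longrightarrow> f x \<le> g x) \<Longrightarrow> (\<integral>\<^sup>+x. f x \<partial>measure_pmf p) \<le> (\<integral>\<^sup>+x. g x \<partial>measure_pmf p)"
  by (intro nn_integral_mono_AE) (simp add: AE_measure_pmf_iff)

lemma nn_integral_pmf_cong:
  "(\<And>x. x \<in> set_pmf p \<Longrightarrow> f x = g x) \<Longrightarrow> (\<integral>\<^sup>+x. f x \<partial>measure_pmf p) = (\<integral>\<^sup>+x. g x \<partial>measure_pmf p)"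
  by (intro nn_integral_cong_AE) (simp add: AE_measure_pmf_iff)

definition remaining :: "strategy \<Rightarrow> state \<Rightarrow> (state \<Rightarrow> ennreal) \<Rightarrow> nat \<Rightarrow> ennreal" where
  "remaining \<pi> x W n = (\<integral>\<^sup>+h. (\<integral>\<^sup>+y. W y \<partial>next_state x h) \<partial>history \<pi> x n)"

lemma stage_reward_remaining:
  "(\<integral>\<^sup>+h. (\<integral>\<^sup>+y. (\<integral>\<^sup>+a. reward y a + (\<integral>\<^sup>+z. W z \<partial>trans_pmf y a) \<partial>\<pi> h y) \<partial>next_state x h)
     \<partial>history \<pi> x n) = stage_reward \<pi> x n + remaining \<pi> x W (Suc n)"
proof -
  have "(\<integral>\<^sup>+z. W z \<partial>next_state x (h @ [(y, a)])) = (\<integral>\<^sup>+z. W z \<partial>trans_pmf y a)" for h y a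
    by (simp add: next_state_def)
  then show ?thesis
    by (simp add: stage_reward_def remaining_def nn_integral_add)
qed

lemma remaining_0: "remaining \<pi> x W 0 = W x"
  by (simp add: remaining_def next_state_def)

text \<open>Rewards before stage \<open>n\<close> plus the expectation of \<open>W\<close> at stage \<open>n\<close> decrease in \<open>n\<close>, and at stage 0
  they are \<open>W x\<close>; by nonnegativity of \<open>W\<close> the rewards alone stay below \<open>W x\<close>.\<close>

theorem total_reward_le:
  assumes \<pi>: "\<pi> \<in> strategies" and x: "x \<in> states"
    and W: "\<And>y a. y \<in> states \<Longrightarrow> a \<in> actions y \<Longrightarrow>
      reward y a + (\<integral>\<^sup>+z. W z \<partial>trans_pmf y a) \<le> W y"
  shows "total_reward x \<pi> \<le> W x"
proof -
  have step: "stage_reward \<pi> x n + remaining \<pi> x W (Suc n) \<le> remaining \<pi> x W n" for n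
    unfolding stage_reward_remaining[symmetric] unfolding remaining_def
  proof (intro nn_integral_pmf_mono)
    fix h y assume h: "h \<in> set_pmf (history \<pi> x n)" and y: "y \<in> set_pmf (next_state x h)"
    have y': "y \<in> states" using history_support(2)[OF \<pi> x h] y by blast
    have "set_pmf (\<pi> h y) \<subseteq> actions y"
      using history_support(1)[OF \<pi> x h] y' \<pi> unfolding strategies_def by blast
    then have "(\<integral>\<^sup>+a. reward y a + (\<integral>\<^sup>+z. W z \<partial>trans_pmf y a) \<partial>\<pi> h y) \<le> (\<integral>\<^sup>+a. W y \<partial>\<pi> h y)"
      using W[OF y'] by (intro nn_integral_pmf_mono) blast
    then show "(\<integral>\<^sup>+a. reward y a + (\<integral>\<^sup>+z. W z \<partial>trans_pmf y a) \<partial>\<pi> h y) \<le> W y" by simp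
  qed
  have "(\<Sum>k<n. stage_reward \<pi> x k) + remaining \<pi> x W n \<le> W x" for n
  proof (induction n)
    case (Suc n)
    have "(\<Sum>k<Suc n. stage_reward \<pi> x k) + remaining \<pi> x W (Suc n) \<le>
        (\<Sum>k<n. stage_reward \<pi> x k) + remaining \<pi> x W n"
      using step[of n] by (simp add: add.assoc add_left_mono)
    also note Suc.IH
    finally show ?case .
  qed (simp add: remaining_0)
  then have "(\<Sum>k<n. stage_reward \<pi> x k) \<le> W x" for n
    by (metis add_increasing2 order.trans le_iff_add)
  then show ?thesis
    unfolding total_reward_suminf by (intro suminf_le_const summableI)
qed

lemma pure_stationary_strategy:
  "(\<And>y. y \<in> states \<Longrightarrow> g y \<in> actions y) \<Longrightarrow> pure_stationary g \<in> strategies"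
  by (simp add: strategies_def pure_stationary_def)

text \<open>With equality in each step nothing is lost until the rank \<open>\<rho>\<close>, which drops at every step, has
  reached 0; there \<open>W\<close> vanishes, so that all of \<open>W x\<close> has been collected as reward.\<close>

theorem total_reward_pure_stationary_ge:
  assumes x: "x \<in> states" and g: "\<And>y. y \<in> states \<Longrightarrow> g y \<in> actions y"
    and W: "\<And>y. y \<in> states \<Longrightarrow> W y \<le> reward y (g y) + (\<integral>\<^sup>+z. W z \<partial>trans_pmf y (g y))"
    and W0: "\<And>y. y \<in> states \<Longrightarrow> \<rho> y = (0::nat) \<Longrightarrow> W y = 0"
    and \<rho>: "\<And>y z. y \<in> states \<Longrightarrow> z \<in> set_pmf (trans_pmf y (g y)) \<Longrightarrow> \<rho> z = 0 \<or> \<rho> z < \<rho> y"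
  shows "W x \<le> total_reward x (pure_stationary g)"
proof -
  let ?\<pi> = "pure_stationary g"
  have \<pi>: "?\<pi> \<in> strategies" by (rule pure_stationary_strategy[OF g])
  have step: "remaining ?\<pi> x W n \<le> stage_reward ?\<pi> x n + remaining ?\<pi> x W (Suc n)" for n
    unfolding stage_reward_remaining[symmetric] unfolding remaining_def
  proof (intro nn_integral_pmf_mono)
    fix h y assume h: "h \<in> set_pmf (history ?\<pi> x n)" and y: "y \<in> set_pmf (next_state x h)"
    have "y \<in> states" using history_support(2)[OF \<pi> x h] y by blast
    then show "W y \<le> (\<integral>\<^sup>+a. reward y a + (\<integral>\<^sup>+z. W z \<partial>trans_pmf y a) \<partial>?\<pi> h y)"
      using W by (simp add: pure_stationary_def)
  qed
  have sum: "W x \<le> (\<Sum>k<n. stage_reward ?\<pi> x k) + remaining ?\<pi> x W n" for n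
  proof (induction n)
    case (Suc n)
    note Suc.IH
    also have "(\<Sum>k<n. stage_reward ?\<pi> x k) + remaining ?\<pi> x W n \<le>
        (\<Sum>k<Suc n. stage_reward ?\<pi> x k) + remaining ?\<pi> x W (Suc n)"
      using step[of n] by (simp add: add.assoc add_left_mono)
    finally show ?case .
  qed (simp add: remaining_0)
  have rank: "\<rho> y = 0 \<or> \<rho> y + n \<le> \<rho> x"
    if "h \<in> set_pmf (history ?\<pi> x n)" "y \<in> set_pmf (next_state x h)" for h y n
    using that
  proof (induction n arbitrary: h y)
    case 0
    then show ?case by (simp add: next_state_def)
  next
    case (Suc n)
    from Suc.prems(1) obtain h' y' a where h: "h' \<in> set_pmf (history ?\<pi> x n)"
        "y' \<in> set_pmf (next_state x h')" "a \<in> set_pmf (?\<pi> h' y')" "h = h' @ [(y', a)]"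
      unfolding set_history_Suc by blast
    have y': "y' \<in> states" using history_support(2)[OF \<pi> x h(1)] h(2) by blast
    have "y \<in> set_pmf (trans_pmf y' (g y'))"
      using Suc.prems(2) h(3,4) by (simp add: next_state_def pure_stationary_def)
    from \<rho>[OF y' this] Suc.IH[OF h(1,2)] show ?case by auto
  qed
  have "remaining ?\<pi> x W (Suc (\<rho> x)) = 0"
  proof -
    have "(\<integral>\<^sup>+y. W y \<partial>next_state x h) = 0" if h: "h \<in> set_pmf (history ?\<pi> x (Suc (\<rho> x)))" for h
    proof -
      have "W y = 0" if y: "y \<in> set_pmf (next_state x h)" for y
      proof (rule W0)
        show "y \<in> states" using history_support(2)[OF \<pi> x h] y by blast
        show "\<rho> y = 0" using rank[OF h y] by simp
      qed
      then show ?thesis by (subst nn_integral_pmf_cong[where g="\<lambda>_. 0"]) auto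
    qed
    then show ?thesis
      unfolding remaining_def by (subst nn_integral_pmf_cong[where g="\<lambda>_. 0"]) auto
  qed
  then have "W x \<le> (\<Sum>k<Suc (\<rho> x). stage_reward ?\<pi> x k)"
    using sum[of "Suc (\<rho> x)"] by simp
  also have "\<dots> \<le> total_reward x ?\<pi>"
    unfolding total_reward_suminf by (intro sum_le_suminf summableI) auto
  finally show ?thesis .
qed

section \<open>Configurations\<close>

lemma count_combs: "count (combs (a, b, k)) x = (case x of SFive \<Rightarrow> a | SOne \<Rightarrow> b |
    Triple l \<Rightarrow> if k \<noteq> 0 \<and> l = k then 1 else 0)"
  by (cases x) auto

lemma combs_inject: "combs i = combs j \<longleftrightarrow> i = j"
proof
  assume eq: "combs i = combs j"
  obtain a b k a' b' k' where ij: "i = (a, b, k)" "j = (a', b', k')"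
    by (metis prod_cases3)
  have "count (combs i) x = count (combs j) x" for x
    using eq by simp
  from this[of SFive] this[of SOne] this[of "Triple k"] this[of "Triple k'"] show "i = j"
    unfolding count_combs ij by (auto split: if_splits)
qed simp

text \<open>Replaces the comparison of multisets by componentwise inequalities, on which arithmetic works.\<close>

lemma smaller_iff: "(f', o', t') \<prec> (f, os, t) \<longleftrightarrow> (f', o', t') \<noteq> (0, 0, 0) \<and> f' \<le> f \<and> o' \<le> os \<and>
    (t' = 0 \<or> t' = t) \<and> (f', o', t') \<noteq> (f, os, t)"
proof -
  have sub: "combs (f', o', t') \<subseteq># combs (f, os, t) \<longleftrightarrow> f' \<le> f \<and> o' \<le> os \<and> (t' = 0 \<or> t' = t)"
    (is "?l \<longleftrightarrow> ?r")
  proof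
    assume l: ?l
    have "count (combs (f', o', t')) x \<le> count (combs (f, os, t)) x" for x
      using l by (rule mset_subset_eq_count)
    from this[of SFive] this[of SOne] this[of "Triple t'"] show ?r
      unfolding count_combs by (auto split: if_splits)
  next
    assume ?r
    then show ?l unfolding subseteq_mset_def count_combs by (auto split: comb.splits)
  qed
  have "combs (f', o', t') = {#} \<longleftrightarrow> (f', o', t') = (0, 0, 0)"
    using combs_inject[of "(f', o', t')" "(0, 0, 0)"] by simp
  then show ?thesis
    unfolding smaller_def subset_mset.less_le sub combs_inject by blast
qed

lemma smaller_score: "j \<prec> i \<Longrightarrow> score j < score i"
  by (cases i; cases j) (auto simp: smaller_iff)

lemma smaller_ndice: "j \<prec> i \<Longrightarrow> ndice j < ndice i"
  by (cases i; cases j) (auto simp: smaller_iff)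

lemma smaller_ncomb: "j \<prec> i \<Longrightarrow> 1 < ncomb i"
  by (cases i; cases j) (auto simp: smaller_iff)

lemma smaller_trans: "k \<prec> j \<Longrightarrow> j \<prec> i \<Longrightarrow> k \<prec> i"
  by (auto simp: smaller_def)

text \<open>Every triple of numbers that fits on five dice is rolled by an explicit word: fives and ones as
  demanded and three dice showing \<open>t\<close>.\<close>

lemma configs_iff: "(f, os, t) \<in> configs \<longleftrightarrow>
    t \<in> {0, 2, 3, 4, 6} \<and> (f, os, t) \<noteq> (0, 0, 0) \<and> ndice (f, os, t) \<le> 5"
proof
  assume "(f, os, t) \<in> configs"
  then obtain n w where s: "score (f, os, t) \<noteq> 0" and n: "n \<in> {1..5}"
      and w: "w \<in> rolls n" "cfg_of w = (f, os, t)"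
    by (auto simp: configs_def ways_def card_gt_0_iff)
  have l: "length w \<le> 5" using w(1) n by (simp add: rolls_def)
  have "(\<Sum>k\<in>{2, 3, 4, 6}. count_list w k) \<le> length w" by (rule sum_count_list_le) simp
  then have "t \<in> {0, 2, 3, 4, 6}" using w(2) l by (auto simp: cfg_of_def split: if_splits)
  then show "t \<in> {0, 2, 3, 4, 6} \<and> (f, os, t) \<noteq> (0, 0, 0) \<and> ndice (f, os, t) \<le> 5"
    using s ndice_cfg_of_le[of w] w(2) l by (auto split: if_splits)
next
  assume *: "t \<in> {0, 2, 3, 4, 6} \<and> (f, os, t) \<noteq> (0, 0, 0) \<and> ndice (f, os, t) \<le> 5"
  let ?w = "replicate f 5 @ replicate os 1 @ replicate (if t \<noteq> 0 then 3 else 0) t"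
  have cr: "count_list (replicate m a) b = (if a = b then m else 0)" for m and a b :: nat
    by (induction m) auto
  have "cfg_of ?w = (f, os, t)" using * by (auto simp: cfg_of_def cr)
  moreover have "?w \<in> rolls (ndice (f, os, t))" "ndice (f, os, t) \<in> {1..5}"
    using * by (auto simp: rolls_def)
  ultimately show "(f, os, t) \<in> configs" using cfg_of_configs[of ?w] * by metis
qed

lemma smaller_configs: "j \<prec> i \<Longrightarrow> i \<in> configs \<Longrightarrow> j \<in> configs"
  by (cases i; cases j) (auto simp: smaller_iff configs_iff split: if_splits)

lemma ndice_pos: "i \<in> configs \<Longrightarrow> 0 < ndice i"
  by (cases i) (auto simp: configs_iff)

lemma ndice_le_score: "i \<in> configs \<Longrightarrow> ndice i \<le> score i"
  by (cases i) (auto simp: configs_iff)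

definition cfgs :: "cfg list" where
  "cfgs = filter (\<lambda>i. i \<noteq> (0, 0, 0) \<and> ndice i \<le> 5)
     (List.product [0, 1, 2, 3, 4, 5] (List.product [0, 1, 2, 3, 4, 5] [0, 2, 3, 4, 6]))"

lemma set_cfgs: "set cfgs = configs"
proof -
  have six: "x \<in> set [0, 1, 2, 3, 4, 5] \<longleftrightarrow> x \<le> 5" for x :: nat by auto
  have "(f, os, t) \<in> set cfgs \<longleftrightarrow> (f, os, t) \<in> configs" for f os t
    unfolding cfgs_def set_filter set_product mem_Collect_eq mem_Times_iff fst_conv snd_conv six
      configs_iff by auto
  then show ?thesis by auto
qed

lemma finite_configs: "finite configs"
  by (simp add: set_cfgs[symmetric])

section \<open>The distribution of the configuration of a roll\<close>

text \<open>Words of dice are grouped by their sorted arrangement, which determines the configuration.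
  Adding one die to a sorted word by insertion makes the number of groups grow polynomially (126 for
  four dice) and keeps the enumeration of all \<open>6\<^sup>5\<close> outcomes out of the evaluation.\<close>

fun tally_add :: "'a \<Rightarrow> int \<Rightarrow> ('a \<times> int) list \<Rightarrow> ('a \<times> int) list" where
  "tally_add x c [] = [(x, c)]"
| "tally_add x c ((y, d) # ts) = (if x = y then (y, c + d) # ts else (y, d) # tally_add x c ts)"

definition add_die :: "(nat list \<Rightarrow> 'a) \<Rightarrow> (nat list \<times> int) list \<Rightarrow> ('a \<times> int) list" where
  "add_die f ts =
     fold (\<lambda>(w, c). fold (\<lambda>d. tally_add (f (insort d w)) c) [1, 2, 3, 4, 5, 6]) ts []"

primrec roll_tally :: "nat \<Rightarrow> (nat list \<times> int) list" where
  "roll_tally 0 = [([], 1)]"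
| "roll_tally (Suc n) = add_die (\<lambda>w. w) (roll_tally n)"

text \<open>The last die is added directly to configurations, whose list (at most 45 entries) is much shorter
  than that of sorted words.\<close>

definition cfg_tally :: "nat \<Rightarrow> (cfg \<times> int) list" where
  "cfg_tally n = add_die cfg_of (roll_tally (n - 1))"

definition tally_sum :: "('a \<Rightarrow> real) \<Rightarrow> ('a \<times> int) list \<Rightarrow> real" where
  "tally_sum F ts = (\<Sum>(w, c)\<leftarrow>ts. real_of_int c * F w)"

lemma tally_sum_add: "tally_sum F (tally_add x c ts) = tally_sum F ts + c * F x"
  by (induction ts) (auto simp: tally_sum_def algebra_simps)

lemma tally_sum_add_die:
  "tally_sum F (add_die f ts) = tally_sum (\<lambda>w. \<Sum>d\<in>{1..6}. F (f (insort d w))) ts"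
proof -
  have inner: "tally_sum F (fold (\<lambda>d. tally_add (f (insort d w)) c) ds us) =
      tally_sum F us + c * (\<Sum>d\<leftarrow>ds. F (f (insort d w)))" for w c ds us
    by (induction ds arbitrary: us) (simp_all add: tally_sum_add algebra_simps)
  have six: "{1..6} = set [1, 2, 3, 4, 5, 6 :: nat]" by auto
  have d: "(\<Sum>d\<leftarrow>[1, 2, 3, 4, 5, 6]. F (f (insort d w))) = (\<Sum>d\<in>{1..6}. F (f (insort d w)))" for w
    unfolding six by (rule sum.distinct_set_conv_list[symmetric]) simp
  have "tally_sum F (fold (\<lambda>(w, c). fold (\<lambda>d. tally_add (f (insort d w)) c) ds) ts us) =
      tally_sum F us + tally_sum (\<lambda>w. \<Sum>d\<leftarrow>ds. F (f (insort d w))) ts" for us ds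
  proof (induction ts arbitrary: us)
    case (Cons p ts)
    obtain w c where p: "p = (w, c)" by fastforce
    show ?case
      unfolding fold_Cons comp_def p case_prod_conv Cons.IH inner by (simp add: tally_sum_def)
  qed (simp add: tally_sum_def)
  then show ?thesis by (simp only: add_die_def d) (simp add: tally_sum_def)
qed

lemma sum_rolls_Suc: "(\<Sum>w\<in>rolls (Suc n). F w) = (\<Sum>w\<in>rolls n. \<Sum>d\<in>{1..6}. F (d # w))"
proof -
  have "rolls (Suc n) = (\<lambda>(w, d). d # w) ` (rolls n \<times> {1..6})"
    by (fastforce simp: rolls_def length_Suc_conv)
  moreover have "inj_on (\<lambda>(w, d). d # w) (rolls n \<times> {1..6})"
    by (auto simp: inj_on_def)
  ultimately show ?thesis
    by (simp add: sum.reindex sum.cartesian_product case_prod_unfold)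
qed

lemma tally_sum_roll_tally:
  "(\<And>v w. mset v = mset w \<Longrightarrow> F v = F w) \<Longrightarrow> tally_sum F (roll_tally n) = (\<Sum>w\<in>rolls n. F w)"
proof (induction n arbitrary: F)
  case 0
  have "rolls 0 = {[]}" by (auto simp: rolls_def)
  then show ?case by (simp add: tally_sum_def)
next
  case (Suc n)
  have "tally_sum F (roll_tally (Suc n)) = tally_sum (\<lambda>w. \<Sum>d\<in>{1..6}. F (d # w)) (roll_tally n)"
    unfolding roll_tally.simps tally_sum_add_die
    by (intro arg_cong2[where f=tally_sum] ext sum.cong refl Suc.prems) simp
  also have "\<dots> = (\<Sum>w\<in>rolls n. \<Sum>d\<in>{1..6}. F (d # w))"
    by (intro Suc.IH sum.cong refl Suc.prems) simp
  finally show ?case by (simp add: sum_rolls_Suc)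
qed

lemma cfg_of_mset: "mset v = mset w \<Longrightarrow> cfg_of v = cfg_of w"
  by (simp add: cfg_of_def count_mset[symmetric])

lemma tally_sum_cfg_tally:
  assumes "1 \<le> n"
  shows "tally_sum h (cfg_tally n) = (\<Sum>w\<in>rolls n. h (cfg_of w))"
proof -
  obtain m where n: "n = Suc m" using assms by (cases n) auto
  have "tally_sum h (cfg_tally n) = tally_sum (\<lambda>w. \<Sum>d\<in>{1..6}. h (cfg_of (insort d w))) (roll_tally m)"
    by (simp add: n cfg_tally_def tally_sum_add_die)
  also have "\<dots> = (\<Sum>w\<in>rolls m. \<Sum>d\<in>{1..6}. h (cfg_of (insort d w)))"
    by (intro tally_sum_roll_tally sum.cong refl arg_cong[where f=h] cfg_of_mset) simp
  also have "\<dots> = (\<Sum>w\<in>rolls m. \<Sum>d\<in>{1..6}. h (cfg_of (d # w)))"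
    by (intro sum.cong refl arg_cong[where f=h] cfg_of_mset) simp
  finally show ?thesis by (simp add: n sum_rolls_Suc)
qed

text \<open>Both sides average \<open>h\<close> over the scoring outcomes; the right one is what the tallies compute.\<close>

lemma sum_ways:
  assumes "n \<in> {1..5}"
  shows "(\<Sum>k\<in>configs. real (ways n k) * h k) =
    (\<Sum>w\<in>rolls n. if cfg_of w = (0, 0, 0) then 0 else h (cfg_of w))"
proof -
  have c: "cfg_of w \<in> configs \<longleftrightarrow> cfg_of w \<noteq> (0, 0, 0)" if "w \<in> rolls n" for w
    using cfg_of_configs[OF that assms] by (auto simp: configs_iff)
  have "real (ways n k) * h k = (\<Sum>w\<in>rolls n. if cfg_of w = k then h k else 0)" for k
  proof -
    have "(\<Sum>w\<in>rolls n. if cfg_of w = k then h k else 0) = (\<Sum>w\<in>{w \<in> rolls n. cfg_of w = k}. h k)"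
      by (rule sum.inter_filter[symmetric]) (rule finite_rolls)
    then show ?thesis by (simp add: ways_def)
  qed
  then have "(\<Sum>k\<in>configs. real (ways n k) * h k) =
      (\<Sum>k\<in>configs. \<Sum>w\<in>rolls n. if cfg_of w = k then h k else 0)" by simp
  also have "\<dots> = (\<Sum>w\<in>rolls n. \<Sum>k\<in>configs. if cfg_of w = k then h k else 0)"
    by (rule sum.swap)
  also have "\<dots> = (\<Sum>w\<in>rolls n. if cfg_of w = (0, 0, 0) then 0 else h (cfg_of w))"
    using c by (intro sum.cong) (auto simp: sum.delta' finite_configs)
  finally show ?thesis .
qed

text \<open>Makes the sum over a set executable for the simplifier.\<close>

lemma cfg_of_code [code]: "cfg_of w = (count_list w 5, count_list w 1,
    \<Sum>k\<leftarrow>[2, 3, 4, 6]. if 3 \<le> count_list w k then k else 0)"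
  by (simp add: cfg_of_def)

section \<open>The candidate value function\<close>

definition moves :: "nat \<Rightarrow> cfg \<Rightarrow> nat \<Rightarrow> cfg set" where
  "moves \<tau> i n = {j. Move j \<in> actions (St \<tau> i n)}"

text \<open>The value of a state if \<open>R\<close> gives the worths of rolling.  Only single moves appear, and after a move
  only the roll: moving again can be done at once, and stopping is then worse than stopping now.\<close>

definition best :: "(nat \<Rightarrow> nat \<Rightarrow> real) \<Rightarrow> nat \<Rightarrow> cfg \<Rightarrow> nat \<Rightarrow> real" where
  "best R \<tau> i n = (if 56 \<le> \<tau> then real \<tau> else Max ({real \<tau>, R \<tau> n} \<union>
     (\<lambda>j. R (\<tau> + score j - score i) (n + ndice i - ndice j)) ` moves \<tau> i n))"

text \<open>The worth of rolling.  The guard \<open>\<tau> < t \<and> t < 56\<close> makes the recursion well-founded by fiat;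
  \<open>rollv_eq\<close> removes it.\<close>

function rollv :: "nat \<Rightarrow> nat \<Rightarrow> real" where
  "rollv \<tau> n = (\<Sum>k\<in>configs. real (ways n k) / 6 ^ n *
     best (\<lambda>t m. if \<tau> < t \<and> t < 56 then rollv t m else 0) (\<tau> + score k) k
       (n - ndice k + (if n = ndice k then 5 else 0)))"
  by auto
termination by (relation "Wellfounded.measure (\<lambda>(\<tau>, n). 56 - \<tau>)") auto

declare rollv.simps [simp del]

definition vopt :: "nat \<Rightarrow> cfg \<Rightarrow> nat \<Rightarrow> real" where
  "vopt = best rollv"

lemma moves_iff: "j \<in> moves \<tau> i n \<longleftrightarrow> j \<prec> i \<and> n < 5 \<and> j \<in> configs \<and>
    score i < \<tau> + score j \<and> ndice j < n + ndice i \<and> n + ndice i \<le> 5 + ndice j"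
proof -
  have "j \<in> moves \<tau> i n \<longleftrightarrow> j \<prec> i \<and> 1 < ncomb i \<and> n < 5 \<and> after_move \<tau> i n j \<in> states"
    unfolding moves_def actions.simps by blast
  also have "\<dots> \<longleftrightarrow> j \<prec> i \<and> n < 5 \<and> after_move \<tau> i n j \<in> states"
    using smaller_ncomb[of j i] by blast
  also have "after_move \<tau> i n j \<in> states \<longleftrightarrow> j \<in> configs \<and>
      score i < \<tau> + score j \<and> ndice j < n + ndice i \<and> n + ndice i \<le> 5 + ndice j"
    unfolding after_move_def St_states atLeastAtMost_iff by (simp add: Suc_le_eq le_diff_conv conj_ac)
  finally show ?thesis by blast
qed

lemma moves_configs: "moves \<tau> i n \<subseteq> configs"
  by (auto simp: moves_iff)

lemma finite_moves: "finite (moves \<tau> i n)"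
  using finite_subset[OF moves_configs finite_configs] .

lemma best_cong:
  assumes "\<tau> < 56 \<Longrightarrow> R \<tau> n = R' \<tau> n"
    and "\<And>j. \<tau> < 56 \<Longrightarrow> j \<in> moves \<tau> i n \<Longrightarrow>
      R (\<tau> + score j - score i) (n + ndice i - ndice j) = R' (\<tau> + score j - score i) (n + ndice i - ndice j)"
  shows "best R \<tau> i n = best R' \<tau> i n"
proof (cases "56 \<le> \<tau>")
  case False
  then have "(\<lambda>j. R (\<tau> + score j - score i) (n + ndice i - ndice j)) ` moves \<tau> i n =
      (\<lambda>j. R' (\<tau> + score j - score i) (n + ndice i - ndice j)) ` moves \<tau> i n"
    using assms(2) by (intro image_cong refl) simp
  then show ?thesis using False assms(1) by (simp only: best_def)
qed (simp add: best_def)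

text \<open>The guard holds at all arguments that matter: after rolling \<open>k\<close> and moving to \<open>j\<close> the score is
  \<open>\<tau> + score k + score j - score k > \<tau>\<close>.\<close>

lemma rollv_eq:
  "rollv \<tau> n = (\<Sum>k\<in>configs. real (ways n k) / 6 ^ n *
     vopt (\<tau> + score k) k (n - ndice k + (if n = ndice k then 5 else 0)))"
proof -
  have "best (\<lambda>t m. if \<tau> < t \<and> t < 56 then rollv t m else 0) (\<tau> + score k) k m =
      vopt (\<tau> + score k) k m" if k: "k \<in> configs" for k m
    unfolding vopt_def
  proof (rule best_cong)
    assume "\<tau> + score k < 56"
    then show "(if \<tau> < \<tau> + score k \<and> \<tau> + score k < 56 then rollv (\<tau> + score k) m else 0) =
        rollv (\<tau> + score k) m"
      using score_pos[OF k] by simp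
  next
    fix j assume t: "\<tau> + score k < 56" and j: "j \<in> moves (\<tau> + score k) k m"
    have "\<tau> < \<tau> + score k + score j - score k \<and> \<tau> + score k + score j - score k < 56"
      using t j score_pos[of j] smaller_score[of j k] by (auto simp: moves_iff)
    then show "(if \<tau> < \<tau> + score k + score j - score k \<and> \<tau> + score k + score j - score k < 56
        then rollv (\<tau> + score k + score j - score k) (m + ndice k - ndice j) else 0) =
        rollv (\<tau> + score k + score j - score k) (m + ndice k - ndice j)"
      by (rule if_P)
  qed
  then show ?thesis
    by (subst rollv.simps) (intro sum.cong refl, simp only:)
qed

lemma rollv_roll_value: "rollv \<tau> n = roll_value (\<lambda>(\<tau>, i, n). vopt \<tau> i n) \<tau> n"
  unfolding rollv_eq roll_value_def by simp

abbreviation roll_after_move :: "nat \<Rightarrow> cfg \<Rightarrow> nat \<Rightarrow> cfg \<Rightarrow> real" where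
  "roll_after_move \<tau> i n j \<equiv> rollv (\<tau> + score j - score i) (n + ndice i - ndice j)"

abbreviation vopt_after_move :: "nat \<Rightarrow> cfg \<Rightarrow> nat \<Rightarrow> cfg \<Rightarrow> real" where
  "vopt_after_move \<tau> i n j \<equiv> vopt (\<tau> + score j - score i) j (n + ndice i - ndice j)"

section \<open>Evaluation plans\<close>

text \<open>For fixed \<open>n\<close> the recursion for \<open>rollv \<tau> n\<close> has the same shape for all \<open>\<tau>\<close>.  A plan lists, for each
  scoring configuration, its number of outcomes, its score, and the pairs (chips added, dice) at which
  one may go on rolling: after keeping the configuration or any smaller one.\<close>

text \<open>An executable form of \<open>j \<prec> i\<close> for configurations \<open>j\<close>.\<close>

definition below :: "cfg \<Rightarrow> cfg \<Rightarrow> bool" where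
  "below j i \<longleftrightarrow> fst j \<le> fst i \<and> fst (snd j) \<le> fst (snd i) \<and>
     (snd (snd j) = 0 \<or> snd (snd j) = snd (snd i)) \<and> j \<noteq> i"

text \<open>When all dice score, five fresh dice are rolled and no move is available, hence the single pair.\<close>

definition plan :: "nat \<Rightarrow> (int \<times> nat \<times> (nat \<times> nat) list) list" where
  "plan n = map (\<lambda>(k, c). (c, score k, if ndice k = n then [(score k, 5)]
       else (score k, n - ndice k) # map (\<lambda>j. (score j, n - ndice j)) (filter (\<lambda>j. below j k) cfgs)))
     (filter (\<lambda>(k, c). k \<noteq> (0, 0, 0)) (cfg_tally n))"

lemma below_iff: "j \<in> configs \<Longrightarrow> below j i \<longleftrightarrow> j \<prec> i"
  by (cases i; cases j) (auto simp: below_def smaller_iff configs_iff)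

lemma foldr_max_Max: "foldr max xs (x :: 'a :: linorder) = Max (insert x (set xs))"
proof (induction xs)
  case (Cons y xs)
  have "Max (insert x (set (y # xs))) = Max (insert y (insert x (set xs)))"
    by (simp add: insert_commute)
  also have "\<dots> = max y (Max (insert x (set xs)))" by (rule Max_insert) auto
  finally show ?case using Cons by simp
qed simp

text \<open>After a roll a move to any smaller configuration stays inside the state space.\<close>

lemma moves_after_roll:
  assumes "n \<in> {1..5}" "k \<in> configs" "ndice k < n"
  shows "moves (\<tau> + score k) k (n - ndice k) = {j \<in> configs. j \<prec> k}"
proof (intro set_eqI)
  fix j
  show "j \<in> moves (\<tau> + score k) k (n - ndice k) \<longleftrightarrow> j \<in> {j \<in> configs. j \<prec> k}"
    using assms ndice_pos[OF assms(2)] smaller_ndice[of j k] score_pos[of j] ndice_pos[of j]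
    by (cases "j \<in> configs"; cases "j \<prec> k") (simp_all add: moves_iff)
qed

lemma moves_five [simp]: "moves \<tau> i 5 = {}"
  by (auto simp: moves_iff)

text \<open>The contribution of one entry to \<open>6 ^ n * rollv \<tau> n\<close> in a currency with \<open>u\<close> units per chip: \<open>u = 1\<close> for
  real numbers, \<open>u = 10 ^ 9\<close> for the integer table.\<close>

definition plan_value :: "(nat \<Rightarrow> nat \<Rightarrow> 'a :: linordered_idom) \<Rightarrow> 'a \<Rightarrow> nat \<Rightarrow>
    int \<times> nat \<times> (nat \<times> nat) list \<Rightarrow> 'a" where
  "plan_value R u \<tau> = (\<lambda>(c, s, ts). of_int c * (if 56 \<le> \<tau> + s then u * of_nat (\<tau> + s) else
     foldr max (map (\<lambda>(a, m). R (\<tau> + a) m) ts) (u * of_nat (\<tau> + s))))"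

lemma keys_tally_add: "fst ` set (tally_add x c ts) = insert x (fst ` set ts)"
proof (induction ts)
  case (Cons p ts)
  then show ?case by (cases p; cases "x = fst p") (simp_all add: insert_commute)
qed simp

lemma keys_add_die:
  "fst ` set (add_die f ts) = (\<Union>w\<in>fst ` set ts. (\<lambda>d. f (insort d w)) ` set [1, 2, 3, 4, 5, 6])"
proof -
  have inner: "fst ` set (fold (\<lambda>d. tally_add (f (insort d w)) c) ds us) =
      fst ` set us \<union> (\<lambda>d. f (insort d w)) ` set ds" for w c ds us
    by (induction ds arbitrary: us) (auto simp: keys_tally_add)
  have "fst ` set (fold (\<lambda>(w, c). fold (\<lambda>d. tally_add (f (insort d w)) c) ds) ts us) =
      fst ` set us \<union> (\<Union>w\<in>fst ` set ts. (\<lambda>d. f (insort d w)) ` set ds)" for ds us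
  proof (induction ts arbitrary: us)
    case (Cons p ts)
    obtain w c where p: "p = (w, c)" by fastforce
    show ?case
      unfolding fold_Cons comp_def p case_prod_conv Cons.IH inner by auto
  qed simp
  then show ?thesis unfolding add_die_def by (simp only: list.set image_empty Un_empty_left)
qed

lemma insort_rolls: "w \<in> rolls n \<Longrightarrow> d \<in> set [1, 2, 3, 4, 5, 6] \<Longrightarrow> insort d w \<in> rolls (Suc n)"
  by (auto simp: rolls_def set_insort_key)

lemma roll_tally_keys: "fst ` set (roll_tally n) \<subseteq> rolls n"
proof (induction n)
  case 0
  show ?case by (simp add: rolls_def)
next
  case (Suc n)
  then show ?case unfolding roll_tally.simps keys_add_die using insort_rolls by blast
qed

lemma cfg_tally_keys: "1 \<le> n \<Longrightarrow> fst ` set (cfg_tally n) \<subseteq> cfg_of ` rolls n"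
  unfolding cfg_tally_def keys_add_die
  using roll_tally_keys[of "n - 1"] insort_rolls[of _ "n - 1"] by fastforce

lemma rollv_plan:
  assumes n: "n \<in> {1..5}"
  shows "6 ^ n * rollv \<tau> n = (\<Sum>p\<leftarrow>plan n. plan_value rollv 1 \<tau> p)"
proof -
  define h where "h k = (if k = (0, 0, 0) then 0 else
      vopt (\<tau> + score k) k (n - ndice k + (if n = ndice k then 5 else 0)))" for k
  have "6 ^ n * rollv \<tau> n = (\<Sum>k\<in>configs. real (ways n k) *
      vopt (\<tau> + score k) k (n - ndice k + (if n = ndice k then 5 else 0)))"
    unfolding rollv_eq by (simp add: sum_distrib_left)
  also have "\<dots> = (\<Sum>w\<in>rolls n. h (cfg_of w))"
    unfolding sum_ways[OF n] h_def ..
  also have "\<dots> = tally_sum h (cfg_tally n)"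
    using n by (simp add: tally_sum_cfg_tally)
  also have "\<dots> = tally_sum h (filter (\<lambda>(k, c). k \<noteq> (0, 0, 0)) (cfg_tally n))"
    unfolding tally_sum_def by (rule sum_list_map_filter[symmetric]) (auto simp: h_def)
  also have "\<dots> = (\<Sum>p\<leftarrow>plan n. plan_value rollv 1 \<tau> p)"
    unfolding tally_sum_def plan_def map_map
  proof (intro arg_cong[where f=sum_list] map_cong refl)
    fix p assume p: "p \<in> set (filter (\<lambda>(k, c). k \<noteq> (0, 0, 0)) (cfg_tally n))"
    obtain k c where kc: "p = (k, c)" by fastforce
    show "(case p of (w, c) \<Rightarrow> real_of_int c * h w) = (plan_value rollv 1 \<tau> \<circ>
       (\<lambda>(k, c). (c, score k, if ndice k = n then [(score k, 5)]
          else (score k, n - ndice k) # map (\<lambda>j. (score j, n - ndice j)) (filter (\<lambda>j. below j k) cfgs)))) p"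
    proof -
      have "k \<in> cfg_of ` rolls n" "k \<noteq> (0, 0, 0)"
        using p kc n cfg_tally_keys[of n] by force+
      then have k: "k \<in> configs" "ndice k \<le> n" "k \<noteq> (0, 0, 0)"
        using cfg_of_configs[OF _ n] ndice_cfg_of_le by (auto simp: rolls_def)
      show ?thesis
      proof (cases "ndice k = n")
        case True
        then show ?thesis
          using k by (simp add: kc h_def vopt_def best_def plan_value_def max.commute)
      next
        case False
        then have d: "ndice k < n" using k by simp
        have f: "set (filter (\<lambda>j. below j k) cfgs) = {j \<in> configs. j \<prec> k}"
          by (auto simp: set_cfgs below_iff)
        have "best rollv (\<tau> + score k) k (n - ndice k) =
          (if 56 \<le> \<tau> + score k then real (\<tau> + score k) else foldr max (map (\<lambda>(a, m). rollv (\<tau> + a) m)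
            ((score k, n - ndice k) # map (\<lambda>j. (score j, n - ndice j)) (filter (\<lambda>j. below j k) cfgs)))
            (real (\<tau> + score k)))"
          unfolding foldr_max_Max best_def moves_after_roll[OF n k(1) d] set_map list.set f
          using d by (simp add: image_image)
        then show ?thesis
          using False d k by (simp add: kc h_def vopt_def plan_value_def)
      qed
    qed
  qed
  finally show ?thesis .
qed

section \<open>Numerical values\<close>

text \<open>Row \<open>n\<close> approximates \<open>rollv \<tau> n\<close> for \<open>\<tau> = 0, \<dots>, 55\<close>, in units of \<open>10\<^sup>-\<^sup>9\<close> chips.\<close>

definition nano_table :: "int list list" where
  "nano_table =
    [[2326892829, 2576972093, 2831604767, 3099233030, 3377699370, 3657955080, 3938266484, 4218637846,
      4499075647, 4782794873, 5072291078, 5364775052, 5657716050, 5950657063, 6243598092, 6538442495,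
      6838695607, 7144056121, 7451018828, 7757981773, 8064944890, 8371908189, 8678871751, 8985835641,
      9292799951, 9599764816, 9906730288, 10213696281, 10520662746, 10827629832, 11134597982,
      11441569910, 11748554922, 12055564754, 12362589958, 12669616187, 12976643348, 13283671432,
      13590702710, 13897755899, 14204861589, 14512030361, 14819238629, 15126476925, 15433768592,
      15741126411, 16048550383, 16356040508, 16663594470, 16971193416, 17278806584, 17586419753,
      17894032922, 18201646091, 18511059671, 18833333333],
     [2103335446, 2306436921, 2657096073, 3172609075, 3710481372, 4248372944, 4786285582, 5324756198,
      5864736547, 6406177688, 6948192962, 7490284408, 8032375859, 8574784542, 9118411906, 9663791955,
      10210290269, 10757055656, 11303821110, 11850586624, 12397352212, 12944117899, 13490883710,
      14037649683, 14584415851, 15131182206, 15677948727, 16224715430, 16771482413, 17318250204,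
      17865020805, 18411797724, 18958581341, 19505367691, 20052154367, 20598941352, 21145729024,
      21692520879, 22239325137, 22786148658, 23332989276, 23879841481, 24426707586, 24973593612,
      25520501688, 26067431815, 26614383607, 27161353536, 27708333333, 28255315501, 28802297668,
      29349279835, 29896562071, 30446287723, 31000000000, 31555555556],
     [2474325801, 2884471080, 3447027162, 4122869098, 4837145682, 5551584414, 6266465252, 6982027755,
      7698006921, 8414134249, 9130358961, 9846681065, 10563259183, 11280385496, 11998035091,
      12715863135, 13433691239, 14151519396, 14869347609, 15587175891, 16305004320, 17022833434,
      17740663838, 18458495642, 19176328087, 19894161662, 20611996540, 21329832959, 22047671013,
      22765512132, 23483357480, 24201206303, 24919056510, 25636908744, 26354763259, 27072620895,
      27790533477, 28508761409, 29226998485, 29945242476, 30663491931, 31381748631, 32100013535,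
      32818286184, 33536616131, 34255259925, 34973958333, 35692965535, 36412022748, 37131387174,
      37850801612, 38570673297, 39291666667, 40013888889, 40736111111, 41458333333],
     [3722188404, 4338174797, 5020581871, 5743402948, 6475655158, 7211779771, 8000993376, 8839701576,
      9678525830, 10517479925, 11356563870, 12195830555, 13035324559, 13874957923, 14714621262,
      15554284647, 16393948076, 17233611556, 18073275111, 18912938913, 19752603517, 20592269435,
      21431936482, 22271604240, 23111272900, 23950942906, 24790614314, 25630287538, 26469963363,
      27309642268, 28149323250, 28989005948, 29828691014, 30668379329, 31508079750, 32347869368,
      33187869360, 34027874727, 34867884295, 35707897839, 36547915762, 37387937888, 38227996944,
      39068297127, 39908837760, 40749592764, 41590432575, 42431510536, 43272826646, 44114380906,
      44956223327, 45798611111, 46641203704, 47483796296, 48326388889, 49168981481],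
     [5872018918, 6606509847, 7354847128, 8106985429, 8882643173, 9712755008, 10553441213,
      11394289264, 12235309637, 13076517441, 13917936441, 14778832796, 15654913670, 16533736643,
      17412559658, 18291382718, 19170205836, 20060449137, 20971724505, 21892612221, 22813500746,
      23734389890, 24655279448, 25576169685, 26497060822, 27417953022, 28338846682, 29259742211,
      30180639514, 31101538170, 32022438307, 32943340683, 33864247207, 34785172253, 35706157280,
      36627231242, 37548308507, 38469388616, 39390471470, 40311557119, 41232659140, 42153876252,
      43075293283, 43996888883, 44918542889, 45840318660, 46762292889, 47684465576, 48606836721,
      49529406325, 50452160494, 51375000000, 52297839506, 53220679012, 54143518519, 55066358025]]"

definition nano :: "nat \<Rightarrow> nat \<Rightarrow> int" where
  "nano \<tau> n = nano_table ! (n - 1) ! \<tau>"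

lemma upto_56: "[0..<56] =
   [0, 1, 2, 3, 4, 5, 6, 7, 8, 9, 10, 11, 12, 13, 14, 15, 16, 17, 18, 19, 20, 21, 22, 23, 24,
    25, 26, 27, 28, 29, 30, 31, 32, 33, 34, 35, 36, 37, 38, 39, 40, 41, 42, 43, 44, 45, 46, 47,
    48, 49, 50, 51, 52, 53, 54, 55]"
  by code_simp

text \<open>Turns the rows into one rewrite rule per entry, which is far cheaper for the simplifier than
  repeated indexing into long lists.\<close>

lemma nano_row: "length (nano_table ! (n - 1)) = 56 \<Longrightarrow> map (\<lambda>\<tau>. nano \<tau> n) [0..<56] = nano_table ! (n - 1)"
  unfolding nano_def by (metis map_nth)

lemma nano_1: "map (\<lambda>\<tau>. nano \<tau> 1) [0..<56] = nano_table ! 0"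
  and nano_2: "map (\<lambda>\<tau>. nano \<tau> 2) [0..<56] = nano_table ! 1"
  and nano_3: "map (\<lambda>\<tau>. nano \<tau> 3) [0..<56] = nano_table ! 2"
  and nano_4: "map (\<lambda>\<tau>. nano \<tau> 4) [0..<56] = nano_table ! 3"
  and nano_5: "map (\<lambda>\<tau>. nano \<tau> 5) [0..<56] = nano_table ! 4"
  using nano_row[of 1] nano_row[of 2] nano_row[of 3] nano_row[of 4] nano_row[of 5]
  by (simp_all add: nano_table_def)

lemmas nano_simps = nano_1[unfolded upto_56, simplified nano_table_def list.map, simplified]
  nano_2[unfolded upto_56, simplified nano_table_def list.map, simplified]
  nano_3[unfolded upto_56, simplified nano_table_def list.map, simplified]
  nano_4[unfolded upto_56, simplified nano_table_def list.map, simplified]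
  nano_5[unfolded upto_56, simplified nano_table_def list.map, simplified]

text \<open>These five lists contain all that the numerical part uses of the rules of the game.\<close>

lemma plan_1: "plan 1 =
   [(1, 2, [(2, 5)]), (1, 1, [(1, 5)])]"
  by code_simp

lemma plan_2: "plan 2 =
   [(1, 4, [(4, 5)]), (8, 2, [(2, 1)]), (2, 3, [(3, 5)]), (8, 1, [(1, 1)]), (1, 2, [(2, 5)])]"
  by code_simp

lemma plan_3: "plan 3 =
   [(1, 20, [(20, 5)]), (12, 4, [(4, 1), (2, 2)]), (3, 5, [(5, 5)]), (48, 2, [(2, 2)]),
    (24, 3, [(3, 1), (2, 2), (1, 2)]), (3, 4, [(4, 5)]), (1, 4, [(4, 5)]), (48, 1, [(1, 2)]),
    (12, 2, [(2, 1), (1, 2)]), (1, 6, [(6, 5)]), (1, 8, [(8, 5)]), (1, 10, [(10, 5)]),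
    (1, 12, [(12, 5)])]"
  by code_simp

lemma plan_4: "plan 4 =
   [(1, 22, [(22, 5)]), (16, 20, [(20, 1), (2, 3), (4, 2)]), (4, 21, [(21, 5)]),
    (96, 4, [(4, 2), (2, 3)]), (48, 5, [(5, 1), (2, 3), (4, 2), (1, 3), (3, 2)]),
    (6, 6, [(6, 5)]), (4, 6, [(6, 5)]), (240, 2, [(2, 3)]), (192, 3, [(3, 2), (2, 3), (1, 3)]),
    (48, 4, [(4, 1), (2, 3), (1, 3), (3, 2), (2, 2)]), (4, 8, [(8, 5)]), (4, 10, [(10, 5)]),
    (4, 12, [(12, 5)]), (4, 14, [(14, 5)]), (13, 4, [(4, 1)]), (4, 5, [(5, 5)]),
    (240, 1, [(1, 3)]), (96, 2, [(2, 2), (1, 3)]), (13, 6, [(6, 1)]), (13, 8, [(8, 1)]),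
    (16, 10, [(10, 1), (1, 3), (2, 2)]), (13, 12, [(12, 1)]), (4, 7, [(7, 5)]),
    (4, 9, [(9, 5)]), (1, 11, [(11, 5)]), (4, 13, [(13, 5)])]"
  by code_simp

lemma plan_5: "plan 5 =
   [(1, 24, [(24, 5)]), (20, 22, [(22, 1), (2, 4), (4, 3), (20, 2)]), (5, 23, [(23, 5)]),
    (160, 20, [(20, 2), (2, 4), (4, 3)]),
    (80, 21, [(21, 1), (2, 4), (4, 3), (20, 2), (1, 4), (3, 3), (5, 2)]), (10, 22, [(22, 5)]),
    (10, 8, [(8, 5)]), (600, 4, [(4, 3), (2, 4)]),
    (480, 5, [(5, 2), (2, 4), (4, 3), (1, 4), (3, 3)]),
    (120, 6, [(6, 1), (2, 4), (4, 3), (1, 4), (3, 3), (5, 2), (2, 3), (4, 2)]),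
    (10, 10, [(10, 5)]), (10, 12, [(12, 5)]), (10, 14, [(14, 5)]), (10, 16, [(16, 5)]),
    (65, 6, [(6, 1), (4, 2), (2, 4)]), (20, 7, [(7, 5)]), (1020, 2, [(2, 4)]),
    (1200, 3, [(3, 3), (2, 4), (1, 4)]), (480, 4, [(4, 2), (2, 4), (1, 4), (3, 3), (2, 3)]),
    (65, 8, [(8, 1), (6, 2), (2, 4)]), (65, 10, [(10, 1), (8, 2), (2, 4)]),
    (80, 12, [(12, 1), (2, 4), (1, 4), (3, 3), (2, 3), (4, 2), (10, 2)]),
    (65, 14, [(14, 1), (12, 2), (2, 4)]), (20, 9, [(9, 5)]), (20, 11, [(11, 5)]),
    (5, 13, [(13, 5)]), (20, 15, [(15, 5)]), (106, 4, [(4, 2)]),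
    (65, 5, [(5, 1), (4, 2), (1, 4)]), (10, 6, [(6, 5)]), (106, 6, [(6, 2)]),
    (1020, 1, [(1, 4)]), (600, 2, [(2, 3), (1, 4)]), (106, 8, [(8, 2)]),
    (160, 10, [(10, 2), (1, 4), (2, 3)]), (106, 12, [(12, 2)]),
    (65, 7, [(7, 1), (6, 2), (1, 4)]), (65, 9, [(9, 1), (8, 2), (1, 4)]),
    (20, 11, [(11, 1), (1, 4), (2, 3), (10, 2)]), (65, 13, [(13, 1), (12, 2), (1, 4)]),
    (10, 8, [(8, 5)]), (10, 10, [(10, 5)]), (1, 12, [(12, 5)]), (10, 14, [(14, 5)])]"
  by code_simp

text \<open>The table solves the recursion up to one unit.\<close>

definition nano_consistent :: "nat \<Rightarrow> nat \<Rightarrow> bool" where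
  "nano_consistent n \<tau> \<longleftrightarrow>
     \<bar>(\<Sum>p\<leftarrow>plan n. plan_value nano (10 ^ 9) \<tau> p) - 6 ^ n * nano \<tau> n\<bar> \<le> 6 ^ n"

text \<open>Index arithmetic also produces 2 and 3 in successor form, which would not match the table.\<close>

lemmas small_nat = numeral_2_eq_2 [symmetric] numeral_3_eq_3 [symmetric]

lemma nano_consistent_1: "list_all (nano_consistent 1) [0..<56]"
  by (simp add: upto_56 nano_consistent_def plan_1[unfolded One_nat_def] plan_value_def nano_simps small_nat)

lemma nano_consistent_2: "list_all (nano_consistent 2) [0..<56]"
  by (simp add: upto_56 nano_consistent_def plan_2 plan_value_def nano_simps small_nat)

lemma nano_consistent_3: "list_all (nano_consistent 3) [0..<56]"
  by (simp add: upto_56 nano_consistent_def plan_3 plan_value_def nano_simps small_nat)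

lemma nano_consistent_4: "list_all (nano_consistent 4) [0..<56]"
  by (simp add: upto_56 nano_consistent_def plan_4 plan_value_def nano_simps small_nat)

lemma nano_consistent_5: "list_all (nano_consistent 5) [0..<56]"
  by (simp add: upto_56 nano_consistent_def plan_5 plan_value_def nano_simps small_nat)

lemma list_all_upt: "list_all P [0..<n] \<longleftrightarrow> (\<forall>\<tau><n. P \<tau>)"
  by (auto simp: list_all_iff)

lemma dice_induct:
  assumes "n \<in> {1..5 :: nat}" "P 1" "P 2" "P 3" "P 4" "P 5"
  shows "P n"
proof -
  have "n = 1 \<or> n = 2 \<or> n = 3 \<or> n = 4 \<or> n = 5" using assms(1) by auto
  then show ?thesis using assms by blast
qed

lemma nano_consistent: "\<tau> < 56 \<Longrightarrow> n \<in> {1..5} \<Longrightarrow> nano_consistent n \<tau>"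
  using nano_consistent_1 nano_consistent_2 nano_consistent_3 nano_consistent_4 nano_consistent_5
  unfolding list_all_upt by (rule_tac n=n in dice_induct) blast+

text \<open>Nonnegative weights of total at most \<open>6 ^ n\<close>, and offsets \<open>a\<close> with \<open>1 \<le> a\<close>: averaging is then
  nonexpansive and refers to higher scores only.\<close>

definition plan_wf :: "nat \<Rightarrow> bool" where
  "plan_wf n \<longleftrightarrow> list_all (\<lambda>(c, s, ts). 0 \<le> c \<and>
       list_all (\<lambda>(a, m). 1 \<le> a \<and> a \<le> s \<and> m \<in> {1..5}) ts) (plan n) \<and>
     (\<Sum>p\<leftarrow>plan n. fst p) \<le> 6 ^ n"

lemma plan_wf:
  assumes "n \<in> {1..5}"
  shows "plan_wf n"
proof -
  have "plan_wf 1" by (simp add: plan_wf_def plan_1[unfolded One_nat_def])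
  moreover have "plan_wf 2" by (simp add: plan_wf_def plan_2)
  moreover have "plan_wf 3" by (simp add: plan_wf_def plan_3)
  moreover have "plan_wf 4" by (simp add: plan_wf_def plan_4)
  moreover have "plan_wf 5" by (simp add: plan_wf_def plan_5)
  ultimately show ?thesis by (rule dice_induct[OF assms])
qed

text \<open>Taking maxima does not enlarge the distance between corresponding entries.\<close>

lemma foldr_max_error:
  fixes x :: real and y :: int
  assumes "\<And>t. t \<in> set ts \<Longrightarrow> \<bar>u * f t - real_of_int (g t)\<bar> \<le> e"
    and "\<bar>u * x - real_of_int y\<bar> \<le> e" "0 < u"
  shows "\<bar>u * foldr max (map f ts) x - real_of_int (foldr max (map g ts) y)\<bar> \<le> e"
  using assms(1)
proof (induction ts)
  case Nil
  show ?case using assms(2) by simp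
next
  case (Cons t ts)
  have "u * max a b = max (u * a) (u * b)" for a b
    using assms(3) by (simp add: max_mult_distrib_left)
  moreover have "\<bar>u * foldr max (map f ts) x - real_of_int (foldr max (map g ts) y)\<bar> \<le> e"
      "\<bar>u * f t - real_of_int (g t)\<bar> \<le> e"
    using Cons by simp_all
  ultimately show ?case by (simp add: of_int_max)
qed

text \<open>Each step of the downward recursion adds at most one unit to the error.\<close>

lemma nano_error:
  "\<tau> < 56 \<Longrightarrow> n \<in> {1..5} \<Longrightarrow> \<bar>10 ^ 9 * rollv \<tau> n - nano \<tau> n\<bar> \<le> 56 - real \<tau>"
proof (induction "56 - \<tau>" arbitrary: \<tau> n rule: less_induct)
  case less
  define e where "e = 55 - real \<tau>"
  have e: "0 \<le> e" using less.prems(1) by (simp add: e_def)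
  have IH: "\<bar>10 ^ 9 * rollv t m - nano t m\<bar> \<le> e" if "\<tau> < t" "t < 56" "m \<in> {1..5}" for t m
  proof -
    have "\<bar>10 ^ 9 * rollv t m - nano t m\<bar> \<le> 56 - real t"
      using that less.prems(1) by (intro less.hyps) auto
    also have "\<dots> \<le> e" using that by (simp add: e_def)
    finally show ?thesis .
  qed
  have wf: "plan_wf n" by (rule plan_wf[OF less.prems(2)])
  have p: "\<bar>10 ^ 9 * plan_value rollv 1 \<tau> p - real_of_int (plan_value nano (10 ^ 9) \<tau> p)\<bar> \<le> real_of_int (fst p) * e"
    if "p \<in> set (plan n)" for p
  proof -
    obtain c s ts where p: "p = (c, s, ts)" by (metis prod_cases3)
    have c: "0 \<le> c" and ts: "\<And>a m. (a, m) \<in> set ts \<Longrightarrow> 1 \<le> a \<and> a \<le> s \<and> m \<in> {1..5}"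
      using wf that by (auto simp: plan_wf_def list_all_iff p)
    show ?thesis
    proof (cases "56 \<le> \<tau> + s")
      case True
      then show ?thesis using e c by (simp add: p plan_value_def algebra_simps)
    next
      case False
      let ?r = "foldr max (map (\<lambda>(a, m). rollv (\<tau> + a) m) ts) (1 * real (\<tau> + s))"
      let ?q = "foldr max (map (\<lambda>(a, m). nano (\<tau> + a) m) ts) (10 ^ 9 * int (\<tau> + s))"
      have "\<bar>10 ^ 9 * ?r - real_of_int ?q\<bar> \<le> e"
      proof (rule foldr_max_error)
        fix t assume t: "t \<in> set ts"
        obtain a m where am: "t = (a, m)" by fastforce
        then show "\<bar>10 ^ 9 * (case t of (a, m) \<Rightarrow> rollv (\<tau> + a) m) -
            real_of_int (case t of (a, m) \<Rightarrow> nano (\<tau> + a) m)\<bar> \<le> e"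
          using IH[of "\<tau> + a" m] ts[of a m] t False by (simp add: am)
      qed (use e in simp_all)
      then have "c * \<bar>10 ^ 9 * ?r - real_of_int ?q\<bar> \<le> c * e"
        using c by (intro mult_left_mono) auto
      moreover have "c * \<bar>10 ^ 9 * ?r - real_of_int ?q\<bar> =
          \<bar>10 ^ 9 * plan_value rollv 1 \<tau> p - real_of_int (plan_value nano (10 ^ 9) \<tau> p)\<bar>"
        using c False unfolding p plan_value_def
        by (simp add: abs_mult_pos' algebra_simps del: foldr_map)
      ultimately show ?thesis by (simp add: p)
    qed
  qed
  have "\<bar>10 ^ 9 * (6 ^ n * rollv \<tau> n) - real_of_int (\<Sum>p\<leftarrow>plan n. plan_value nano (10 ^ 9) \<tau> p)\<bar> \<le>
      real_of_int (\<Sum>p\<leftarrow>plan n. fst p) * e"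
  proof -
    have "\<bar>10 ^ 9 * (\<Sum>p\<leftarrow>ps. plan_value rollv 1 \<tau> p) -
        real_of_int (\<Sum>p\<leftarrow>ps. plan_value nano (10 ^ 9) \<tau> p)\<bar> \<le> real_of_int (\<Sum>p\<leftarrow>ps. fst p) * e"
      if "set ps \<subseteq> set (plan n)" for ps
      using that
    proof (induction ps)
      case (Cons q ps)
      then show ?case using p[of q] by (simp add: algebra_simps)
    qed simp
    from this[OF order.refl] show ?thesis unfolding rollv_plan[OF less.prems(2)] .
  qed
  also have "\<dots> \<le> 6 ^ n * e"
  proof (rule mult_right_mono[OF _ e])
    have "real_of_int (\<Sum>p\<leftarrow>plan n. fst p) \<le> real_of_int (6 ^ n)"
      using wf unfolding plan_wf_def of_int_le_iff by blast
    then show "real_of_int (\<Sum>p\<leftarrow>plan n. fst p) \<le> 6 ^ n" by simp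
  qed
  finally have 1: "\<bar>10 ^ 9 * (6 ^ n * rollv \<tau> n) -
      real_of_int (\<Sum>p\<leftarrow>plan n. plan_value nano (10 ^ 9) \<tau> p)\<bar> \<le> 6 ^ n * e" .
  have "real_of_int \<bar>(\<Sum>p\<leftarrow>plan n. plan_value nano (10 ^ 9) \<tau> p) - 6 ^ n * nano \<tau> n\<bar> \<le>
      real_of_int (6 ^ n)"
    using nano_consistent[OF less.prems] unfolding nano_consistent_def of_int_le_iff .
  then have 2: "\<bar>real_of_int (\<Sum>p\<leftarrow>plan n. plan_value nano (10 ^ 9) \<tau> p) - 6 ^ n * nano \<tau> n\<bar> \<le> 6 ^ n"
    by simp
  have "\<bar>6 ^ n * (10 ^ 9 * rollv \<tau> n - nano \<tau> n)\<bar> \<le> 6 ^ n * (e + 1)"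
    using 1 2 by (simp add: algebra_simps abs_le_iff)
  then have "\<bar>10 ^ 9 * rollv \<tau> n - nano \<tau> n\<bar> \<le> e + 1"
    by (simp add: abs_mult)
  then show ?case by (simp add: e_def)
qed

lemma rollv_less:
  "\<tau> < 56 \<Longrightarrow> n \<in> {1..5} \<Longrightarrow> real_of_int (nano \<tau> n) + 56 < 10 ^ 9 * x \<Longrightarrow> rollv \<tau> n < x"
  using nano_error[of \<tau> n] by (simp add: abs_le_iff)

lemma rollv_greater:
  "\<tau> < 56 \<Longrightarrow> n \<in> {1..5} \<Longrightarrow> 10 ^ 9 * x < real_of_int (nano \<tau> n) - 56 \<Longrightarrow> x < rollv \<tau> n"
  using nano_error[of \<tau> n] by (simp add: abs_le_iff)

text \<open>The largest score below 56 at which rolling \<open>n\<close> dice is worth more than stopping.\<close>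

definition roll_limit :: "nat \<Rightarrow> nat" where
  "roll_limit n = [3, 3, 6, 18, 55] ! (n - 1)"

text \<open>All gaps in question are larger than the error of 56 units on either side.\<close>

lemma rollv_facts:
  assumes "\<tau> < 56" "n \<in> {1..5}"
  shows "\<tau> \<le> roll_limit n \<Longrightarrow> real \<tau> < rollv \<tau> n"
    and "roll_limit n < \<tau> \<Longrightarrow> rollv \<tau> n < real \<tau>"
    and "n \<noteq> 5 \<Longrightarrow> rollv \<tau> n < real \<tau> + 4"
    and "rollv \<tau> n < 56"
    and "Suc \<tau> < 56 \<Longrightarrow> rollv \<tau> n < rollv (Suc \<tau>) n"
proof -
  define ok where "ok m t \<longleftrightarrow> (t \<le> roll_limit m \<longrightarrow> 10 ^ 9 * int t < nano t m - 56) \<and>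
      (roll_limit m < t \<longrightarrow> nano t m + 56 < 10 ^ 9 * int t) \<and>
      (m \<noteq> 5 \<longrightarrow> nano t m + 56 < 10 ^ 9 * (int t + 4)) \<and> nano t m + 56 < 10 ^ 9 * 56 \<and>
      (t = 55 \<or> nano t m + 56 < nano (Suc t) m - 56)" for m t
  have "list_all (ok 1) [0..<56]"
    by (simp add: upto_56 ok_def nano_simps roll_limit_def small_nat)
  moreover have "list_all (ok 2) [0..<56]"
    by (simp add: upto_56 ok_def nano_simps roll_limit_def small_nat)
  moreover have "list_all (ok 3) [0..<56]"
    by (simp add: upto_56 ok_def nano_simps roll_limit_def small_nat)
  moreover have "list_all (ok 4) [0..<56]"
    by (simp add: upto_56 ok_def nano_simps roll_limit_def small_nat)
  moreover have "list_all (ok 5) [0..<56]"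
    by (simp add: upto_56 ok_def nano_simps roll_limit_def small_nat)
  ultimately have ok: "ok n \<tau>"
    using assms(1) unfolding list_all_upt by (rule_tac dice_induct[OF assms(2)]) blast+
  have up: "rollv t m < x" if "nano t m + 56 < 10 ^ 9 * y" "x = real_of_int y" "t < 56" "m \<in> {1..5}" for t m x y
  proof (rule rollv_less[OF that(3,4)])
    have "real_of_int (nano t m + 56) < real_of_int (10 ^ 9 * y)"
      using that(1) unfolding of_int_less_iff .
    then show "real_of_int (nano t m) + 56 < 10 ^ 9 * x" using that(2) by simp
  qed
  have low: "x < rollv t m" if "10 ^ 9 * y < nano t m - 56" "x = real_of_int y" "t < 56" "m \<in> {1..5}" for t m x y
  proof (rule rollv_greater[OF that(3,4)])
    have "real_of_int (10 ^ 9 * y) < real_of_int (nano t m - 56)"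
      using that(1) unfolding of_int_less_iff .
    then show "10 ^ 9 * x < real_of_int (nano t m) - 56" using that(2) by simp
  qed
  show "\<tau> \<le> roll_limit n \<Longrightarrow> real \<tau> < rollv \<tau> n"
    using ok assms by (intro low[of "int \<tau>"]) (simp_all add: ok_def)
  show "roll_limit n < \<tau> \<Longrightarrow> rollv \<tau> n < real \<tau>"
    using ok assms by (intro up[of _ _ "int \<tau>"]) (simp_all add: ok_def)
  show "n \<noteq> 5 \<Longrightarrow> rollv \<tau> n < real \<tau> + 4"
    using ok assms by (intro up[of _ _ "int \<tau> + 4"]) (simp_all add: ok_def)
  show "rollv \<tau> n < 56"
    using ok assms by (intro up[of _ _ 56]) (simp_all add: ok_def)
  assume S: "Suc \<tau> < 56"
  have "real_of_int (nano \<tau> n + 56) < real_of_int (nano (Suc \<tau>) n - 56)"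
    using ok S unfolding ok_def of_int_less_iff by auto
  then show "rollv \<tau> n < rollv (Suc \<tau>) n"
    using nano_error[OF assms] nano_error[OF S assms(2)] by (simp add: abs_le_iff)
qed

lemma rollv_strict_mono:
  assumes "n \<in> {1..5}" "\<tau> < \<tau>'" "\<tau>' < 56"
  shows "rollv \<tau> n < rollv \<tau>' n"
  using assms(2,3)
proof (induction \<tau>')
  case (Suc t)
  show ?case
  proof (cases "\<tau> = t")
    case True
    then show ?thesis using Suc.prems rollv_facts(5)[of t n] assms(1) by simp
  next
    case False
    then have "rollv \<tau> n < rollv t n" using Suc by simp
    also have "\<dots> < rollv (Suc t) n" using Suc.prems rollv_facts(5)[of t n] assms(1) by simp
    finally show ?thesis .
  qed
qed simp

text \<open>With 56 chips or more the chips at risk outweigh the mean gain of a roll, for each number of dice.\<close>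

lemma rollv_large:
  assumes "56 \<le> \<tau>" "n \<in> {1..5}"
  shows "rollv \<tau> n < real \<tau>"
proof -
  have s: "56 \<le> \<tau> + s" for s using assms(1) by simp
  have r: "56 \<le> real \<tau>" using assms(1) by simp
  have "rollv \<tau> 1 < \<tau>"
    using rollv_plan[of 1 \<tau>] r by (simp add: plan_1[unfolded One_nat_def] plan_value_def s)
  moreover have "rollv \<tau> 2 < \<tau>"
    using rollv_plan[of 2 \<tau>] r by (simp add: plan_2 plan_value_def s)
  moreover have "rollv \<tau> 3 < \<tau>"
    using rollv_plan[of 3 \<tau>] r by (simp add: plan_3 plan_value_def s)
  moreover have "rollv \<tau> 4 < \<tau>"
    using rollv_plan[of 4 \<tau>] r by (simp add: plan_4 plan_value_def s)
  moreover have "rollv \<tau> 5 < \<tau>"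
    using rollv_plan[of 5 \<tau>] r by (simp add: plan_5 plan_value_def s)
  ultimately show ?thesis by (rule dice_induct[OF assms(2)])
qed

section \<open>The value of a state\<close>

lemma vopt_large: "56 \<le> \<tau> \<Longrightarrow> vopt \<tau> i n = real \<tau>"
  by (simp add: vopt_def best_def)

lemma vopt_ge:
  assumes "\<tau> < 56" "y \<in> {real \<tau>, rollv \<tau> n} \<union>
    (\<lambda>j. roll_after_move \<tau> i n j) ` moves \<tau> i n" (is "y \<in> ?S")
  shows "y \<le> vopt \<tau> i n"
proof -
  have "vopt \<tau> i n = Max ?S" using assms(1) by (simp only: vopt_def best_def not_le if_not_P)
  moreover have "y \<le> Max ?S" using assms(2) by (intro Max_ge) (auto simp: finite_moves)
  ultimately show ?thesis by simp
qed

lemma vopt_ge_stop: "real \<tau> \<le> vopt \<tau> i n"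
  using vopt_ge[of \<tau> "real \<tau>"] vopt_large[of \<tau>] by (cases "\<tau> < 56") auto

lemma vopt_ge_roll: "\<tau> < 56 \<Longrightarrow> rollv \<tau> n \<le> vopt \<tau> i n"
  by (rule vopt_ge) simp_all

lemma vopt_ge_move:
  "\<tau> < 56 \<Longrightarrow> j \<in> moves \<tau> i n \<Longrightarrow>
     roll_after_move \<tau> i n j \<le> vopt \<tau> i n"
  by (rule vopt_ge) blast+

lemma vopt_cases:
  obtains "vopt \<tau> i n = real \<tau>" | "\<tau> < 56" "vopt \<tau> i n = rollv \<tau> n"
  | j where "\<tau> < 56" "j \<in> moves \<tau> i n"
      "vopt \<tau> i n = roll_after_move \<tau> i n j"
proof (cases "56 \<le> \<tau>")
  case True
  then show ?thesis using that vopt_large by blast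
next
  case False
  let ?S = "{real \<tau>, rollv \<tau> n} \<union>
    (\<lambda>j. roll_after_move \<tau> i n j) ` moves \<tau> i n"
  have "Max ?S \<in> ?S" by (rule Max_in) (auto simp: finite_moves)
  moreover have "vopt \<tau> i n = Max ?S" using False by (simp only: vopt_def best_def if_False)
  ultimately show ?thesis using that False by force
qed

lemma vopt_nonneg: "0 \<le> vopt \<tau> i n"
  using vopt_ge_stop[of \<tau> i n] by linarith

lemma rollv_nonneg: "0 \<le> rollv \<tau> n"
  unfolding rollv_eq by (intro sum_nonneg mult_nonneg_nonneg vopt_nonneg) auto

lemma moves_dice: "j \<in> moves \<tau> i n \<Longrightarrow> n + ndice i - ndice j \<in> {1..5}"
  by (auto simp: moves_iff)

lemma moves_score:
  "j \<in> moves \<tau> i n \<Longrightarrow> score j < score i \<and> 0 < \<tau> + score j - score i \<and> \<tau> + score j - score i < \<tau>"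
  using smaller_score[of j i] by (auto simp: moves_iff)

text \<open>Two moves in a row have the effect of a single move.\<close>

lemma moves_trans:
  assumes j: "j \<in> moves \<tau> i n"
    and k: "k \<in> moves (\<tau> + score j - score i) j (n + ndice i - ndice j)"
  shows "k \<in> moves \<tau> i n"
    and "\<tau> + score j - score i + score k - score j = \<tau> + score k - score i"
    and "n + ndice i - ndice j + ndice j - ndice k = n + ndice i - ndice k"
proof -
  have j': "j \<prec> i" "n < 5" "score i < \<tau> + score j" "ndice j < n + ndice i"
    using j by (simp_all add: moves_iff)
  have k': "k \<prec> j" "k \<in> configs" "score j < \<tau> + score j - score i + score k"
      "ndice k < n + ndice i - ndice j + ndice j" "n + ndice i - ndice j + ndice j \<le> 5 + ndice k"
    using k by (simp_all only: moves_iff simp_thms)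
  show "k \<in> moves \<tau> i n"
    using j' k' smaller_trans[OF k'(1) j'(1)] by (simp add: moves_iff)
  show "\<tau> + score j - score i + score k - score j = \<tau> + score k - score i"
    using j' by simp
  show "n + ndice i - ndice j + ndice j - ndice k = n + ndice i - ndice k"
    using j' by simp
qed

lemma vopt_less:
  assumes "\<tau> < 56" "real \<tau> < x" "rollv \<tau> n < x"
    and "\<And>j. j \<in> moves \<tau> i n \<Longrightarrow> roll_after_move \<tau> i n j < x"
  shows "vopt \<tau> i n < x"
  by (rule vopt_cases[of \<tau> i n]) (use assms in auto)

lemma vopt_le:
  assumes "real \<tau> \<le> x" "\<tau> < 56 \<Longrightarrow> rollv \<tau> n \<le> x"
    and "\<And>j. \<tau> < 56 \<Longrightarrow> j \<in> moves \<tau> i n \<Longrightarrow>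
      roll_after_move \<tau> i n j \<le> x"
  shows "vopt \<tau> i n \<le> x"
  by (rule vopt_cases[of \<tau> i n]) (use assms in auto)

lemma vopt_move_less:
  assumes "j \<in> moves \<tau> i n" "\<tau> + score j - score i < 56"
    and "real \<tau> \<le> x" "roll_after_move \<tau> i n j < x"
    and "\<And>k. k \<in> moves \<tau> i n \<Longrightarrow> k \<prec> j \<Longrightarrow> roll_after_move \<tau> i n k < x"
  shows "vopt_after_move \<tau> i n j < x"
proof (rule vopt_less)
  show "real (\<tau> + score j - score i) < x" using moves_score[OF assms(1)] assms(3) by linarith
next
  fix k assume k: "k \<in> moves (\<tau> + score j - score i) j (n + ndice i - ndice j)"
  then have "k \<prec> j" by (simp add: moves_iff)
  then show "rollv (\<tau> + score j - score i + score k - score j)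
      (n + ndice i - ndice j + ndice j - ndice k) < x"
    unfolding moves_trans(2,3)[OF assms(1) k] using assms(5) moves_trans(1)[OF assms(1) k] by blast
qed (use assms in auto)

lemma vopt_move_le:
  assumes "\<tau> < 56" "j \<in> moves \<tau> i n"
  shows "vopt_after_move \<tau> i n j \<le> vopt \<tau> i n"
proof (rule vopt_le)
  show "real (\<tau> + score j - score i) \<le> vopt \<tau> i n"
    using moves_score[OF assms(2)] vopt_ge_stop[of \<tau> i n] by linarith
  show "roll_after_move \<tau> i n j \<le> vopt \<tau> i n"
    by (rule vopt_ge_move[OF assms])
  fix k assume k: "k \<in> moves (\<tau> + score j - score i) j (n + ndice i - ndice j)"
  then show "rollv (\<tau> + score j - score i + score k - score j)
      (n + ndice i - ndice j + ndice j - ndice k) \<le> vopt \<tau> i n"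
    unfolding moves_trans(2,3)[OF assms(2) k]
    using vopt_ge_move[OF assms(1) moves_trans(1)[OF assms(2) k]] by blast
qed

text \<open>A move may lead from \<open>\<tau> \<ge> 56\<close> to a score below 56, but there all worths of rolling are below 56, too.\<close>

lemma vopt_move_large:
  assumes "56 \<le> \<tau>" "j \<in> moves \<tau> i n"
  shows "vopt_after_move \<tau> i n j < real \<tau>"
proof (cases "56 \<le> \<tau> + score j - score i")
  case True
  then show ?thesis using moves_score[OF assms(2)] by (simp add: vopt_large)
next
  case False
  have r: "roll_after_move \<tau> i n k < real \<tau>"
    if k: "k \<in> moves \<tau> i n" "\<tau> + score k - score i < 56" for k
    using rollv_facts(4)[OF k(2) moves_dice[OF k(1)]] assms(1) by linarith
  show ?thesis
  proof (rule vopt_move_less[OF assms(2)])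
    fix k assume k: "k \<in> moves \<tau> i n" "k \<prec> j"
    show "roll_after_move \<tau> i n k < real \<tau>"
      using smaller_score[OF k(2)] False by (intro r k(1)) linarith
  qed (use False r[OF assms(2)] in auto)
qed

section \<open>Optimality\<close>

fun value_fn :: "state \<Rightarrow> real" where
  "value_fn Init = rollv 0 5"
| "value_fn Final = 0"
| "value_fn (St \<tau> i n) = vopt \<tau> i n"

text \<open>The reward of an action plus the mean of \<open>value_fn\<close> after it.\<close>

fun worth :: "state \<Rightarrow> act \<Rightarrow> real" where
  "worth Init a = rollv 0 5"
| "worth Final a = 0"
| "worth (St \<tau> i n) Stop = real \<tau>"
| "worth (St \<tau> i n) Roll = rollv \<tau> n"
| "worth (St \<tau> i n) (Move j) = vopt_after_move \<tau> i n j"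

lemma value_fn_nonneg: "0 \<le> value_fn x"
  by (cases x) (simp_all add: vopt_nonneg rollv_nonneg)

lemma roll_integral:
  assumes n: "n \<in> {1..5}"
  shows "(\<integral>\<^sup>+y. ennreal (value_fn y) \<partial>roll_pmf \<tau> n) = ennreal (rollv \<tau> n)"
proof -
  let ?y = "\<lambda>j. if j = (0, 0, 0) then Final else after_roll \<tau> n j"
  have "(\<integral>\<^sup>+y. ennreal (value_fn y) \<partial>roll_pmf \<tau> n) =
      (\<integral>\<^sup>+w. ennreal (value_fn (?y (cfg_of w))) \<partial>pmf_of_set (rolls n))"
    by (simp add: roll_pmf_def cfg_pmf_def)
  also have "\<dots> = (\<Sum>w\<in>rolls n. ennreal (value_fn (?y (cfg_of w)))) / card (rolls n)"
    by (rule nn_integral_pmf_of_set[OF rolls_nonempty finite_rolls])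
  also have "\<dots> = ennreal (\<Sum>w\<in>rolls n. value_fn (?y (cfg_of w))) / ennreal (6 ^ n)"
    using card_rolls[of n] by (simp add: sum_ennreal value_fn_nonneg ennreal_of_nat_eq_real_of_nat)
  also have "\<dots> = ennreal ((\<Sum>w\<in>rolls n. value_fn (?y (cfg_of w))) / 6 ^ n)"
    by (intro divide_ennreal sum_nonneg value_fn_nonneg) simp
  also have "(\<Sum>w\<in>rolls n. value_fn (?y (cfg_of w))) = (\<Sum>w\<in>rolls n. if cfg_of w = (0, 0, 0) then 0
      else vopt (\<tau> + score (cfg_of w)) (cfg_of w) (n - ndice (cfg_of w) + (if n = ndice (cfg_of w) then 5 else 0)))"
    by (intro sum.cong refl) (simp add: after_roll_def)
  also have "\<dots> = (\<Sum>k\<in>configs. real (ways n k) * vopt (\<tau> + score k) k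
      (n - ndice k + (if n = ndice k then 5 else 0)))"
    by (rule sum_ways[OF n, symmetric])
  also have "\<dots> / 6 ^ n = rollv \<tau> n"
    unfolding rollv_eq by (simp add: sum_divide_distrib)
  finally show ?thesis .
qed

lemma worth_integral:
  assumes "x \<in> states" "a \<in> actions x"
  shows "reward x a + (\<integral>\<^sup>+y. ennreal (value_fn y) \<partial>trans_pmf x a) = ennreal (worth x a)"
proof (cases x)
  case Init
  then show ?thesis using assms(2) roll_integral[of 5 0] by simp
next
  case Final
  then show ?thesis using assms(2) by simp
next
  case (St \<tau> i n)
  have n: "n \<in> {1..5}" using assms(1) by (simp add: St St_states)
  show ?thesis
    using roll_integral[OF n, of \<tau>]
    by (cases a) (simp_all add: St after_move_def ennreal_of_nat_eq_real_of_nat)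
qed

lemma worth_le:
  assumes "x \<in> states" "a \<in> actions x"
  shows "worth x a \<le> value_fn x"
proof (cases x)
  case (St \<tau> i n)
  have n: "n \<in> {1..5}" using assms(1) by (simp add: St St_states)
  show ?thesis
  proof (cases a)
    case Roll
    then show ?thesis
      using vopt_ge_roll[of \<tau> n i] rollv_large[of \<tau> n] n vopt_large[of \<tau> i n]
      by (cases "\<tau> < 56") (simp_all add: St)
  next
    case Stop
    then show ?thesis by (simp add: St vopt_ge_stop)
  next
    case (Move j)
    then have "j \<in> moves \<tau> i n" using assms(2) by (simp only: St moves_def mem_Collect_eq)
    then show ?thesis
      using vopt_move_le[of \<tau> j i n] vopt_move_large[of \<tau> j i n] vopt_large[of \<tau> i n]
      by (cases "\<tau> < 56") (simp_all add: St Move)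
  qed
qed (use assms in auto)

text \<open>The order of the tests matters for termination: a roll is preferred to a move of equal worth, so that a
  move is never followed by a move.\<close>

fun policy :: "state \<Rightarrow> act" where
  "policy Init = Roll"
| "policy Final = Stop"
| "policy (St \<tau> i n) = (if vopt \<tau> i n = real \<tau> then Stop else if vopt \<tau> i n = rollv \<tau> n then Roll
     else Move (SOME j. j \<in> moves \<tau> i n \<and>
       vopt \<tau> i n = roll_after_move \<tau> i n j))"

text \<open>Decreases at every step.  The score at which the next roll takes place is higher than that of the last roll,
  even after a move; so two units per chip suffice for a roll and a move.  A move is ranked one above a
  roll at the score to which it leads.\<close>

fun rank :: "state \<Rightarrow> nat" where
  "rank Init = 116"
| "rank Final = 0"
| "rank (St \<tau> i n) = (case policy (St \<tau> i n) of Stop \<Rightarrow> 1 | Roll \<Rightarrow> 2 * (56 - \<tau>) + 2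
     | Move j \<Rightarrow> 2 * (56 - (\<tau> + score j - score i)) + 3)"

lemma policy_St_cases:
  obtains "policy (St \<tau> i n) = Stop" "vopt \<tau> i n = real \<tau>"
  | "policy (St \<tau> i n) = Roll" "\<tau> < 56" "vopt \<tau> i n = rollv \<tau> n"
  | j where "policy (St \<tau> i n) = Move j" "\<tau> < 56" "j \<in> moves \<tau> i n"
      "vopt \<tau> i n = roll_after_move \<tau> i n j"
proof -
  let ?P = "\<lambda>j. j \<in> moves \<tau> i n \<and>
    vopt \<tau> i n = roll_after_move \<tau> i n j"
  consider "vopt \<tau> i n = real \<tau>" | "vopt \<tau> i n \<noteq> real \<tau>" "vopt \<tau> i n = rollv \<tau> n"
    | "vopt \<tau> i n \<noteq> real \<tau>" "vopt \<tau> i n \<noteq> rollv \<tau> n" by blast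
  then show ?thesis
  proof cases
    case 1
    then show ?thesis using that(1) by simp
  next
    case 2
    then have "\<tau> < 56" using vopt_large[of \<tau> i n] by (cases "\<tau> < 56") auto
    then show ?thesis using that(2) 2 by simp
  next
    case 3
    then have t: "\<tau> < 56" using vopt_large[of \<tau> i n] by (cases "\<tau> < 56") auto
    have "\<exists>j. ?P j" by (rule vopt_cases[of \<tau> i n]) (use 3 in blast)+
    then have "?P (SOME j. ?P j)" by (rule someI_ex)
    then show ?thesis using that(3)[of "SOME j. ?P j"] 3 t by simp
  qed
qed

lemma policy_actions: "x \<in> states \<Longrightarrow> policy x \<in> actions x"
proof (cases x)
  case (St \<tau> i n)
  show ?thesis
    unfolding St by (rule policy_St_cases[of \<tau> i n]) (simp_all only: moves_def mem_Collect_eq actions.simps, simp_all)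
qed simp_all

lemma worth_policy:
  assumes "x \<in> states"
  shows "worth x (policy x) = value_fn x"
proof (cases x)
  case (St \<tau> i n)
  show ?thesis
  proof (rule policy_St_cases[of \<tau> i n])
    fix j assume j: "policy (St \<tau> i n) = Move j" "\<tau> < 56" "j \<in> moves \<tau> i n"
      "vopt \<tau> i n = roll_after_move \<tau> i n j"
    have "\<tau> + score j - score i < 56" using moves_score[OF j(3)] j(2) by linarith
    then have "vopt \<tau> i n \<le> vopt_after_move \<tau> i n j"
      using j(4) vopt_ge_roll by metis
    then show ?thesis
      using vopt_move_le[OF j(2,3)] by (simp only: St j(1) worth.simps value_fn.simps)
  qed (simp_all only: St worth.simps value_fn.simps)
qed simp_all

lemma rank_after_roll:
  assumes "n \<in> {1..5}" "y \<in> set_pmf (roll_pmf \<tau> n)" "\<tau> < 56"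
  shows "rank y < 2 * (56 - \<tau>) + 2"
proof (rule set_roll_pmf[OF assms(1,2)])
  fix j assume j: "j \<in> configs" "y = after_roll \<tau> n j"
  define m where "m = n - ndice j + (if n = ndice j then 5 else 0)"
  have y: "y = St (\<tau> + score j) j m" using j by (simp add: after_roll_def m_def)
  show ?thesis
  proof (rule policy_St_cases[of "\<tau> + score j" j m])
    assume "policy (St (\<tau> + score j) j m) = Roll"
    then show ?thesis using score_pos[OF j(1)] assms(3) by (simp add: y del: policy.simps)
  next
    fix k assume k: "policy (St (\<tau> + score j) j m) = Move k" "k \<in> moves (\<tau> + score j) j m"
    then have "0 < score k" using moves_configs score_pos by blast
    then show ?thesis using k assms(3) by (simp add: y del: policy.simps)
  qed (simp add: y del: policy.simps)
qed simp

lemma rank_decreases: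
  assumes "x \<in> states" "y \<in> set_pmf (trans_pmf x (policy x))"
  shows "rank y = 0 \<or> rank y < rank x"
proof (cases x)
  case Init
  then have "rank y < 2 * (56 - 0) + 2"
    using assms(2) by (intro rank_after_roll[of 5]) auto
  then show ?thesis by (simp add: Init)
next
  case Final
  then show ?thesis using assms(2) by simp
next
  case (St \<tau> i n)
  have n: "n \<in> {1..5}" using assms(1) by (simp add: St St_states)
  show ?thesis
  proof (rule policy_St_cases[of \<tau> i n])
    assume "policy (St \<tau> i n) = Stop"
    then show ?thesis using assms(2) by (simp add: St del: policy.simps)
  next
    assume p: "policy (St \<tau> i n) = Roll" "\<tau> < 56"
    then show ?thesis
      using assms(2) rank_after_roll[OF n, of y \<tau>] by (simp add: St del: policy.simps)
  next
    fix j assume j: "policy (St \<tau> i n) = Move j" "\<tau> < 56" "j \<in> moves \<tau> i n"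
      "vopt \<tau> i n = roll_after_move \<tau> i n j"
    let ?\<tau> = "\<tau> + score j - score i" and ?n = "n + ndice i - ndice j"
    have y: "y = St ?\<tau> j ?n"
      using assms(2) by (simp add: St j(1) after_move_def del: policy.simps)
    have "?\<tau> < 56" using moves_score[OF j(3)] j(2) by linarith
    then have "vopt ?\<tau> j ?n = rollv ?\<tau> ?n"
      using vopt_ge_roll[of ?\<tau> ?n j] vopt_move_le[OF j(2,3)] j(4) by linarith
    then have "policy y = Stop \<or> policy y = Roll" by (simp add: y)
    then have "rank y \<le> 2 * (56 - ?\<tau>) + 2" unfolding y rank.simps by auto
    also have "\<dots> < rank x" by (simp add: St j(1) del: policy.simps)
    finally show ?thesis by simp
  qed
qed

lemma total_reward_policy: "x \<in> states \<Longrightarrow> ennreal (value_fn x) \<le> total_reward x (pure_stationary policy)"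
proof (rule total_reward_pure_stationary_ge[where \<rho>=rank])
  fix y assume y: "y \<in> states"
  show "ennreal (value_fn y) \<le> reward y (policy y) +
      (\<integral>\<^sup>+z. ennreal (value_fn z) \<partial>trans_pmf y (policy y))"
    using worth_integral[OF y policy_actions[OF y]] worth_policy[OF y] by simp
  assume "rank y = 0"
  then have "y = Final" by (cases y) (auto split: act.splits if_splits)
  then show "ennreal (value_fn y) = 0" by simp
qed (use policy_actions rank_decreases in auto)

text \<open>The two halves of the verification principle meet at \<^const>\<open>value_fn\<close>.\<close>

theorem opt_value_eq: 
  assumes "x \<in> states"
  shows "opt_value x = ennreal (value_fn x)"
proof (rule antisym)
  show "opt_value x \<le> ennreal (value_fn x)"
    unfolding opt_value_def
  proof (rule SUP_least)
    fix \<pi> assume "\<pi> \<in> strategies"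
    then show "total_reward x \<pi> \<le> ennreal (value_fn x)"
    proof (rule total_reward_le[OF _ assms])
      fix y a assume "y \<in> states" "a \<in> actions y"
      then show "reward y a + (\<integral>\<^sup>+z. ennreal (value_fn z) \<partial>trans_pmf y a) \<le> ennreal (value_fn y)"
        using worth_integral worth_le by (simp add: ennreal_leI)
    qed
  qed
  have "pure_stationary policy \<in> strategies" by (rule pure_stationary_strategy[OF policy_actions])
  then have "total_reward x (pure_stationary policy) \<le> opt_value x"
    unfolding opt_value_def by (rule SUP_upper)
  then show "ennreal (value_fn x) \<le> opt_value x"
    using total_reward_policy[OF assms] by simp
qed

corollary total_reward_policy_eq:
  assumes "x \<in> states"
  shows "total_reward x (pure_stationary policy) = opt_value x"
proof (rule antisym)
  show "total_reward x (pure_stationary policy) \<le> opt_value x"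
    unfolding opt_value_def by (intro SUP_upper pure_stationary_strategy policy_actions)
  show "opt_value x \<le> total_reward x (pure_stationary policy)"
    using total_reward_policy[OF assms] by (simp add: opt_value_eq[OF assms])
qed

lemma action_value_eq:
  assumes "x \<in> states" "a \<in> actions x"
  shows "action_value x a = ennreal (worth x a)"
proof -
  have "(\<integral>\<^sup>+y. opt_value y \<partial>trans_pmf x a) = (\<integral>\<^sup>+y. ennreal (value_fn y) \<partial>trans_pmf x a)"
    by (rule nn_integral_pmf_cong) (rule opt_value_eq[OF trans_states[OF assms]])
  then show ?thesis unfolding action_value_def using worth_integral[OF assms] by simp
qed

lemma worth_nonneg: "0 \<le> worth x a"
  by (cases "(x, a)" rule: worth.cases) (simp_all add: vopt_nonneg rollv_nonneg)

theorem opt_actions_iff: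
  assumes "x \<in> states"
  shows "a \<in> opt_actions x \<longleftrightarrow> a \<in> actions x \<and> worth x a = value_fn x"
proof -
  have "(\<forall>b\<in>actions x. action_value x b \<le> action_value x a) \<longleftrightarrow> worth x a = value_fn x"
    if a: "a \<in> actions x"
  proof
    assume "\<forall>b\<in>actions x. action_value x b \<le> action_value x a"
    then have "action_value x (policy x) \<le> action_value x a" using policy_actions[OF assms] by blast
    then have "value_fn x \<le> worth x a"
      using action_value_eq[OF assms] a policy_actions[OF assms] worth_policy[OF assms]
      by (simp add: ennreal_le_iff worth_nonneg)
    then show "worth x a = value_fn x" using worth_le[OF assms a] by simp
  next
    assume "worth x a = value_fn x"
    then show "\<forall>b\<in>actions x. action_value x b \<le> action_value x a"
      using action_value_eq[OF assms] a worth_le[OF assms] by (simp add: ennreal_leI)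
  qed
  then show ?thesis by (auto simp: opt_actions_def)
qed

lemma Move_actions: "Move j \<in> actions (St \<tau> i n) \<longleftrightarrow> j \<in> moves \<tau> i n"
  by (simp only: moves_def mem_Collect_eq)

lemma opt_actions_Stop:
  assumes x: "St \<tau> i n \<in> states" and roll: "rollv \<tau> n < real \<tau>"
    and move: "\<And>j. j \<in> moves \<tau> i n \<Longrightarrow>
      vopt_after_move \<tau> i n j < real \<tau>"
  shows "opt_value (St \<tau> i n) = of_nat \<tau>" and "opt_actions (St \<tau> i n) = {Stop}"
proof -
  have g: "worth (St \<tau> i n) a < real \<tau>" if "a \<in> actions (St \<tau> i n)" "a \<noteq> Stop" for a
    using that roll move by (cases a) (auto simp only: worth.simps Move_actions)
  have v: "vopt \<tau> i n = real \<tau>"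
  proof (rule ccontr)
    assume "vopt \<tau> i n \<noteq> real \<tau>"
    moreover have "worth (St \<tau> i n) (policy (St \<tau> i n)) = vopt \<tau> i n"
      using worth_policy[OF x] by (simp only: value_fn.simps)
    ultimately show False
      using g[OF policy_actions[OF x]] vopt_ge_stop[of \<tau> i n] worth.simps(3)[of \<tau> i n] by force
  qed
  then show "opt_value (St \<tau> i n) = of_nat \<tau>"
    by (simp add: opt_value_eq[OF x] ennreal_of_nat_eq_real_of_nat)
  show "opt_actions (St \<tau> i n) = {Stop}"
  proof (intro set_eqI iffI)
    fix a assume "a \<in> opt_actions (St \<tau> i n)"
    then have "a \<in> actions (St \<tau> i n)" "worth (St \<tau> i n) a = real \<tau>"
      unfolding opt_actions_iff[OF x] value_fn.simps v by blast+
    then show "a \<in> {Stop}" using g[of a] by fastforce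
  next
    fix a assume "a \<in> {Stop}"
    then show "a \<in> opt_actions (St \<tau> i n)" by (simp add: opt_actions_iff[OF x] v)
  qed
qed

lemma opt_actions_large:
  assumes "St \<tau> i n \<in> states" "56 \<le> \<tau>"
  shows "opt_value (St \<tau> i n) = of_nat \<tau>" and "opt_actions (St \<tau> i n) = {Stop}"
proof -
  have "n \<in> {1..5}" using assms(1) by (simp add: St_states)
  note * = opt_actions_Stop[OF assms(1) rollv_large[OF assms(2) this] vopt_move_large[OF assms(2)]]
  show "opt_value (St \<tau> i n) = of_nat \<tau>" "opt_actions (St \<tau> i n) = {Stop}"
    by (rule *, assumption)+
qed

section \<open>The table of values\<close>

text \<open>Each of the dice that are neither available nor part of \<open>i\<close> has earned at least one chip, in addition
  to the score of \<open>i\<close>.  This excludes the small scores below the columns of the table.\<close>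

lemma reachable_score: "reachable (St \<tau> i n) \<Longrightarrow> St \<tau> i n \<in> states \<and> score i + 5 \<le> \<tau> + n + ndice i"
proof -
  let ?ok = "\<lambda>y. case y of St \<tau> i n \<Rightarrow> score i + 5 \<le> \<tau> + n + ndice i | _ \<Rightarrow> True"
  have roll: "?ok y" if "y \<in> set_pmf (roll_pmf \<tau> n)" "n \<in> {1..5}" "5 \<le> \<tau> + n" for y \<tau> n
    by (rule set_roll_pmf[OF that(2,1)]) (use that(3) in \<open>auto simp: after_roll_def\<close>)
  have "y \<in> states \<and> ?ok y" if "reachable y" for y
    using that
  proof induction
    case 1
    show ?case by (simp add: states_def)
  next
    case (2 x a y)
    have "y \<in> states" using 2 trans_states by blast
    moreover have "?ok y"
    proof (cases x)
      case Init
      then show ?thesis using "2.hyps"(2,3) roll[of y 0 5] by simp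
    next
      case Final
      then show ?thesis using "2.hyps"(2,3) by simp
    next
      case (St \<tau> i n)
      then have x: "St \<tau> i n \<in> states" "score i + 5 \<le> \<tau> + n + ndice i" using "2.IH" by simp_all
      then have i: "i \<in> configs" and n: "n \<in> {1..5}" by (simp_all add: St_states)
      show ?thesis
      proof (cases a)
        case Roll
        then show ?thesis
          using "2.hyps"(3) roll[OF _ n, of y \<tau>] x(2) ndice_le_score[OF i] by (simp add: St)
      next
        case Stop
        then show ?thesis using "2.hyps"(3) by (simp add: St)
      next
        case (Move j)
        then have "j \<in> moves \<tau> i n" using "2.hyps"(2) unfolding St Move_actions[symmetric] by simp
        then have "score i < \<tau> + score j" "ndice j < n + ndice i" by (simp_all add: moves_iff)
        then show ?thesis using "2.hyps"(3) x(2) by (simp add: St Move after_move_def)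
      qed
    qed
    ultimately show ?case ..
  qed
  then show "reachable (St \<tau> i n) \<Longrightarrow> ?thesis" by fastforce
qed

lemma resign_eq: "combs i = combs j + R \<Longrightarrow> resign R i = Move j"
  unfolding resign_def by (auto simp: combs_inject intro!: the_equality)

lemma smaller_score_ndice: "j \<prec> i \<Longrightarrow> i \<in> configs \<Longrightarrow> score j + ndice i \<le> score i + ndice j"
  by (cases i; cases j) (auto simp: smaller_iff configs_iff split: if_splits)

text \<open>Three or more dice worth at most 3 chips could only be three fives, and those carry a bonus.\<close>

lemma smaller_score_3:
  "j \<prec> i \<Longrightarrow> i \<in> configs \<Longrightarrow> ndice j + 3 \<le> ndice i \<Longrightarrow> score j + 4 \<le> score i"
  by (cases i; cases j) (auto simp: smaller_iff configs_iff split: if_splits)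

lemma roll_optimal:
  assumes "St \<tau> i n \<in> states" "\<tau> < 56" "\<tau> \<le> roll_limit n" "moves \<tau> i n = {}"
  shows "vopt \<tau> i n = rollv \<tau> n" and "Roll \<in> opt_actions (St \<tau> i n)"
proof -
  have "n \<in> {1..5}" using assms(1) by (simp add: St_states)
  then have "real \<tau> < rollv \<tau> n" using rollv_facts(1) assms(2,3) by blast
  then show v: "vopt \<tau> i n = rollv \<tau> n"
    using assms by (intro antisym vopt_le vopt_ge_roll) auto
  show "Roll \<in> opt_actions (St \<tau> i n)" by (simp add: opt_actions_iff[OF assms(1)] v)
qed

lemma move_optimal:
  assumes x: "St \<tau> i n \<in> states" and t: "\<tau> < 56" and j: "j \<in> moves \<tau> i n"
    and v: "v = roll_after_move \<tau> i n j"
    and le: "real \<tau> \<le> v" "rollv \<tau> n \<le> v"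
      "\<And>k. k \<in> moves \<tau> i n \<Longrightarrow> roll_after_move \<tau> i n k \<le> v"
  shows "vopt \<tau> i n = v" and "Move j \<in> opt_actions (St \<tau> i n)"
proof -
  show v': "vopt \<tau> i n = v"
    using le vopt_ge_move[OF t j] unfolding v[symmetric] by (intro antisym vopt_le) auto
  have "\<tau> + score j - score i < 56" using moves_score[OF j] t by linarith
  then have "v \<le> vopt_after_move \<tau> i n j"
    unfolding v by (rule vopt_ge_roll)
  then have "worth (St \<tau> i n) (Move j) = v"
    using vopt_move_le[OF t j] v' by simp
  then show "Move j \<in> opt_actions (St \<tau> i n)"
    unfolding opt_actions_iff[OF x] Move_actions value_fn.simps v' using j by blast
qed

lemma stop_optimal:
  assumes x: "St \<tau> i n \<in> states" and t: "\<tau> < 56" "roll_limit n < \<tau>"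
    and m: "\<And>j. j \<in> moves \<tau> i n \<Longrightarrow>
      roll_after_move \<tau> i n j < real \<tau>"
  shows "opt_value (St \<tau> i n) = of_nat \<tau> \<and> opt_actions (St \<tau> i n) = {Stop}"
proof -
  have n: "n \<in> {1..5}" using x by (simp add: St_states)
  have r: "rollv \<tau> n < real \<tau>" using rollv_facts(2) t n by blast
  have v: "vopt_after_move \<tau> i n j < real \<tau>" if j: "j \<in> moves \<tau> i n" for j
  proof (rule vopt_move_less[OF j _ _ m[OF j]])
    show "\<tau> + score j - score i < 56" using moves_score[OF j] t by linarith
  qed (use m in auto)
  show ?thesis using opt_actions_Stop[OF x r v] by blast
qed

text \<open>The slack 112 covers the error of 56 units on both sides.\<close>

lemma rollv_le:
  assumes "nano t m + 112 \<le> nano t' m'" "t < 56" "t' < 56" "m \<in> {1..5}" "m' \<in> {1..5}"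
  shows "rollv t m \<le> rollv t' m'"
proof -
  have "real_of_int (nano t m + 112) \<le> real_of_int (nano t' m')"
    using assms(1) unfolding of_int_le_iff .
  then show ?thesis
    using nano_error[OF assms(2,4)] nano_error[OF assms(3,5)] by (simp add: abs_le_iff)
qed

text \<open>A move pays only if the roll after it gains more than the chips given up; these bounds on the gain exclude
  that for large scores.\<close>

lemma rollv_gain:
  assumes "t < 56"
  shows "13 \<le> t \<Longrightarrow> rollv t 4 < real t + 1" and "7 \<le> t \<Longrightarrow> rollv t 4 < real t + 2"
    and "3 \<le> t \<Longrightarrow> rollv t 4 < real t + 3" and "rollv t 4 < real t + 4"
    and "4 \<le> t \<Longrightarrow> rollv t 3 < real t + 1" and "1 \<le> t \<Longrightarrow> rollv t 3 < real t + 2"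
    and "2 \<le> t \<Longrightarrow> rollv t 2 < real t + 1"
proof -
  define ok where "ok m a d t \<longleftrightarrow> (a \<le> t \<longrightarrow> nano t m + 56 < 10 ^ 9 * (int t + d))" for m a d and t :: nat
  have up: "rollv t m < real t + real_of_int d" if "ok m a d t" "a \<le> t" "m \<in> {1..5}" for m a d
  proof (rule rollv_less[OF assms that(3)])
    have "real_of_int (nano t m + 56) < real_of_int (10 ^ 9 * (int t + d))"
      using that(1,2) unfolding ok_def of_int_less_iff by blast
    then show "real_of_int (nano t m) + 56 < 10 ^ 9 * (real t + real_of_int d)" by simp
  qed
  have "list_all (ok 4 13 1) [0..<56]" "list_all (ok 4 7 2) [0..<56]" "list_all (ok 4 3 3) [0..<56]"
      "list_all (ok 4 0 4) [0..<56]" "list_all (ok 3 4 1) [0..<56]" "list_all (ok 3 1 2) [0..<56]"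
      "list_all (ok 2 2 1) [0..<56]"
    by (simp_all add: upto_56 ok_def nano_simps small_nat)
  then have ok: "ok 4 13 1 t" "ok 4 7 2 t" "ok 4 3 3 t" "ok 4 0 4 t" "ok 3 4 1 t" "ok 3 1 2 t" "ok 2 2 1 t"
    using assms unfolding list_all_upt by blast+
  show "13 \<le> t \<Longrightarrow> rollv t 4 < real t + 1" using up[OF ok(1)] by simp
  show "7 \<le> t \<Longrightarrow> rollv t 4 < real t + 2" using up[OF ok(2)] by simp
  show "3 \<le> t \<Longrightarrow> rollv t 4 < real t + 3" using up[OF ok(3)] by simp
  show "rollv t 4 < real t + 4" using up[OF ok(4)] by simp
  show "4 \<le> t \<Longrightarrow> rollv t 3 < real t + 1" using up[OF ok(5)] by simp
  show "1 \<le> t \<Longrightarrow> rollv t 3 < real t + 2" using up[OF ok(6)] by simp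
  show "2 \<le> t \<Longrightarrow> rollv t 2 < real t + 1" using up[OF ok(7)] by simp
qed

text \<open>Rounding to three decimals allows \<open>500000\<close> units, of which 56 are reserved for the error of the table.\<close>

primrec row_close :: "nat \<Rightarrow> nat \<Rightarrow> real list \<Rightarrow> bool" where
  "row_close m t [] \<longleftrightarrow> True"
| "row_close m t (v # vs) \<longleftrightarrow> \<bar>real_of_int (nano t m) - 10 ^ 9 * v\<bar> \<le> 499944 \<and> row_close m (Suc t) vs"

lemma row_close:
  assumes "row_close m t vs" "k < length vs" "t + k < 56" "m \<in> {1..5}"
  shows "\<bar>rollv (t + k) m - vs ! k\<bar> \<le> 1 / 2000"
proof -
  have "row_close m t vs \<Longrightarrow> k < length vs \<Longrightarrow> \<bar>real_of_int (nano (t + k) m) - 10 ^ 9 * (vs ! k)\<bar> \<le> 499944"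
  proof (induction vs arbitrary: t k)
    case (Cons v vs)
    then show ?case using Cons.IH[of "Suc t" "k - 1"] by (cases k) auto
  qed simp
  then have "\<bar>real_of_int (nano (t + k) m) - 10 ^ 9 * (vs ! k)\<bar> \<le> 499944" using assms by blast
  then show ?thesis
    using nano_error[OF assms(3,4)] unfolding abs_le_iff by (simp add: field_simps)
qed

lemma rounds_to_3: "0 \<le> r \<Longrightarrow> \<bar>r - v\<bar> \<le> 1 / 2000 \<Longrightarrow> rounds_to 3 (ennreal r) v"
  unfolding rounds_to_def by (intro exI[of _ r]) simp

text \<open>A column whose listed states are all worth a roll with \<open>m\<close> dice after giving up \<open>\<delta>\<close> chips.\<close>

lemma table_columnI:
  assumes n: "n \<in> {1..5}" and C: "C \<subseteq> configs" and t0: "1 \<le> \<tau>0" and d: "\<delta> \<le> \<tau>0"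
    and unreach: "\<And>i \<tau>. i \<in> C \<Longrightarrow> \<tau> < \<tau>0 \<Longrightarrow> reachable (St \<tau> i n) \<Longrightarrow> False"
    and row: "row_close m (\<tau>0 - \<delta>) vs" "m \<in> {1..5}" "\<tau>0 + length vs \<le> 56"
    and listed: "\<And>i \<tau>. i \<in> C \<Longrightarrow> \<tau>0 \<le> \<tau> \<Longrightarrow> \<tau> < \<tau>0 + length vs \<Longrightarrow>
      vopt \<tau> i n = rollv (\<tau> - \<delta>) m \<and> real \<tau> < rollv (\<tau> - \<delta>) m \<and> a i \<in> opt_actions (St \<tau> i n)"
    and rest: "\<And>i \<tau>. i \<in> C \<Longrightarrow> \<tau>0 + length vs \<le> \<tau> \<Longrightarrow> \<tau> < 56 \<Longrightarrow>
      opt_value (St \<tau> i n) = of_nat \<tau> \<and> opt_actions (St \<tau> i n) = {Stop}"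
  shows "table_column n C a \<tau>0 vs"
  unfolding table_column_def Let_def
proof (intro ballI conjI allI impI)
  fix i k assume i: "i \<in> C" and k: "k < length vs"
  have x: "cell_state (\<tau>0 + k, i, n) = St (\<tau>0 + k) i n" using t0 by simp
  have "St (\<tau>0 + k) i n \<in> states" using i C n t0 by (auto simp: St_states)
  then have v: "opt_value (St (\<tau>0 + k) i n) = ennreal (rollv (\<tau>0 + k - \<delta>) m)"
    using listed[OF i, of "\<tau>0 + k"] k by (simp add: opt_value_eq)
  have "\<tau>0 + k - \<delta> = \<tau>0 - \<delta> + k" using d by simp
  then have "\<bar>rollv (\<tau>0 + k - \<delta>) m - vs ! k\<bar> \<le> 1 / 2000"
    using row_close[OF row(1) k _ row(2)] row(3) k by simp
  then show "rounds_to 3 (opt_value (cell_state (\<tau>0 + k, i, n))) (vs ! k)"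
    unfolding x v by (intro rounds_to_3 rollv_nonneg)
  have "real (\<tau>0 + k) < rollv (\<tau>0 + k - \<delta>) m" using listed[OF i, of "\<tau>0 + k"] k by simp
  then show "of_nat (\<tau>0 + k) < opt_value (cell_state (\<tau>0 + k, i, n))"
    unfolding x v ennreal_of_nat_eq_real_of_nat by (intro ennreal_lessI) auto
  show "a i \<in> opt_actions (cell_state (\<tau>0 + k, i, n))"
    unfolding x using listed[OF i, of "\<tau>0 + k"] k by simp
next
  fix i \<tau> assume "i \<in> C" "\<tau> < \<tau>0"
  then show "\<not> reachable (St \<tau> i n)" using unreach by blast
next
  fix i \<tau> assume "i \<in> C" "\<tau>0 + length vs \<le> \<tau> \<and> \<tau> < 56"
  then show "opt_value (St \<tau> i n) = of_nat \<tau>" "opt_actions (St \<tau> i n) = {Stop}"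
    using rest by blast+
qed

text \<open>Without available moves the choice is between rolling and stopping, and \<^const>\<open>roll_limit\<close> decides.\<close>

lemma roll_column:
  assumes n: "n \<in> {1..5}" and C: "C \<subseteq> configs" and t0: "1 \<le> \<tau>0"
    and unreach: "\<And>i \<tau>. i \<in> C \<Longrightarrow> \<tau> < \<tau>0 \<Longrightarrow> reachable (St \<tau> i n) \<Longrightarrow> False"
    and row: "row_close n \<tau>0 vs" and lim: "\<tau>0 + length vs = Suc (roll_limit n)"
    and m: "\<And>i \<tau>. i \<in> C \<Longrightarrow> moves \<tau> i n = {}"
  shows "table_column n C (\<lambda>i. Roll) \<tau>0 vs"
proof (rule table_columnI[where \<delta>=0 and m=n, OF n C t0 _ unreach])
  have l: "roll_limit n \<le> 55" using n by (rule dice_induct) (simp_all add: roll_limit_def)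
  then show "\<tau>0 + length vs \<le> 56" using lim by simp
  show "row_close n (\<tau>0 - 0) vs" using row by simp
  fix i \<tau> assume i: "i \<in> C"
  show "vopt \<tau> i n = rollv (\<tau> - 0) n \<and> real \<tau> < rollv (\<tau> - 0) n \<and> Roll \<in> opt_actions (St \<tau> i n)"
    if "\<tau>0 \<le> \<tau>" "\<tau> < \<tau>0 + length vs"
  proof -
    have x: "St \<tau> i n \<in> states" using i C n t0 that by (auto simp: St_states)
    have t: "\<tau> < 56" "\<tau> \<le> roll_limit n" using that lim l by auto
    show ?thesis using roll_optimal[OF x t m[OF i]] rollv_facts(1)[OF t(1) n t(2)] by simp
  qed
  show "opt_value (St \<tau> i n) = of_nat \<tau> \<and> opt_actions (St \<tau> i n) = {Stop}"
    if "\<tau>0 + length vs \<le> \<tau>" "\<tau> < 56"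
    using i C n t0 that lim m[OF i] by (intro stop_optimal) (auto simp: St_states)
qed (use n in auto)

lemma value_Init: "opt_value Init = ennreal (rollv 0 5)" and Roll_Init: "Roll \<in> opt_actions Init"
  by (simp_all add: opt_value_eq opt_actions_iff states_def)

lemma table_5:
  assumes row: "row_close 5 0 vs" and l: "length vs = 56"
  shows "table_column 5 configs (\<lambda>i. Roll) 0 vs"
  unfolding table_column_def Let_def
proof (intro ballI conjI allI impI)
  fix i k assume i: "i \<in> configs" and k: "k < length vs"
  have t: "k < 56" "k \<le> roll_limit 5" using k l by (simp_all add: roll_limit_def)
  have v: "opt_value (cell_state (0 + k, i, 5)) = ennreal (rollv k 5) \<and>
      Roll \<in> opt_actions (cell_state (0 + k, i, 5))"
  proof (cases "k = 0")
    case True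
    then show ?thesis by (simp add: value_Init Roll_Init)
  next
    case False
    then have "St k i 5 \<in> states" using i by (simp add: St_states)
    then show ?thesis using roll_optimal[OF _ t] False by (simp add: opt_value_eq)
  qed
  have "\<bar>rollv k 5 - vs ! k\<bar> \<le> 1 / 2000" using row_close[OF row k] t by simp
  then show "rounds_to 3 (opt_value (cell_state (0 + k, i, 5))) (vs ! k)"
    using v by (simp only: rounds_to_3 rollv_nonneg)
  have "real k < rollv k 5" using rollv_facts(1)[OF t(1) _ t(2)] by simp
  then have "of_nat k < ennreal (rollv k 5)"
    unfolding ennreal_of_nat_eq_real_of_nat by (intro ennreal_lessI) auto
  then show "of_nat (0 + k) < opt_value (cell_state (0 + k, i, 5))" using v by simp
  show "Roll \<in> opt_actions (cell_state (0 + k, i, 5))" using v by blast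
qed (use l in auto)

lemma table_4:
  assumes "row_close 4 1 vs" "length vs = 18"
  shows "table_column 4 (configs_upto 1) (\<lambda>i. Roll) 1 vs"
proof (rule roll_column)
  fix i \<tau> assume i: "i \<in> configs_upto 1"
  show "moves \<tau> i 4 = {}"
    using i smaller_ndice ndice_pos by (fastforce simp: configs_upto_def moves_iff)
  show False if "\<tau> < 1" "reachable (St \<tau> i 4)"
    using that reachable_score[of \<tau> i 4] by (simp add: St_states)
qed (use assms in \<open>auto simp: configs_upto_def roll_limit_def\<close>)

lemma table_3_other:
  assumes "row_close 3 2 vs" "length vs = 5"
  shows "table_column 3 (configs_upto 2 - {(2, 0, 0), (1, 1, 0), (0, 2, 0)}) (\<lambda>i. Roll) 2 vs"
proof (rule roll_column)
  fix i \<tau> assume i: "i \<in> configs_upto 2 - {(2, 0, 0), (1, 1, 0), (0, 2, 0)}"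
  have i': "i = (1, 0, 0) \<or> i = (0, 1, 0)"
    using i by (cases i) (auto simp: configs_upto_def configs_iff split: if_splits)
  then show "moves \<tau> i 3 = {}"
    using smaller_ndice ndice_pos by (fastforce simp: moves_iff)
  show False if "\<tau> < 2" "reachable (St \<tau> i 3)"
    using that reachable_score[of \<tau> i 3] i' by auto
qed (use assms in \<open>auto simp: configs_upto_def roll_limit_def\<close>)

lemma table_2_one_five:
  assumes "row_close 2 3 vs" "length vs = 1"
  shows "table_column 2 {(1, 0, 0)} (\<lambda>i. Roll) 3 vs"
proof (rule roll_column)
  fix i \<tau> assume i: "i \<in> {(1, 0, 0) :: cfg}"
  then show "moves \<tau> i 2 = {}"
    using smaller_ndice ndice_pos by (fastforce simp: moves_iff)
  show False if "\<tau> < 3" "reachable (St \<tau> i 2)"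
    using that reachable_score[of \<tau> i 2] i by auto
qed (use assms in \<open>auto simp: configs_iff roll_limit_def\<close>)

lemma nat_le_1_2: "x \<le> 2 \<longleftrightarrow> x = 0 \<or> x = 1 \<or> x = 2" "x \<le> 1 \<longleftrightarrow> x = 0 \<or> x = 1" for x :: nat
  by auto

lemma smaller_few_dice:
  "j \<prec> (2, 0, 0) \<Longrightarrow> j \<in> {(1, 0, 0)}"
  "j \<prec> (1, 1, 0) \<Longrightarrow> j \<in> {(1, 0, 0), (0, 1, 0)}"
  "j \<prec> (0, 2, 0) \<Longrightarrow> j \<in> {(0, 1, 0)}"
  "j \<prec> (2, 1, 0) \<Longrightarrow> j \<in> {(1, 0, 0), (2, 0, 0), (0, 1, 0), (1, 1, 0)}"
  "j \<prec> (1, 2, 0) \<Longrightarrow> j \<in> {(1, 0, 0), (0, 1, 0), (0, 2, 0), (1, 1, 0)}"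
  by (cases j; auto simp: smaller_iff nat_le_1_2)+

lemma small_cfg_simps:
  "score (1, 0, 0) = 1" "score (0, 1, 0) = 2" "score (2, 0, 0) = 2" "score (1, 1, 0) = 3"
  "score (0, 2, 0) = 4" "score (2, 1, 0) = 4" "score (1, 2, 0) = 5"
  "ndice (1, 0, 0) = 1" "ndice (0, 1, 0) = 1" "ndice (2, 0, 0) = 2" "ndice (1, 1, 0) = 2"
  "ndice (0, 2, 0) = 2" "ndice (2, 1, 0) = 3" "ndice (1, 2, 0) = 3"
  by simp_all

lemma small_differences:
  fixes x :: nat
  shows "x + 1 - 2 = x - 1" "x + 1 - 3 = x - 2" "x + 2 - 3 = x - 1" "x + 2 - 4 = x - 2"
    "x + 1 - 4 = x - 3" "x + 3 - 4 = x - 1" "x + 1 - 5 = x - 4" "x + 2 - 5 = x - 3"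
    "x + 4 - 5 = x - 1" "x + 3 - 5 = x - 2" "x + 2 - 1 = x + 1" "x + 3 - 1 = x + 2" "x + 3 - 2 = x + 1"
  by simp_all

text \<open>The worths of rolling after any of the moves from the configurations with moves in the table.\<close>

lemma moves_small:
  "j \<in> moves \<tau> (2, 0, 0) n \<Longrightarrow> roll_after_move \<tau> (2, 0, 0) n j \<in>
     {rollv (\<tau> - 1) (n + 1)}"
  "j \<in> moves \<tau> (1, 1, 0) n \<Longrightarrow> roll_after_move \<tau> (1, 1, 0) n j \<in>
     {rollv (\<tau> - 1) (n + 1), rollv (\<tau> - 2) (n + 1)}"
  "j \<in> moves \<tau> (0, 2, 0) n \<Longrightarrow> roll_after_move \<tau> (0, 2, 0) n j \<in>
     {rollv (\<tau> - 2) (n + 1)}"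
  "j \<in> moves \<tau> (2, 1, 0) n \<Longrightarrow> roll_after_move \<tau> (2, 1, 0) n j \<in>
     {rollv (\<tau> - 1) (n + 1), rollv (\<tau> - 2) (n + 1), rollv (\<tau> - 2) (n + 2), rollv (\<tau> - 3) (n + 2)}"
  "j \<in> moves \<tau> (1, 2, 0) n \<Longrightarrow> roll_after_move \<tau> (1, 2, 0) n j \<in>
     {rollv (\<tau> - 1) (n + 1), rollv (\<tau> - 2) (n + 1), rollv (\<tau> - 3) (n + 2), rollv (\<tau> - 4) (n + 2)}"
  unfolding moves_iff
  by (elim conjE, drule smaller_few_dice, elim insertE emptyE,
      simp_all only: small_cfg_simps small_differences insert_iff simp_thms)+

text \<open>Column of a move: \<open>S \<tau>\<close> contains the worths of rolling after any move, \<open>g i\<close> is the best move.\<close>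

lemma move_column:
  assumes n: "n \<in> {1..5}" and C: "C \<subseteq> configs" and t0: "1 \<le> \<tau>0" and d: "\<delta> \<le> \<tau>0"
    and unreach: "\<And>i \<tau>. i \<in> C \<Longrightarrow> \<tau> < \<tau>0 \<Longrightarrow> reachable (St \<tau> i n) \<Longrightarrow> False"
    and row: "row_close m (\<tau>0 - \<delta>) vs" "m \<in> {1..5}" "\<tau>0 + length vs \<le> 56" "roll_limit n < \<tau>0 + length vs"
    and target: "\<And>i \<tau>. i \<in> C \<Longrightarrow> \<tau>0 \<le> \<tau> \<Longrightarrow> a i = Move (g i) \<and> g i \<in> moves \<tau> i n \<and>
      roll_after_move \<tau> i n (g i) = rollv (\<tau> - \<delta>) m"
    and choice: "\<And>i \<tau> k. i \<in> C \<Longrightarrow> k \<in> moves \<tau> i n \<Longrightarrow>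
      roll_after_move \<tau> i n k \<in> S \<tau>"
    and listed: "\<And>\<tau>. \<tau>0 \<le> \<tau> \<Longrightarrow> \<tau> < \<tau>0 + length vs \<Longrightarrow> real \<tau> < rollv (\<tau> - \<delta>) m \<and>
      rollv \<tau> n \<le> rollv (\<tau> - \<delta>) m \<and> (\<forall>v\<in>S \<tau>. v \<le> rollv (\<tau> - \<delta>) m)"
    and rest: "\<And>\<tau> v. \<tau>0 + length vs \<le> \<tau> \<Longrightarrow> \<tau> < 56 \<Longrightarrow> v \<in> S \<tau> \<Longrightarrow> v < real \<tau>"
  shows "table_column n C a \<tau>0 vs"
proof (rule table_columnI[OF n C t0 d unreach row(1-3)])
  fix i \<tau> assume i: "i \<in> C"
  show "vopt \<tau> i n = rollv (\<tau> - \<delta>) m \<and> real \<tau> < rollv (\<tau> - \<delta>) m \<and> a i \<in> opt_actions (St \<tau> i n)"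
    if \<tau>: "\<tau>0 \<le> \<tau>" "\<tau> < \<tau>0 + length vs"
  proof -
    have x: "St \<tau> i n \<in> states" using i C n t0 \<tau> by (auto simp: St_states)
    have g: "a i = Move (g i)" "g i \<in> moves \<tau> i n"
      "rollv (\<tau> - \<delta>) m = roll_after_move \<tau> i n (g i)"
      using target[OF i \<tau>(1)] by simp_all
    have l: "real \<tau> < rollv (\<tau> - \<delta>) m" "rollv \<tau> n \<le> rollv (\<tau> - \<delta>) m"
      "\<And>v. v \<in> S \<tau> \<Longrightarrow> v \<le> rollv (\<tau> - \<delta>) m"
      using listed[OF \<tau>] by blast+
    have t: "\<tau> < 56" using \<tau> row(3) by simp
    show ?thesis
      using move_optimal[OF x t g(2,3) less_imp_le[OF l(1)] l(2) l(3)[OF choice[OF i]]] l(1) g(1)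
      by simp
  qed
  show "opt_value (St \<tau> i n) = of_nat \<tau> \<and> opt_actions (St \<tau> i n) = {Stop}"
    if \<tau>: "\<tau>0 + length vs \<le> \<tau>" "\<tau> < 56"
    using i C n t0 \<tau> row(4) rest[OF \<tau> choice[OF i]] by (intro stop_optimal) (auto simp: St_states)
qed

lemma table_3_five:
  assumes row: "row_close 4 1 vs" and l: "length vs = 12"
  shows "table_column 3 {(2, 0, 0), (1, 1, 0)} (resign {#SFive#}) 2 vs"
proof (rule move_column[where \<delta>=1 and m=4 and S="\<lambda>\<tau>. {rollv (\<tau> - 1) 4, rollv (\<tau> - 2) 4}"
      and g="\<lambda>i. if i = (2, 0, 0) then (1, 0, 0) else (0, 1, 0)"])
  fix i :: cfg and \<tau> assume i: "i \<in> {(2, 0, 0), (1, 1, 0)}"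
  show False if "\<tau> < 2" "reachable (St \<tau> i 3)"
    using that reachable_score[of \<tau> i 3] i by auto
  let ?j = "if i = (2, 0, 0) then (1, 0, 0) else (0, 1, 0) :: cfg"
  have "resign {#SFive#} i = Move ?j"
    by (rule resign_eq) (use i in \<open>auto simp: numeral_2_eq_2\<close>)
  then show "resign {#SFive#} i = Move ?j \<and> ?j \<in> moves \<tau> i 3 \<and>
      rollv (\<tau> + score ?j - score i) (3 + ndice i - ndice ?j) = rollv (\<tau> - 1) 4" if "2 \<le> \<tau>"
    using i that by (auto simp: moves_iff smaller_iff configs_iff numeral_eq_Suc)
  show "roll_after_move \<tau> i 3 k \<in> {rollv (\<tau> - 1) 4, rollv (\<tau> - 2) 4}"
    if "k \<in> moves \<tau> i 3" for k
    using i moves_small(1,2)[of k \<tau> 3] that by (auto simp del: score.simps ndice.simps)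
next
  fix \<tau> assume "2 \<le> \<tau>" "\<tau> < 2 + length vs"
  then have "\<tau> \<in> set [2, 3, 4, 5, 6, 7, 8, 9, 10, 11, 12, 13]" using l by simp presburger
  then show "real \<tau> < rollv (\<tau> - 1) 4 \<and> rollv \<tau> 3 \<le> rollv (\<tau> - 1) 4 \<and>
      (\<forall>v\<in>{rollv (\<tau> - 1) 4, rollv (\<tau> - 2) 4}. v \<le> rollv (\<tau> - 1) 4)"
    by (simp only: list.set, elim insertE emptyE)
      (simp_all add: rollv_le rollv_greater nano_simps small_nat)
next
  fix \<tau> v assume \<tau>: "2 + length vs \<le> \<tau>" "\<tau> < 56" and v: "v \<in> {rollv (\<tau> - 1) 4, rollv (\<tau> - 2) 4}"
  show "v < real \<tau>"
    using v rollv_gain(1)[of "\<tau> - 1"] rollv_gain(2)[of "\<tau> - 2"] \<tau> l by (auto simp: of_nat_diff)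
qed (use assms in \<open>auto simp: configs_iff roll_limit_def\<close>)

lemma table_3_one:
  assumes row: "row_close 4 2 vs" and l: "length vs = 5"
  shows "table_column 3 {(0, 2, 0)} (resign {#SOne#}) 4 vs"
proof (rule move_column[where \<delta>=2 and m=4 and S="\<lambda>\<tau>. {rollv (\<tau> - 2) 4}" and g="\<lambda>i. (0, 1, 0)"])
  fix i :: cfg and \<tau> assume i: "i \<in> {(0, 2, 0)}"
  show False if "\<tau> < 4" "reachable (St \<tau> i 3)"
    using that reachable_score[of \<tau> i 3] i by auto
  have "resign {#SOne#} i = Move (0, 1, 0)"
    by (rule resign_eq) (use i in \<open>auto simp: numeral_2_eq_2\<close>)
  then show "resign {#SOne#} i = Move (0, 1, 0) \<and> (0, 1, 0) \<in> moves \<tau> i 3 \<and>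
      roll_after_move \<tau> i 3 (0, 1, 0) = rollv (\<tau> - 2) 4" if "4 \<le> \<tau>"
    using i that by (auto simp: moves_iff smaller_iff configs_iff numeral_eq_Suc)
  show "roll_after_move \<tau> i 3 k \<in> {rollv (\<tau> - 2) 4}"
    if "k \<in> moves \<tau> i 3" for k
    using i moves_small(3)[of k \<tau> 3] that by (auto simp del: score.simps ndice.simps)
next
  fix \<tau> assume "4 \<le> \<tau>" "\<tau> < 4 + length vs"
  then have "\<tau> \<in> set [4, 5, 6, 7, 8]" using l by simp linarith
  then show "real \<tau> < rollv (\<tau> - 2) 4 \<and> rollv \<tau> 3 \<le> rollv (\<tau> - 2) 4 \<and>
      (\<forall>v\<in>{rollv (\<tau> - 2) 4}. v \<le> rollv (\<tau> - 2) 4)"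
    by (simp only: list.set, elim insertE emptyE)
      (simp_all add: rollv_le rollv_greater nano_simps small_nat)
next
  fix \<tau> v assume \<tau>: "4 + length vs \<le> \<tau>" "\<tau> < 56" and v: "v \<in> {rollv (\<tau> - 2) 4}"
  show "v < real \<tau>"
    using v rollv_gain(2)[of "\<tau> - 2"] \<tau> l by (auto simp: of_nat_diff)
qed (use assms in \<open>auto simp: configs_iff roll_limit_def\<close>)

lemma table_2_two_fives:
  assumes row: "row_close 4 2 vs" and l: "length vs = 5"
  shows "table_column 2 {(2, 1, 0)} (resign {#SFive, SFive#}) 4 vs"
proof (rule move_column[where \<delta>=2 and m=4 and g="\<lambda>i. (0, 1, 0)" and
      S="\<lambda>\<tau>. {rollv (\<tau> - 1) 3, rollv (\<tau> - 2) 3, rollv (\<tau> - 2) 4, rollv (\<tau> - 3) 4}"])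
  fix i :: cfg and \<tau> assume i: "i \<in> {(2, 1, 0)}"
  show False if "\<tau> < 4" "reachable (St \<tau> i 2)"
    using that reachable_score[of \<tau> i 2] i by auto
  have "resign {#SFive, SFive#} i = Move (0, 1, 0)"
    by (rule resign_eq) (use i in \<open>auto simp: numeral_2_eq_2\<close>)
  then show "resign {#SFive, SFive#} i = Move (0, 1, 0) \<and> (0, 1, 0) \<in> moves \<tau> i 2 \<and>
      roll_after_move \<tau> i 2 (0, 1, 0) = rollv (\<tau> - 2) 4" if "4 \<le> \<tau>"
    using i that by (auto simp: moves_iff smaller_iff configs_iff numeral_eq_Suc)
  show "roll_after_move \<tau> i 2 k \<in>
      {rollv (\<tau> - 1) 3, rollv (\<tau> - 2) 3, rollv (\<tau> - 2) 4, rollv (\<tau> - 3) 4}"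
    if "k \<in> moves \<tau> i 2" for k
    using i moves_small(4)[of k \<tau> 2] that by (auto simp del: score.simps ndice.simps)
next
  fix \<tau> assume "4 \<le> \<tau>" "\<tau> < 4 + length vs"
  then have "\<tau> \<in> set [4, 5, 6, 7, 8]" using l by simp linarith
  then show "real \<tau> < rollv (\<tau> - 2) 4 \<and> rollv \<tau> 2 \<le> rollv (\<tau> - 2) 4 \<and>
      (\<forall>v\<in>{rollv (\<tau> - 1) 3, rollv (\<tau> - 2) 3, rollv (\<tau> - 2) 4, rollv (\<tau> - 3) 4}. v \<le> rollv (\<tau> - 2) 4)"
    by (simp only: list.set, elim insertE emptyE)
      (simp_all add: rollv_le rollv_greater nano_simps small_nat)
next
  fix \<tau> v assume \<tau>: "4 + length vs \<le> \<tau>" "\<tau> < 56"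
    and v: "v \<in> {rollv (\<tau> - 1) 3, rollv (\<tau> - 2) 3, rollv (\<tau> - 2) 4, rollv (\<tau> - 3) 4}"
  show "v < real \<tau>"
    using v rollv_gain(5)[of "\<tau> - 1"] rollv_gain(6)[of "\<tau> - 2"] rollv_gain(2)[of "\<tau> - 2"]
      rollv_gain(3)[of "\<tau> - 3"] \<tau> l by (auto simp: of_nat_diff)
qed (use assms in \<open>auto simp: configs_iff roll_limit_def\<close>)

lemma table_2_five_one:
  assumes row: "row_close 4 2 vs" and l: "length vs = 1"
  shows "table_column 2 {(1, 2, 0)} (resign {#SFive, SOne#}) 5 vs"
proof (rule move_column[where \<delta>=3 and m=4 and g="\<lambda>i. (0, 1, 0)" and
      S="\<lambda>\<tau>. {rollv (\<tau> - 1) 3, rollv (\<tau> - 2) 3, rollv (\<tau> - 3) 4, rollv (\<tau> - 4) 4}"])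
  fix i :: cfg and \<tau> assume i: "i \<in> {(1, 2, 0)}"
  show False if "\<tau> < 5" "reachable (St \<tau> i 2)"
    using that reachable_score[of \<tau> i 2] i by auto
  have "resign {#SFive, SOne#} i = Move (0, 1, 0)"
    by (rule resign_eq) (use i in \<open>auto simp: numeral_2_eq_2\<close>)
  then show "resign {#SFive, SOne#} i = Move (0, 1, 0) \<and> (0, 1, 0) \<in> moves \<tau> i 2 \<and>
      roll_after_move \<tau> i 2 (0, 1, 0) = rollv (\<tau> - 3) 4" if "5 \<le> \<tau>"
    using i that by (auto simp: moves_iff smaller_iff configs_iff numeral_eq_Suc)
  show "roll_after_move \<tau> i 2 k \<in>
      {rollv (\<tau> - 1) 3, rollv (\<tau> - 2) 3, rollv (\<tau> - 3) 4, rollv (\<tau> - 4) 4}"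
    if "k \<in> moves \<tau> i 2" for k
    using i moves_small(5)[of k \<tau> 2] that by (auto simp del: score.simps ndice.simps)
next
  fix \<tau> assume "5 \<le> \<tau>" "\<tau> < 5 + length vs"
  then have "\<tau> = 5" using l by simp
  then show "real \<tau> < rollv (\<tau> - 3) 4 \<and> rollv \<tau> 2 \<le> rollv (\<tau> - 3) 4 \<and>
      (\<forall>v\<in>{rollv (\<tau> - 1) 3, rollv (\<tau> - 2) 3, rollv (\<tau> - 3) 4, rollv (\<tau> - 4) 4}. v \<le> rollv (\<tau> - 3) 4)"
    by (simp add: rollv_le rollv_greater nano_simps small_nat)
next
  fix \<tau> v assume \<tau>: "5 + length vs \<le> \<tau>" "\<tau> < 56"
    and v: "v \<in> {rollv (\<tau> - 1) 3, rollv (\<tau> - 2) 3, rollv (\<tau> - 3) 4, rollv (\<tau> - 4) 4}"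
  show "v < real \<tau>"
    using v rollv_gain(5)[of "\<tau> - 1"] rollv_gain(6)[of "\<tau> - 2"] rollv_gain(3)[of "\<tau> - 3"]
      rollv_gain(4)[of "\<tau> - 4"] \<tau> l by (auto simp: of_nat_diff)
qed (use assms in \<open>auto simp: configs_iff roll_limit_def\<close>)

lemma table_2_five:
  assumes row: "row_close 3 2 vs" and l: "length vs = 2"
  shows "table_column 2 {(2, 0, 0), (1, 1, 0)} (resign {#SFive#}) 3 vs"
proof (rule move_column[where \<delta>=1 and m=3 and S="\<lambda>\<tau>. {rollv (\<tau> - 1) 3, rollv (\<tau> - 2) 3}"
      and g="\<lambda>i. if i = (2, 0, 0) then (1, 0, 0) else (0, 1, 0)"])
  fix i :: cfg and \<tau> assume i: "i \<in> {(2, 0, 0), (1, 1, 0)}"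
  show False if "\<tau> < 3" "reachable (St \<tau> i 2)"
    using that reachable_score[of \<tau> i 2] i by auto
  let ?j = "if i = (2, 0, 0) then (1, 0, 0) else (0, 1, 0) :: cfg"
  have "resign {#SFive#} i = Move ?j"
    by (rule resign_eq) (use i in \<open>auto simp: numeral_2_eq_2\<close>)
  then show "resign {#SFive#} i = Move ?j \<and> ?j \<in> moves \<tau> i 2 \<and>
      rollv (\<tau> + score ?j - score i) (2 + ndice i - ndice ?j) = rollv (\<tau> - 1) 3" if "3 \<le> \<tau>"
    using i that by (auto simp: moves_iff smaller_iff configs_iff numeral_eq_Suc)
  show "roll_after_move \<tau> i 2 k \<in> {rollv (\<tau> - 1) 3, rollv (\<tau> - 2) 3}"
    if "k \<in> moves \<tau> i 2" for k
    using i moves_small(1,2)[of k \<tau> 2] that by (auto simp del: score.simps ndice.simps)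
next
  fix \<tau> assume "3 \<le> \<tau>" "\<tau> < 3 + length vs"
  then have "\<tau> \<in> set [3, 4]" using l by simp linarith
  then show "real \<tau> < rollv (\<tau> - 1) 3 \<and> rollv \<tau> 2 \<le> rollv (\<tau> - 1) 3 \<and>
      (\<forall>v\<in>{rollv (\<tau> - 1) 3, rollv (\<tau> - 2) 3}. v \<le> rollv (\<tau> - 1) 3)"
    by (simp only: list.set, elim insertE emptyE)
      (simp_all add: rollv_le rollv_greater nano_simps small_nat)
next
  fix \<tau> v assume \<tau>: "3 + length vs \<le> \<tau>" "\<tau> < 56" and v: "v \<in> {rollv (\<tau> - 1) 3, rollv (\<tau> - 2) 3}"
  show "v < real \<tau>"
    using v rollv_gain(5)[of "\<tau> - 1"] rollv_gain(6)[of "\<tau> - 2"] \<tau> l by (auto simp: of_nat_diff)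
qed (use assms in \<open>auto simp: configs_iff roll_limit_def\<close>)

section \<open>States in which moving does not pay\<close>

lemma moves_regular:
  assumes "j \<in> moves \<tau> i n" "n + ndice i \<le> 5"
  shows "n + ndice i - ndice j \<le> 4"
  using assms ndice_pos[of j] by (auto simp: moves_iff)

lemma configs_upto_3: "configs_upto 3 = {(1, 0, 0), (0, 1, 0), (2, 0, 0), (1, 1, 0), (0, 2, 0),
    (3, 0, 0), (2, 1, 0), (1, 2, 0), (0, 3, 0), (0, 0, 2), (0, 0, 3), (0, 0, 4), (0, 0, 6)}"
proof -
  have "configs_upto 3 = set (filter (\<lambda>i. ndice i \<le> 3) cfgs)"
    by (auto simp: configs_upto_def set_cfgs)
  also have "filter (\<lambda>i. ndice i \<le> 3) cfgs = [(0, 0, 2), (0, 0, 3), (0, 0, 4), (0, 0, 6), (0, 1, 0),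
      (0, 2, 0), (0, 3, 0), (1, 0, 0), (1, 1, 0), (1, 2, 0), (2, 0, 0), (2, 1, 0), (3, 0, 0)]"
    by code_simp
  finally show ?thesis by auto
qed

text \<open>From these configurations a move gives up a 1 or the bonus of three equal dice.\<close>

lemma smaller_score_2:
  assumes "i \<in> configs_upto 3" "i \<notin> {(2, 1, 0), (1, 2, 0), (2, 0, 0), (1, 1, 0), (1, 0, 0)}" "j \<prec> i"
  shows "score j + 2 \<le> score i" and "ndice j + 2 \<le> ndice i \<Longrightarrow> score j + 4 \<le> score i"
proof -
  have "i \<in> {(0, 1, 0), (0, 2, 0), (3, 0, 0), (0, 3, 0), (0, 0, 2), (0, 0, 3), (0, 0, 4), (0, 0, 6)}"
    using assms(1,2) unfolding configs_upto_3 by blast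
  then have "score j + 2 \<le> score i \<and> (ndice j + 2 \<le> ndice i \<longrightarrow> score j + 4 \<le> score i)"
    using assms(3) by (cases j) (elim insertE emptyE; simp add: smaller_iff; linarith?)
  then show "score j + 2 \<le> score i" "ndice j + 2 \<le> ndice i \<Longrightarrow> score j + 4 \<le> score i" by blast+
qed

text \<open>A move that frees \<open>r\<close> dice gives up at least \<open>r\<close> chips, and at least 4 chips if \<open>r = 3\<close>; for \<open>n = 2\<close> and
  the remaining configurations it gives up at least 2 chips, and 4 chips if \<open>r = 2\<close>.  The score of a
  reachable state is large enough for a roll with \<open>n + r\<close> dice to gain less than that.\<close>

lemma stop_few_dice:
  assumes r: "reachable (St \<tau> i n)" and t: "\<tau> < 56"
    and n: "n = 1 \<or> n = 2 \<and> i \<notin> {(2, 1, 0), (1, 2, 0), (2, 0, 0), (1, 1, 0), (1, 0, 0)}"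
  shows "opt_value (St \<tau> i n) = of_nat \<tau> \<and> opt_actions (St \<tau> i n) = {Stop}"
proof (rule stop_optimal)
  show x: "St \<tau> i n \<in> states" using reachable_score[OF r] by blast
  have s: "score i + 5 \<le> \<tau> + n + ndice i" using reachable_score[OF r] by blast
  have i: "i \<in> configs" and d: "n + ndice i \<le> 5"
    using reachable_covered[OF r] n by (auto simp: St_states configs_upto_def)
  show "roll_limit n < \<tau>"
    using n s ndice_le_score[OF i] i
    by (cases i) (auto simp: roll_limit_def configs_iff split: if_splits)
  fix j assume j: "j \<in> moves \<tau> i n"
  define t where "t = \<tau> + score j - score i"
  define m where "m = n + ndice i - ndice j"
  have j': "j \<prec> i" "score i < \<tau> + score j" "j \<in> configs" "ndice j < n + ndice i"
    using j by (simp_all add: moves_iff)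
  have m4: "m \<le> 4" unfolding m_def by (rule moves_regular[OF j d])
  have ts: "score i + t = \<tau> + score j" using j'(2) by (simp add: t_def)
  have md: "m + ndice j = n + ndice i" using j'(4) by (simp add: m_def)
  have t5: "5 \<le> t + m" "t < \<tau>"
    using s ts md ndice_le_score[OF j'(3)] smaller_score[OF j'(1)] by linarith+
  have t56: "t < 56" using t5 t by simp
  have dn: "ndice j < ndice i" by (rule smaller_ndice[OF j'(1)])
  have sd: "score j + ndice i \<le> score i + ndice j" by (rule smaller_score_ndice[OF j'(1) i])
  have "rollv t m < real t + real (score i - score j)"
  proof (cases "ndice j + 3 \<le> ndice i")
    case True
    then have "score j + 4 \<le> score i" by (rule smaller_score_3[OF j'(1) i])
    moreover have "rollv t m < real t + 4"
      using rollv_facts(3)[OF t56] m4 md dn n by auto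
    ultimately show ?thesis by (simp add: of_nat_diff)
  next
    case False
    consider "n = 1" "m = 2" | "n = 1" "m = 3" "score j + 2 \<le> score i" | "n = 2" "m = 3" | "n = 2" "m = 4"
      using False n md dn sd by linarith
    then show ?thesis
    proof cases
      case 1
      then show ?thesis using rollv_gain(7)[OF t56] t5 sd dn by (simp add: of_nat_diff)
    next
      case 2
      then show ?thesis using rollv_gain(6)[OF t56] t5 sd dn by (simp add: of_nat_diff)
    next
      case 3
      have "score j + 2 \<le> score i"
        using n i d 3(1) by (intro smaller_score_2(1)[OF _ _ j'(1)]) (auto simp: configs_upto_def)
      then show ?thesis using rollv_gain(6)[OF t56] t5 3 by (simp add: of_nat_diff)
    next
      case 4
      have "score j + 4 \<le> score i"
        using n i d 4 md by (intro smaller_score_2(2)[OF _ _ j'(1)]) (auto simp: configs_upto_def)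
      then show ?thesis using rollv_gain(4)[OF t56] 4 by (simp add: of_nat_diff)
    qed
  qed
  also have "real t + real (score i - score j) = real \<tau>"
    using ts smaller_score[OF j'(1)] by (simp add: of_nat_diff)
  finally show "roll_after_move \<tau> i n j < real \<tau>"
    by (simp add: t_def m_def)
qed (use t in auto)

text \<open>After a move at most four dice are available, and rolling them gains less than 4 chips.\<close>

lemma vopt_gain:
  assumes "n \<in> {1..4}" "n + ndice i \<le> 5"
  shows "vopt \<tau> i n < real \<tau> + 4"
proof (cases "\<tau> < 56")
  case True
  show ?thesis
  proof (rule vopt_less[OF True])
    fix j assume j: "j \<in> moves \<tau> i n"
    have "\<tau> + score j - score i < \<tau>" using moves_score[OF j] by simp
    moreover have "roll_after_move \<tau> i n j < real (\<tau> + score j - score i) + 4"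
      using moves_dice[OF j] moves_regular[OF j assms(2)] calculation True by (intro rollv_facts(3)) auto
    ultimately show "roll_after_move \<tau> i n j < real \<tau> + 4" by linarith
  qed (use rollv_facts(3)[OF True, of n] assms in auto)
qed (simp add: vopt_large)

lemma combs_diff:
  assumes "R \<subseteq># combs i"
  obtains j where "combs i = combs j + R"
proof -
  obtain f os t where i: "i = (f, os, t)" by (metis prod_cases3)
  have le: "count R x \<le> count (combs i) x" for x by (rule mset_subset_eq_count[OF assms])
  have "combs i = combs (f - count R SFive, os - count R SOne, if Triple t \<in># R then 0 else t) + R"
  proof (rule multiset_eqI)
    fix x
    show "count (combs i) x =
        count (combs (f - count R SFive, os - count R SOne, if Triple t \<in># R then 0 else t) + R) x"
    proof (cases x)
      case (Triple k)
      define m where "m = count R (Triple k)"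
      have 1: "m \<le> (if t \<noteq> 0 \<and> k = t then 1 else 0)"
        using le[of "Triple k"] unfolding i count_combs m_def by simp
      have 2: "k = t \<Longrightarrow> Triple t \<in># R \<longleftrightarrow> m \<noteq> 0" by (simp add: m_def)
      define t' where "t' = (if Triple t \<in># R then 0 else t)"
      have "(if t \<noteq> 0 \<and> k = t then 1 else 0) = (if t' \<noteq> 0 \<and> k = t' then 1 else 0) + m"
      proof (cases "t \<noteq> 0 \<and> k = t")
        case True
        then have "m = 0 \<or> m = 1" "t' = (if m \<noteq> 0 then 0 else t)" using 1 2 by (auto simp: t'_def)
        then show ?thesis using True by (elim disjE) simp_all
      next
        case False
        then have "m = 0" "t' = 0 \<or> t' = t" using 1 by (simp_all only: if_False le_zero_eq t'_def) simp
        then show ?thesis using False by (elim disjE) simp_all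
      qed
      then show ?thesis
        unfolding i count_combs count_union Triple comb.case t'_def[symmetric] m_def[symmetric] .
    qed (use le[of x] in \<open>simp_all only: i count_combs count_union comb.case le_add_diff_inverse2\<close>)
  qed
  then show ?thesis by (rule that)
qed

text \<open>Every listed set of dice is worth at least 4 chips, more than a roll with the at most four dice then
  available can gain; so stopping is better.\<close>

lemma resign_not_optimal:
  assumes x: "St \<tau> i n \<in> states" and n: "n = 5 \<or> i \<in> configs_upto (5 - n)"
    and R: "R \<in> {{#SOne, SOne#}, {#SFive, SFive, SOne#}, {#SFive, SOne, SOne#}, {#SOne, SOne, SOne#},
      {#Triple 2#}, {#Triple 3#}, {#Triple 4#}, {#SFive, SFive, SFive#}, {#Triple 6#}}"
    and sub: "R \<subset># combs i"
  shows "resign R i \<notin> opt_actions (St \<tau> i n)"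
proof
  assume opt: "resign R i \<in> opt_actions (St \<tau> i n)"
  have i: "i \<in> configs" using x by (simp add: St_states)
  obtain j where ij: "combs i = combs j + R"
    using combs_diff[of R i] sub by (auto simp: subset_mset.less_le)
  have "resign R i = Move j" by (rule resign_eq[OF ij])
  then have j: "j \<in> moves \<tau> i n"
    and v: "vopt_after_move \<tau> i n j = vopt \<tau> i n"
    using opt unfolding opt_actions_iff[OF x] value_fn.simps by (simp_all only: Move_actions worth.simps)
  have j': "j \<prec> i" "n < 5" "score i < \<tau> + score j" "j \<in> configs" "ndice j < n + ndice i" using j by (simp_all add: moves_iff)
  have d: "n + ndice i \<le> 5" using n j'(2) by (auto simp: configs_upto_def)
  have "score j + 4 \<le> score i"
  proof -
    obtain f os t f' o' t' where i': "i = (f, os, t)" "j = (f', o', t')" by (metis prod_cases3)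
    have eq: "count (combs i) x = count (combs j) x + count R x" for x using ij by simp
    have f: "f = f' + count R SFive" "os = o' + count R SOne"
      using eq[of SFive] eq[of SOne] unfolding i' count_combs by simp_all
    have t: "(if t \<noteq> 0 \<and> k = t then 1 else 0) = (if t' \<noteq> 0 \<and> k = t' then 1 else 0) + count R (Triple k)" for k
      using eq[of "Triple k"] unfolding i' count_combs by simp
    have f5: "f \<le> 5" using i by (auto simp: i' configs_iff)
    have t': "t' = 0 \<or> t' = t" using j'(1) by (simp add: i' smaller_iff)
    then have tt: "t' \<le> t" by auto
    have tk: "t = k \<and> t' = 0" if "count R (Triple k) = 1" for k
      using t[of k] t' that by (auto split: if_splits)
    define a b where "a = count R SFive" and "b = count R SOne"
    have "(a, b) \<in> {(0, 2), (2, 1), (1, 2), (0, 3), (3, 0)} \<or>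
        a = 0 \<and> b = 0 \<and> (\<exists>k\<in>{2, 3, 4, 6}. count R (Triple k) = 1)"
      using R unfolding a_def b_def by (elim insertE emptyE) simp_all
    then show ?thesis
    proof
      assume "(a, b) \<in> {(0, 2), (2, 1), (1, 2), (0, 3), (3, 0)}"
      then show ?thesis
        using f tt f5 unfolding i' a_def[symmetric] b_def[symmetric]
        by (elim insertE emptyE) (auto split: if_splits)
    next
      assume "a = 0 \<and> b = 0 \<and> (\<exists>k\<in>{2, 3, 4, 6}. count R (Triple k) = 1)"
      then show ?thesis
        using f tk unfolding i' a_def[symmetric] b_def[symmetric] by fastforce
    qed
  qed
  moreover have "vopt_after_move \<tau> i n j < real (\<tau> + score j - score i) + 4"
    using moves_dice[OF j] moves_regular[OF j d] d j'(5) by (intro vopt_gain) auto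
  ultimately show False using v vopt_ge_stop[of \<tau> i n] j'(3) by (simp add: of_nat_diff)
qed

section \<open>The algorithm\<close>

definition entry :: "arrays \<Rightarrow> cell \<Rightarrow> real \<times> act \<times> nat" where
  "entry A c = (val A c, arg A c, cnt A c)"

lemma assign_simps [simp]:
  "val (assign c v a A) c' = (if c' = c then v else val A c')"
  "arg (assign c v a A) c' = (if c' = c then a else arg A c')"
  "cnt (assign c v a A) c' = (if c' = c then cnt A c + 1 else cnt A c')"
  "entry (assign c v a A) c' = (if c' = c then (v, a, cnt A c + 1) else entry A c')"
  by (simp_all add: assign_def entry_def)

text \<open>The cells that are visited by the inner loop for the configuration \<open>i\<close>, the score \<open>t\<close> and \<open>m\<close> dice.\<close>

fun hit_by :: "cfg \<Rightarrow> nat \<Rightarrow> nat \<Rightarrow> cell \<Rightarrow> bool" where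
  "hit_by i t m (\<tau>, j, n) \<longleftrightarrow> j \<in> configs \<and> i \<prec> j \<and> ndice j < ndice i + m \<and>
     \<tau> = t + score j - score i \<and> n = m + ndice i - ndice j"

definition offer :: "cell list \<Rightarrow> real \<Rightarrow> act \<Rightarrow> arrays \<Rightarrow> arrays" where
  "offer ds v a = fold (\<lambda>c B. if val B c < v then assign c v a B else B) ds"

text \<open>After the first update the cell holds \<open>v\<close>, so that later visits do not change it.\<close>

lemma offer_entry:
  "entry (offer ds v a A) c =
     (if c \<in> set ds \<and> val A c < v then (v, a, cnt A c + 1) else entry A c)"
proof (induction ds arbitrary: A)
  case Nil
  show ?case by (simp add: offer_def)
next
  case (Cons d ds)
  have "offer (d # ds) v a A = offer ds v a (if val A d < v then assign d v a A else A)"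
    by (simp add: offer_def)
  then show ?case by (auto simp: Cons.IH)
qed

lemma process_config_entry:
  assumes "set cs = configs"
  shows "entry (process_config cs t m aux i A) c =
    (if c = (t, i, m) then (if aux \<le> real t then (real t, Stop, cnt A c + 1) else (aux, Roll, cnt A c + 1))
     else if real t < aux \<and> hit_by i t m c \<and> val A c < aux then (aux, Move i, cnt A c + 1)
     else entry A c)"
proof (cases "aux \<le> real t")
  case True
  then show ?thesis by (simp add: process_config_def)
next
  case False
  let ?g = "\<lambda>j. (t + score j - score i, j, m + ndice i - ndice j)"
  let ?js = "filter (\<lambda>j. i \<prec> j \<and> ndice j < ndice i + m) cs"
  have "process_config cs t m aux i A = offer (map ?g ?js) aux (Move i) (assign (t, i, m) aux Roll A)"
    using False by (simp add: process_config_def offer_def fold_map comp_def Let_def)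
  moreover have "c \<in> set (map ?g ?js) \<longleftrightarrow> hit_by i t m c"
    using assms by (cases c) (auto simp: hit_by.simps)
  moreover have "\<not> hit_by i t m (t, i, m)" by (auto dest: smaller_score)
  ultimately show ?thesis using False by (auto simp: offer_entry)
qed

declare hit_by.simps [simp del]

text \<open>The effect of one pass on a cell does not depend on the order of the configurations, except for the
  choice between several moves of the same worth: all offers of the pass are equal, so only the first is
  accepted, and the cells assigned their own value have score \<open>t\<close> while all others visited lie higher.\<close>

lemma process_dice_entry:
  assumes cs: "distinct cs" "set cs = configs" and aux: "aux = roll_value (val A) t m"
  shows "case c of (\<tau>, j, n) \<Rightarrow>
    if \<tau> = t \<and> n = m \<and> j \<in> configs \<and> ndice j \<le> 5 - m
    then entry (process_dice cs t m A) c =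
      (if aux \<le> real t then (real t, Stop, cnt A c + 1) else (aux, Roll, cnt A c + 1))
    else if real t < aux \<and> (\<exists>i\<in>configs. ndice i \<le> 5 - m \<and> hit_by i t m c) \<and> val A c < aux
    then \<exists>i\<in>configs. ndice i \<le> 5 - m \<and> hit_by i t m c \<and>
      entry (process_dice cs t m A) c = (aux, Move i, cnt A c + 1)
    else entry (process_dice cs t m A) c = entry A c"
proof -
  obtain \<tau> j n where c: "c = (\<tau>, j, n)" by (metis prod_cases3)
  let ?P = "\<lambda>I e. if \<tau> = t \<and> n = m \<and> j \<in> I
    then e = (if aux \<le> real t then (real t, Stop, cnt A c + 1) else (aux, Roll, cnt A c + 1))
    else if real t < aux \<and> (\<exists>i\<in>I. hit_by i t m c) \<and> val A c < aux
    then \<exists>i\<in>I. hit_by i t m c \<and> e = (aux, Move i, cnt A c + 1)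
    else e = entry A c"
  have "?P (set is) (entry (fold (process_config cs t m aux) is A) c)" if "distinct is" for "is"
    using that
  proof (induction "is" rule: rev_induct)
    case Nil
    show ?case by simp
  next
    case (snoc i "is")
    let ?B = "fold (process_config cs t m aux) is A"
    have IH: "?P (set is) (entry ?B c)" using snoc by simp
    have i: "i \<notin> set is" using snoc.prems by simp
    have no: "\<not> hit_by k t m c" if "\<tau> = t" for k
      using that by (auto simp: c hit_by.simps dest: smaller_score)
    have e: "entry (fold (process_config cs t m aux) (is @ [i]) A) c =
      (if c = (t, i, m) then (if aux \<le> real t then (real t, Stop, cnt ?B c + 1) else (aux, Roll, cnt ?B c + 1))
       else if real t < aux \<and> hit_by i t m c \<and> val ?B c < aux then (aux, Move i, cnt ?B c + 1)
       else entry ?B c)"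
      by (simp add: process_config_entry[OF cs(2)])
    show ?case
    proof (cases "c = (t, i, m)")
      case True
      then have "\<not> (\<tau> = t \<and> n = m \<and> j \<in> set is)" "\<And>k. \<not> hit_by k t m c"
        using i no by (simp_all add: c)
      then have "entry ?B c = entry A c" using IH by simp
      then show ?thesis unfolding e using True by (simp add: c entry_def)
    next
      case c_ne: False
      show ?thesis
      proof (cases "\<tau> = t \<and> n = m \<and> j \<in> set is")
        case True
        then show ?thesis unfolding e using IH c_ne no by (simp add: c)
      next
        case False
        then have own: "\<not> (\<tau> = t \<and> n = m \<and> j \<in> set (is @ [i]))" using c_ne by (auto simp: c)
        show ?thesis
        proof (cases "real t < aux \<and> (\<exists>k\<in>set is. hit_by k t m c) \<and> val A c < aux")
          case True
          then obtain k where k: "k \<in> set is" "hit_by k t m c" "entry ?B c = (aux, Move k, cnt A c + 1)"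
            using IH False by auto
          then have "val ?B c = aux" by (simp add: entry_def)
          then have "entry (fold (process_config cs t m aux) (is @ [i]) A) c = (aux, Move k, cnt A c + 1)"
            unfolding e using c_ne k(3) by simp
          then show ?thesis using own True k by auto
        next
          case F: False
          then have B: "entry ?B c = entry A c" using IH False by auto
          then have "val ?B c = val A c" "cnt ?B c = cnt A c" by (simp_all add: entry_def)
          then show ?thesis unfolding e using own F B c_ne by auto
        qed
      qed
    qed
  qed
  moreover have "distinct (filter (\<lambda>i. ndice i \<le> 5 - m) cs)" using cs(1) by simp
  ultimately have P: "?P (set (filter (\<lambda>i. ndice i \<le> 5 - m) cs)) (entry (process_dice cs t m A) c)"
    unfolding process_dice_def aux[symmetric] by blast
  have f: "set (filter (\<lambda>i. ndice i \<le> 5 - m) cs) = {i \<in> configs. ndice i \<le> 5 - m}"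
    by (simp add: cs(2))
  have bex: "(\<exists>i\<in>{i \<in> configs. ndice i \<le> 5 - m}. Q i) \<longleftrightarrow> (\<exists>i\<in>configs. ndice i \<le> 5 - m \<and> Q i)" for Q
    by blast
  show ?thesis using P unfolding f bex c prod.case mem_Collect_eq .
qed

text \<open>Restricting the comparison to configurations that can be rolled excludes cells that the algorithm never
  fills.\<close>

lemma roll_value_cong:
  assumes "\<And>k. k \<in> configs \<Longrightarrow> ways n k \<noteq> 0 \<Longrightarrow>
    V (\<tau> + score k, k, n - ndice k + (if n = ndice k then 5 else 0)) =
    V' (\<tau> + score k, k, n - ndice k + (if n = ndice k then 5 else 0))"
  shows "roll_value V \<tau> n = roll_value V' \<tau> n"
  unfolding roll_value_def
proof (intro sum.cong refl)
  fix k assume "k \<in> configs"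
  then show "real (ways n k) / 6 ^ n * V (\<tau> + score k, k, n - ndice k + (if n = ndice k then 5 else 0)) =
      real (ways n k) / 6 ^ n * V' (\<tau> + score k, k, n - ndice k + (if n = ndice k then 5 else 0))"
    using assms[of k] by (cases "ways n k = 0") simp_all
qed

lemma process_five_entry:
  assumes cs: "distinct cs" "set cs = configs"
  shows "entry (fold (\<lambda>i B. assign (t, i, 5) (roll_value (val B) t 5) Roll B) cs A) c =
    (if \<exists>i\<in>configs. c = (t, i, 5) then (roll_value (val A) t 5, Roll, cnt A c + 1) else entry A c)"
proof -
  have "entry (fold (\<lambda>i B. assign (t, i, 5) (roll_value (val B) t 5) Roll B) is A) c =
      (if \<exists>i\<in>set is. c = (t, i, 5) then (roll_value (val A) t 5, Roll, cnt A c + 1) else entry A c)"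
    if "distinct is" for "is"  c
    using that
  proof (induction "is" arbitrary: c rule: rev_induct)
    case (snoc i "is")
    let ?B = "fold (\<lambda>i B. assign (t, i, 5) (roll_value (val B) t 5) Roll B) is A"
    have IH: "entry ?B d = (if \<exists>i\<in>set is. d = (t, i, 5) then (roll_value (val A) t 5, Roll, cnt A d + 1)
      else entry A d)" for d
      using snoc by simp
    have "roll_value (val ?B) t 5 = roll_value (val A) t 5"
    proof (rule roll_value_cong)
      fix k assume "k \<in> configs"
      then have "0 < score k" by (rule score_pos)
      then have "entry ?B (t + score k, k, 5 - ndice k + (if 5 = ndice k then 5 else 0)) =
          entry A (t + score k, k, 5 - ndice k + (if 5 = ndice k then 5 else 0))"
        unfolding IH by auto
      then show "val ?B (t + score k, k, 5 - ndice k + (if 5 = ndice k then 5 else 0)) =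
          val A (t + score k, k, 5 - ndice k + (if 5 = ndice k then 5 else 0))"
        by (simp add: entry_def)
    qed
    moreover have "cnt ?B (t, i, 5) = cnt A (t, i, 5)"
      using IH[of "(t, i, 5)"] snoc.prems by (auto simp: entry_def)
    ultimately show ?case using IH[of c] by auto
  qed simp
  then show ?thesis using cs by simp
qed

text \<open>The pair \<open>(t, m)\<close> of score and dice makes an offer, of the value \<open>rollv t m\<close>, to the cell \<open>c\<close> if rolling
  is preferred to stopping there.\<close>

definition hits :: "nat \<times> nat \<Rightarrow> cell \<Rightarrow> bool" where
  "hits p c \<longleftrightarrow> 1 \<le> snd p \<and> (\<exists>i\<in>configs. ndice i + snd p \<le> 5 \<and> hit_by i (fst p) (snd p) c)"

definition earlier :: "nat \<times> nat \<Rightarrow> nat \<times> nat \<Rightarrow> bool" where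
  "earlier p q \<longleftrightarrow> fst q < fst p \<or> fst p = fst q \<and> snd q < snd p"

text \<open>The offers that improve on the score of the cell and on all offers made before.  Only these cause an
  update.\<close>

definition records :: "cell \<Rightarrow> (nat \<times> nat) set" where
  "records c = {p. hits p c \<and> real (fst c) < rollv (fst p) (snd p) \<and>
     (\<forall>q. hits q c \<and> earlier q p \<longrightarrow> rollv (fst q) (snd q) < rollv (fst p) (snd p))}"

text \<open>The pairs processed before \<open>m\<close> dice at the score \<open>t\<close>: the algorithm goes through decreasing scores, and
  at each score through decreasing numbers of dice.\<close>

definition processed :: "nat \<Rightarrow> nat \<Rightarrow> (nat \<times> nat) set" where
  "processed t m = {(\<tau>, n). \<tau> < 56 \<and> n \<in> {1..5} \<and> (t < \<tau> \<or> \<tau> = t \<and> m < n)}"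

text \<open>What a cell holds when the pairs in \<open>D\<close> have been processed: an upper bound of the offers, attained by
  the recorded action.\<close>

definition stored :: "(nat \<times> nat) set \<Rightarrow> arrays \<Rightarrow> cell \<Rightarrow> bool" where
  "stored D A c \<longleftrightarrow> (case c of (\<tau>, j, n) \<Rightarrow>
     if n = 5 then val A c = rollv \<tau> 5 \<and> arg A c = Roll \<and> cnt A c = 1
     else real \<tau> \<le> val A c \<and> rollv \<tau> n \<le> val A c \<and>
       (\<forall>p\<in>D. hits p c \<longrightarrow> rollv (fst p) (snd p) \<le> val A c) \<and>
       (arg A c = Stop \<and> val A c = real \<tau> \<or> arg A c = Roll \<and> val A c = rollv \<tau> n \<or>
        (\<exists>i t m. i \<in> configs \<and> ndice i + m \<le> 5 \<and> hit_by i t m c \<and> arg A c = Move i \<and> val A c = rollv t m)) \<and>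
       1 \<le> cnt A c \<and> cnt A c \<le> 1 + card (D \<inter> records c))"

definition invariant :: "(nat \<times> nat) set \<Rightarrow> arrays \<Rightarrow> bool" where
  "invariant D A \<longleftrightarrow> (\<forall>\<tau> j n. 56 \<le> \<tau> \<longrightarrow> val A (\<tau>, j, n) = real \<tau>) \<and>
     (\<forall>\<tau> j n. (\<tau>, j, n) \<in> cells \<longrightarrow>
        (if (\<tau>, n) \<in> D then stored D A (\<tau>, j, n) else cnt A (\<tau>, j, n) = 0))"

lemma invariant_large: "invariant D A \<Longrightarrow> 56 \<le> \<tau> \<Longrightarrow> val A (\<tau>, j, n) = real \<tau>"
  unfolding invariant_def by blast

lemma invariant_cell: "invariant D A \<Longrightarrow> (\<tau>, j, n) \<in> cells \<Longrightarrow>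
    if (\<tau>, n) \<in> D then stored D A (\<tau>, j, n) else cnt A (\<tau>, j, n) = 0"
  unfolding invariant_def by blast

lemma cells_iff: "(\<tau>, j, n) \<in> cells \<longleftrightarrow> \<tau> < 56 \<and> j \<in> configs \<and> n \<in> {1..5} \<and> (n = 5 \<or> ndice j + n \<le> 5)"
  by (auto simp: cells_def configs_upto_def)

lemma finite_processed: "finite (processed t m)"
proof (rule finite_subset)
  show "processed t m \<subseteq> {..<56} \<times> {1..5}" by (auto simp: processed_def)
qed simp

lemma hitsD:
  assumes "hits (t, m) (\<tau>, j, n)"
  shows "t < \<tau>" "n < m" "m \<le> 4" "1 \<le> n" "1 \<le> m"
  using assms ndice_pos
  by (fastforce simp: hits_def hit_by.simps dest: smaller_score smaller_ndice)+

text \<open>A cell with score at least that of its configuration holds the value of its state as soon as all offers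
  to it have been made: offers correspond to available moves.\<close>

lemma stored_vopt:
  assumes inv: "invariant D A" and c: "(\<tau>, k, n) \<in> cells" "(\<tau>, n) \<in> D" and n: "n \<noteq> 5" and s: "score k \<le> \<tau>"
    and D: "\<And>t m. t < \<tau> \<Longrightarrow> \<tau> < t + score k \<Longrightarrow> n < m \<Longrightarrow> m \<le> 4 \<Longrightarrow> (t, m) \<in> D"
  shows "val A (\<tau>, k, n) = vopt \<tau> k n"
proof -
  have st: "stored D A (\<tau>, k, n)" using invariant_cell[OF inv c(1)] c(2) by simp
  have c': "\<tau> < 56" "k \<in> configs" "1 \<le> n" "ndice k + n \<le> 5" using c(1) n by (auto simp: cells_iff)
  show ?thesis
  proof (rule antisym)
    from st n consider "val A (\<tau>, k, n) = real \<tau>" | "val A (\<tau>, k, n) = rollv \<tau> n"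
      | i t m where "i \<in> configs" "ndice i + m \<le> 5" "hit_by i t m (\<tau>, k, n)" "val A (\<tau>, k, n) = rollv t m"
      unfolding stored_def by auto
    then show "val A (\<tau>, k, n) \<le> vopt \<tau> k n"
    proof cases
      case 1
      then show ?thesis by (simp add: vopt_ge_stop)
    next
      case 2
      then show ?thesis using c'(1) by (simp add: vopt_ge_roll)
    next
      case 3
      have h: "i \<prec> k" "ndice k < ndice i + m" "\<tau> = t + score k - score i" "n = m + ndice i - ndice k"
        using 3(3) by (simp_all add: hit_by.simps)
      have "i \<in> moves \<tau> k n"
        using 3(1,2) h s c' n score_pos[OF 3(1)] smaller_ndice[OF h(1)] by (simp add: moves_iff)
      moreover have "\<tau> + score i - score k = t" "n + ndice k - ndice i = m"
        using h smaller_score[OF h(1)] by simp_all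
      ultimately show ?thesis using vopt_ge_move[OF c'(1), of i k n] 3(4) by simp
    qed
  next
    show "vopt \<tau> k n \<le> val A (\<tau>, k, n)"
    proof (rule vopt_le)
      fix i assume i: "i \<in> moves \<tau> k n"
      define t where "t = \<tau> + score i - score k"
      define m where "m = n + ndice k - ndice i"
      have h: "i \<prec> k" "i \<in> configs" "score k < \<tau> + score i" "ndice i < n + ndice k"
        using i by (simp_all add: moves_iff)
      have d: "0 < ndice i" "ndice i < ndice k" "score i < score k" "0 < score i"
        using h ndice_pos score_pos smaller_ndice smaller_score by blast+
      have hb: "hit_by i t m (\<tau>, k, n)"
        using h d c' by (simp add: hit_by.simps t_def m_def)
      have m: "n < m" "m \<le> 4" "ndice i + m \<le> 5" using h d c' by (simp_all add: m_def)
      then have "hits (t, m) (\<tau>, k, n)" using hb h(2) unfolding hits_def by auto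
      moreover have "(t, m) \<in> D"
        using h d m by (intro D) (simp_all add: t_def)
      ultimately have "rollv t m \<le> val A (\<tau>, k, n)" using st n unfolding stored_def by auto
      then show "roll_after_move \<tau> k n i \<le> val A (\<tau>, k, n)"
        by (simp add: t_def m_def)
    qed (use st n in \<open>auto simp: stored_def\<close>)
  qed
qed

lemma vopt_five: "\<tau> < 56 \<Longrightarrow> vopt \<tau> i 5 = rollv \<tau> 5"
  using rollv_facts(1)[of \<tau> 5]
  by (intro antisym vopt_le vopt_ge_roll) (auto simp: roll_limit_def)

lemma ways_ndice: "ways n k \<noteq> 0 \<Longrightarrow> ndice k \<le> n"
proof -
  assume "ways n k \<noteq> 0"
  then obtain w where "w \<in> rolls n" "cfg_of w = k" by (auto simp: ways_def card_eq_0_iff)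
  then show ?thesis using ndice_cfg_of_le[of w] by (simp add: rolls_def)
qed

text \<open>The cells read at score \<open>t\<close> have a score above \<open>t\<close>, and so have the pairs with offers to them, because a
  move after a roll stays above \<open>t\<close>.  Hence they are final.\<close>

lemma roll_value_rollv:
  assumes inv: "invariant (processed t m) A" and n: "n \<in> {1..5}"
  shows "roll_value (val A) t n = rollv t n"
  unfolding rollv_roll_value
proof (rule roll_value_cong)
  fix k assume k: "k \<in> configs" "ways n k \<noteq> 0"
  have d: "0 < ndice k" "ndice k \<le> n" "0 < score k" using k ndice_pos ways_ndice score_pos by auto
  let ?\<tau> = "t + score k"
  define l where "l = n - ndice k + (if n = ndice k then 5 else 0)"
  have "val A (?\<tau>, k, l) = vopt ?\<tau> k l"
  proof (cases "56 \<le> ?\<tau>")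
    case True
    then show ?thesis using invariant_large[OF inv True] by (simp add: vopt_large)
  next
    case False
    have c: "(?\<tau>, k, l) \<in> cells" using False k d n by (auto simp: cells_iff l_def)
    have D: "(?\<tau>, l) \<in> processed t m" using False d n by (auto simp: processed_def l_def)
    show ?thesis
    proof (cases "l = 5")
      case True
      then show ?thesis using invariant_cell[OF inv c] D False by (simp add: stored_def vopt_five)
    next
      case l: False
      show ?thesis
        by (rule stored_vopt[OF inv c D l]) (use False in \<open>auto simp: processed_def\<close>)
    qed
  qed
  then show "val A (?\<tau>, k, n - ndice k + (if n = ndice k then 5 else 0)) =
      (case (?\<tau>, k, n - ndice k + (if n = ndice k then 5 else 0)) of (\<tau>, i, n) \<Rightarrow> vopt \<tau> i n)"
    by (simp add: l_def)
qed

lemma processed_Suc: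
  "t < 56 \<Longrightarrow> m < 5 \<Longrightarrow> processed t m = insert (t, Suc m) (processed t (Suc m))"
  by (auto simp: processed_def)

lemma invariant_process_five:
  assumes inv: "invariant (processed t 5) A" and t: "t < 56" and cs: "distinct cs" "set cs = configs"
  shows "invariant (processed t 4) (fold (\<lambda>i B. assign (t, i, 5) (roll_value (val B) t 5) Roll B) cs A)"
    (is "invariant _ ?B")
proof -
  note e = process_five_entry[OF cs, of t A]
  have r: "roll_value (val A) t 5 = rollv t 5" by (rule roll_value_rollv[OF inv]) simp
  have D: "processed t 4 = insert (t, 5) (processed t 5)" using processed_Suc[OF t, of 4] by simp
  show ?thesis
    unfolding invariant_def
  proof (intro conjI allI impI)
    fix \<tau> n :: nat and j :: cfg assume "56 \<le> \<tau>"
    then show "val ?B (\<tau>, j, n) = real \<tau>"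
      using e[of "(\<tau>, j, n)"] invariant_large[OF inv, of \<tau> j n] t by (auto simp: entry_def split: if_splits)
  next
    fix \<tau> j n assume c: "(\<tau>, j, n) \<in> cells"
    have old: "if (\<tau>, n) \<in> processed t 5 then stored (processed t 5) A (\<tau>, j, n) else cnt A (\<tau>, j, n) = 0"
      by (rule invariant_cell[OF inv c])
    show "if (\<tau>, n) \<in> processed t 4 then stored (processed t 4) ?B (\<tau>, j, n) else cnt ?B (\<tau>, j, n) = 0"
    proof (cases "\<tau> = t \<and> n = 5")
      case True
      then have "(\<tau>, n) \<notin> processed t 5" by (simp add: processed_def)
      moreover have "\<exists>i\<in>configs. (\<tau>, j, n) = (t, i, 5)" using True c by (auto simp: cells_iff)
      ultimately show ?thesis
        using old e[of "(\<tau>, j, n)"] True r by (simp add: D stored_def entry_def)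
    next
      case False
      then have "entry ?B (\<tau>, j, n) = entry A (\<tau>, j, n)" unfolding e by auto
      then have eq: "val ?B (\<tau>, j, n) = val A (\<tau>, j, n)" "arg ?B (\<tau>, j, n) = arg A (\<tau>, j, n)"
          "cnt ?B (\<tau>, j, n) = cnt A (\<tau>, j, n)" by (simp_all add: entry_def)
      have nh: "\<not> hits (t, 5) (\<tau>, j, n)" using hitsD(3) by fastforce
      then have rc: "processed t 4 \<inter> records (\<tau>, j, n) = processed t 5 \<inter> records (\<tau>, j, n)"
        unfolding D by (auto simp: records_def)
      have "stored (processed t 4) ?B (\<tau>, j, n) \<longleftrightarrow> stored (processed t 5) A (\<tau>, j, n)"
        using nh unfolding stored_def eq rc by (simp add: D)
      then show ?thesis using old False by (auto simp: D eq)
    qed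
  qed
qed

text \<open>A cell other than those assigned in this pass changes only if the offer beats its value.  Then the offer
  beats all earlier ones, so it is a record, and the counter and the number of records both grow by one.\<close>

lemma invariant_process_dice:
  assumes inv: "invariant (processed t m) A" and t: "t < 56" and m: "m \<in> {1..4}"
    and cs: "distinct cs" "set cs = configs"
  shows "invariant (processed t (m - 1)) (process_dice cs t m A)" (is "invariant _ ?B")
proof -
  define aux where "aux = rollv t m"
  have aux: "aux = roll_value (val A) t m"
    using roll_value_rollv[OF inv, of m] m by (simp add: aux_def)
  define D' where "D' = processed t (m - 1)"
  have D: "D' = insert (t, m) (processed t m)"
    unfolding D'_def using processed_Suc[OF t, of "m - 1"] m by auto
  have new: "(t, m) \<notin> processed t m" by (simp add: processed_def)
  have hits: "(\<exists>i\<in>configs. ndice i \<le> 5 - m \<and> hit_by i t m c) \<longleftrightarrow> hits (t, m) c" for c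
    using m unfolding hits_def by (auto simp: le_diff_conv2)
  have e: "if \<tau> = t \<and> n = m \<and> j \<in> configs \<and> ndice j \<le> 5 - m
    then entry ?B (\<tau>, j, n) = (if aux \<le> real t then (real t, Stop, cnt A (\<tau>, j, n) + 1)
      else (aux, Roll, cnt A (\<tau>, j, n) + 1))
    else if real t < aux \<and> hits (t, m) (\<tau>, j, n) \<and> val A (\<tau>, j, n) < aux
    then \<exists>i\<in>configs. ndice i \<le> 5 - m \<and> hit_by i t m (\<tau>, j, n) \<and>
      entry ?B (\<tau>, j, n) = (aux, Move i, cnt A (\<tau>, j, n) + 1)
    else entry ?B (\<tau>, j, n) = entry A (\<tau>, j, n)" for \<tau> j n
    using process_dice_entry[OF cs aux, of "(\<tau>, j, n)"] by (simp only: prod.case hits)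
  show ?thesis
    unfolding D'_def[symmetric] invariant_def
  proof (intro conjI allI impI)
    fix \<tau> n :: nat and j :: cfg assume \<tau>: "56 \<le> \<tau>"
    have v: "val A (\<tau>, j, n) = real \<tau>" by (rule invariant_large[OF inv \<tau>])
    have "aux < 56" unfolding aux_def using m t by (intro rollv_facts(4)) auto
    then have "\<not> val A (\<tau>, j, n) < aux" using v \<tau> by simp
    then have "entry ?B (\<tau>, j, n) = entry A (\<tau>, j, n)"
      using e[of \<tau> n j] \<tau> t by auto
    then show "val ?B (\<tau>, j, n) = real \<tau>" using v by (simp add: entry_def)
  next
    fix \<tau> j n assume c: "(\<tau>, j, n) \<in> cells"
    let ?c = "(\<tau>, j, n)"
    have old: "if (\<tau>, n) \<in> processed t m then stored (processed t m) A ?c else cnt A ?c = 0"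
      by (rule invariant_cell[OF inv c])
    show "if (\<tau>, n) \<in> D' then stored (D') ?B ?c else cnt ?B ?c = 0"
    proof (cases "\<tau> = t \<and> n = m")
      case True
      then have own: "\<tau> = t \<and> n = m \<and> j \<in> configs \<and> ndice j \<le> 5 - m"
        using c m by (auto simp: cells_iff)
      have "cnt A ?c = 0" using old new True by simp
      then have B: "entry ?B ?c = (if aux \<le> real t then (real t, Stop, 1) else (aux, Roll, 1))"
        using e[of \<tau> n j] own by simp
      have "\<not> hits p ?c" if "p \<in> D'" for p
        using that hitsD(1)[of "fst p" "snd p" \<tau> j n] True by (auto simp: processed_def D)
      then show ?thesis
        using B True m D by (auto simp: stored_def entry_def aux_def split: if_splits)
    next
      case not_own: False
      then have iff: "(\<tau>, n) \<in> D' \<longleftrightarrow> (\<tau>, n) \<in> processed t m" by (auto simp: D)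
      show ?thesis
      proof (cases "real t < aux \<and> hits (t, m) ?c \<and> val A ?c < aux")
        case True
        then have h: "hits (t, m) ?c" by blast
        have hd: "t < \<tau>" "n \<noteq> 5" using hitsD[OF h] by auto
        have old_cell: "(\<tau>, n) \<in> processed t m" using c hd by (auto simp: processed_def cells_iff)
        then have st: "stored (processed t m) A ?c" using old by simp
        obtain i where i: "i \<in> configs" "ndice i \<le> 5 - m" "hit_by i t m ?c"
            "entry ?B ?c = (aux, Move i, cnt A ?c + 1)"
          using e[of \<tau> n j] not_own True by auto
        have B: "val ?B ?c = aux" "arg ?B ?c = Move i" "cnt ?B ?c = cnt A ?c + 1"
          using i(4) by (simp_all add: entry_def)
        have rec: "(t, m) \<in> records ?c"
        proof -
          have "real \<tau> < aux" using st hd True by (auto simp: stored_def)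
          moreover have "rollv (fst q) (snd q) < aux" if q: "hits q ?c" "earlier q (t, m)" for q
          proof -
            have "q \<in> processed t m"
              using q hitsD[of "fst q" "snd q" \<tau> j n] c
              by (auto simp: processed_def earlier_def cells_iff)
            then have "rollv (fst q) (snd q) \<le> val A ?c" using st hd q(1) by (auto simp: stored_def)
            then show ?thesis using True by simp
          qed
          ultimately show ?thesis
            using h by (simp only: records_def mem_Collect_eq fst_conv snd_conv aux_def) blast
        qed
        have c1: "card (D' \<inter> records ?c) = Suc (card (processed t m \<inter> records ?c))"
          using rec new finite_processed by (simp add: D Int_insert_left)
        have d: "ndice i + m \<le> 5" using i(2) m by auto
        have A: "real \<tau> \<le> val A ?c" "rollv \<tau> n \<le> val A ?c"
            "\<And>p. p \<in> processed t m \<Longrightarrow> hits p ?c \<Longrightarrow> rollv (fst p) (snd p) \<le> val A ?c"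
            "cnt A ?c \<le> 1 + card (processed t m \<inter> records ?c)"
          using st hd(2) unfolding stored_def by simp_all
        have up: "val A ?c \<le> aux" using True by simp
        have "stored D' ?B ?c"
          unfolding stored_def prod.case if_not_P[OF hd(2)] B
        proof (intro conjI)
          show "\<forall>p\<in>D'. hits p ?c \<longrightarrow> rollv (fst p) (snd p) \<le> aux"
          proof (intro ballI impI)
            fix p assume "p \<in> D'" "hits p ?c"
            then show "rollv (fst p) (snd p) \<le> aux"
              using order.trans[OF A(3) up] by (cases "p = (t, m)") (auto simp: D aux_def)
          qed
          show "Move i = Stop \<and> aux = real \<tau> \<or> Move i = Roll \<and> aux = rollv \<tau> n \<or>
              (\<exists>i' t m. i' \<in> configs \<and> ndice i' + m \<le> 5 \<and> hit_by i' t m ?c \<and>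
                Move i = Move i' \<and> aux = rollv t m)"
            using i(1,3) d aux_def by blast
        qed (use A up c1 in auto)
        then show ?thesis using old_cell iff by simp
      next
        case False
        then have "entry ?B ?c = entry A ?c" using e[of \<tau> n j] not_own by auto
        then have eq: "val ?B ?c = val A ?c" "arg ?B ?c = arg A ?c" "cnt ?B ?c = cnt A ?c"
          by (simp_all add: entry_def)
        have "stored (D') ?B ?c" if st: "stored (processed t m) A ?c"
        proof (cases "n = 5")
          case True
          then show ?thesis using st unfolding stored_def prod.case if_P[OF True] eq by blast
        next
          case n: False
          have "aux \<le> val A ?c" if h: "hits (t, m) ?c"
          proof (cases "real t < aux")
            case True
            then show ?thesis using False h by simp
          next
            case F: False
            then show ?thesis using hitsD(1)[OF h] st n by (auto simp: stored_def)
          qed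
          moreover have "card (processed t m \<inter> records ?c) \<le> card (D' \<inter> records ?c)"
            using finite_processed by (intro card_mono) (auto simp: D)
          moreover have "\<forall>p\<in>D'. hits p ?c \<longrightarrow> rollv (fst p) (snd p) \<le> val A ?c"
            if "\<forall>p\<in>processed t m. hits p ?c \<longrightarrow> rollv (fst p) (snd p) \<le> val A ?c"
          proof (intro ballI impI)
            fix p assume p: "p \<in> D'" "hits p ?c"
            show "rollv (fst p) (snd p) \<le> val A ?c"
              using p that calculation(1) by (cases "p = (t, m)") (auto simp: D aux_def)
          qed
          ultimately show ?thesis
            using st unfolding stored_def prod.case if_not_P[OF n] eq
            by (meson add_left_mono order.trans)
        qed
        then show ?thesis using old iff eq by auto
      qed
    qed
  qed
qed

lemma invariant_process_score:
  assumes "invariant (processed t 5) A" "t < 56" "distinct cs" "set cs = configs"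
  shows "invariant (processed t 0) (process_score cs t A)"
proof -
  note step = invariant_process_dice[OF _ assms(2) _ assms(3,4)]
  show ?thesis
    unfolding process_score_def
    using step[of 1] step[of 2] step[of 3] step[of 4] invariant_process_five[OF assms] by simp
qed

lemma invariant_algorithm:
  assumes cs: "distinct cs" "set cs = configs" and A: "cnt A = (\<lambda>c. 0)"
    and large: "\<And>\<tau> i n. 56 \<le> \<tau> \<Longrightarrow> val A (\<tau>, i, n) = real \<tau>"
  shows "invariant (processed 0 0) (algorithm cs A)"
proof -
  \<comment> \<open>the end of one score is the beginning of the next lower one\<close>
  have shift: "processed t 0 = processed (t - 1) 5" if "0 < t" for t
    using that by (auto simp: processed_def)
  have "invariant (processed 0 0) (fold (process_score cs) (rev [0..<k]) B)"
    if "0 < k" "k \<le> 56" "invariant (processed (k - 1) 5) B" for k B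
    using that
  proof (induction k arbitrary: B)
    case (Suc k)
    have "invariant (processed k 0) (process_score cs k B)"
      using Suc.prems cs by (intro invariant_process_score) auto
    then show ?case using Suc.IH[of "process_score cs k B"] Suc.prems shift[of k]
      by (cases "k = 0") auto
  qed simp
  moreover have "processed 55 5 = {}" by (auto simp: processed_def)
  then have "invariant (processed 55 5) A" using A large by (simp add: invariant_def)
  ultimately show ?thesis unfolding algorithm_def by simp
qed

section \<open>The number of updates\<close>

text \<open>A worthwhile offer gives up less than 4 chips.  Triples and bonuses are worth more, so what is resigned is
  one five, one 1, two fives, or a five and a 1, and no bonus may be destroyed by it.\<close>

lemma hit_kinds:
  assumes hit: "hits (t, m) (\<tau>, (f, os, u), n)" and j: "(f, os, u) \<in> configs" and gain: "\<tau> < t + 4"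
  shows "(t + 1, m) = (\<tau>, n + 1) \<and> 1 \<le> f \<and> f \<noteq> 3 \<or> (t + 2, m) = (\<tau>, n + 1) \<or>
    (t + 2, m) = (\<tau>, n + 2) \<and> 1 \<le> f \<and> f \<noteq> 3 \<or>
    (t + 3, m) = (\<tau>, n + 2) \<and> 1 \<le> f \<and> f \<noteq> 3"
proof -
  obtain f' o' u' where i: "(f', o', u') \<prec> (f, os, u)"
      and \<tau>: "\<tau> + score (f', o', u') = t + score (f, os, u)"
      and m: "n + ndice (f, os, u) = m + ndice (f', o', u')"
    using hit smaller_score by (fastforce simp: hits_def hit_by.simps)
  have le: "f' \<le> f" "o' \<le> os" "u' = 0 \<or> u' = u" "(f', o', u') \<noteq> (f, os, u)" "(f', o', u') \<noteq> (0, 0, 0)"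
    using i by (simp_all add: smaller_iff)
  have s: "score (f, os, u) < score (f', o', u') + 4" using \<tau> gain by linarith
  have f5: "f \<le> 5" "os \<le> 5" using j by (auto simp: configs_iff split: if_splits)
  \<comment> \<open>\<open>a\<close> fives and \<open>b\<close> ones are resigned\<close>
  define a b where "a = f - f'" and "b = os - o'"
  have ab: "f = f' + a" "os = o' + b" using le by (simp_all add: a_def b_def)
  have u: "u' = u" using s le j by (auto simp: ab configs_iff split: if_splits)
  have bonus: "3 \<le> f \<Longrightarrow> 3 \<le> f'" "3 \<le> os \<Longrightarrow> 3 \<le> o'"
    using s by (auto simp: ab u split: if_splits)
  have sc: "a + 2 * b < 4" using s bonus by (auto simp: ab u split: if_splits)
  have "score (f, os, u) = score (f', o', u') + a + 2 * b" "ndice (f, os, u) = ndice (f', o', u') + a + b"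
    using bonus by (auto simp: ab u)
  then have \<tau>': "\<tau> = t + a + 2 * b" and m': "m = n + a + b" using \<tau> m by linarith+
  have "a \<noteq> 0 \<or> b \<noteq> 0" using le(4) by (auto simp: ab u)
  moreover have "a \<noteq> 3" using bonus(1) f5 by (auto simp: ab)
  ultimately have "(a, b) \<in> {(1, 0), (0, 1), (2, 0), (1, 1)}" using sc by auto
  then show ?thesis
    using \<tau>' m' bonus le(5) by (elim insertE emptyE) (auto simp: ab u)
qed

lemma hits_five:
  assumes j: "(f, os, u) \<in> configs" and n: "1 \<le> n" "n + ndice (f, os, u) \<le> 5"
    and f: "1 \<le> f" "f \<noteq> 3" "(f, os, u) \<noteq> (1, 0, 0)" and \<tau>: "1 \<le> \<tau>"
  shows "hits (\<tau> - 1, n + 1) (\<tau>, (f, os, u), n)"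
proof -
  have i: "(f - 1, os, u) \<prec> (f, os, u)" using f by (auto simp: smaller_iff)
  then have "(f - 1, os, u) \<in> configs" using j by (rule smaller_configs)
  moreover have "score (f, os, u) = score (f - 1, os, u) + 1" "ndice (f, os, u) = ndice (f - 1, os, u) + 1"
    using f by auto
  ultimately show ?thesis
    using i j n \<tau> unfolding hits_def hit_by.simps fst_conv snd_conv
    by (intro conjI bexI[of _ "(f - 1, os, u)"]) (simp_all del: score.simps ndice.simps)
qed

text \<open>Let \<open>A\<close>, \<open>B\<close>, \<open>C\<close>, \<open>D\<close> be the offers from resigning one five, two fives, one 1, and a five and a 1.  If \<open>B\<close> or
  \<open>D\<close> is made then so is \<open>A\<close>.  Offer \<open>A\<close> precedes \<open>C\<close> and has the same number of dice and a higher score, so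
  it is not smaller; in the same way \<open>B\<close> rules out \<open>D\<close>.\<close>

lemma card_records:
  assumes c: "(\<tau>, j, n) \<in> cells" and n: "n \<noteq> 5"
  shows "finite (records (\<tau>, j, n))" and "card (records (\<tau>, j, n)) \<le> 2"
proof -
  obtain f os u where j: "j = (f, os, u)" by (metis prod_cases3)
  have c': "\<tau> < 56" "(f, os, u) \<in> configs" "1 \<le> n" "n + ndice (f, os, u) \<le> 5"
    using c n by (auto simp: cells_iff j)
  let ?c = "(\<tau>, j, n)"
  let ?A = "(\<tau> - 1, n + 1)" and ?B = "(\<tau> - 2, n + 2)" and ?C = "(\<tau> - 2, n + 1)" and ?D = "(\<tau> - 3, n + 2)"
  have rec: "hits (t, m) ?c" "real \<tau> < rollv t m" "m \<in> {1..4}" "t < \<tau>" "\<tau> < t + 4"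
      "\<And>q. hits q ?c \<Longrightarrow> earlier q (t, m) \<Longrightarrow> rollv (fst q) (snd q) < rollv t m"
    if p: "(t, m) \<in> records ?c" for t m
  proof -
    show h: "hits (t, m) ?c" and r: "real \<tau> < rollv t m"
      and "\<And>q. hits q ?c \<Longrightarrow> earlier q (t, m) \<Longrightarrow> rollv (fst q) (snd q) < rollv t m"
      using p by (auto simp only: records_def mem_Collect_eq fst_conv snd_conv)
    show m: "m \<in> {1..4}" and t: "t < \<tau>" using hitsD[OF h] by auto
    have "rollv t m < real t + 4" using m t c' by (intro rollv_facts(3)) auto
    then show "\<tau> < t + 4" using r by linarith
  qed
  have kinds: "(t, m) \<in> {?A, ?B, ?C, ?D}" "(t, m) \<noteq> ?C \<Longrightarrow> hits ?A ?c"
      if p: "(t, m) \<in> records ?c" for t m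
  proof -
    note r = rec[OF p]
    note k = hit_kinds[OF r(1)[unfolded j] c'(2) r(5)]
    show "(t, m) \<in> {?A, ?B, ?C, ?D}" using k by auto
    assume "(t, m) \<noteq> ?C"
    then have "1 \<le> f \<and> f \<noteq> 3" using k by auto
    moreover have "(f, os, u) \<noteq> (1, 0, 0)"
    proof
      obtain i where "i \<in> configs" "i \<prec> j" using r(1) by (auto simp: hits_def hit_by.simps)
      then have "2 \<le> ndice j" using ndice_pos smaller_ndice by fastforce
      moreover assume "(f, os, u) = (1, 0, 0)"
      ultimately show False by (simp add: j)
    qed
    ultimately show "hits ?A ?c" unfolding j using c' r(4) by (intro hits_five) auto
  qed
  have noC: "?C \<notin> records ?c" if A: "hits ?A ?c" "?C \<noteq> ?A"
  proof
    assume C: "?C \<in> records ?c"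
    note r = rec[OF C]
    have "earlier ?A ?C" using A(2) by (auto simp: earlier_def)
    then have "rollv (\<tau> - 1) (n + 1) < rollv (\<tau> - 2) (n + 1)" using r(6)[OF A(1)] by simp
    moreover have "rollv (\<tau> - 2) (n + 1) < rollv (\<tau> - 1) (n + 1)"
      using r(3) c'(1) A(2) by (intro rollv_strict_mono) auto
    ultimately show False by simp
  qed
  have noD: "?D \<notin> records ?c" if B: "?B \<in> records ?c" "?D \<noteq> ?B"
  proof
    assume D: "?D \<in> records ?c"
    note r = rec[OF D] and b = rec[OF B(1)]
    have "earlier ?B ?D" using B(2) by (auto simp: earlier_def)
    then have "rollv (\<tau> - 2) (n + 2) < rollv (\<tau> - 3) (n + 2)" using r(6)[OF b(1)] by simp
    moreover have "rollv (\<tau> - 3) (n + 2) < rollv (\<tau> - 2) (n + 2)"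
      using r(3) c'(1) B(2) by (intro rollv_strict_mono) auto
    ultimately show False by simp
  qed
  have sub: "records ?c \<subseteq> {?A, ?B} \<or> records ?c \<subseteq> {?A, ?D} \<or> records ?c \<subseteq> {?C}"
  proof (cases "hits ?A ?c")
    case True
    have "records ?c \<subseteq> {?A, ?B, ?D}" using kinds(1) noC[OF True] by fastforce
    then show ?thesis using noD by (cases "?B \<in> records ?c"; cases "?D = ?B") blast+
  next
    case False
    then show ?thesis using kinds(2) by auto
  qed
  show "finite (records ?c)" using sub by (auto dest: finite_subset)
  have "card {?A, ?B} \<le> 2" "card {?A, ?D} \<le> 2" "card {?C} \<le> 2" by (auto simp: card_insert_if)
  then show "card (records ?c) \<le> 2"
    using sub by (meson card_mono finite.emptyI finite.insertI order.trans)
qed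

lemma records_four: "records (\<tau>, j, 4) = {}"
proof -
  have "\<not> hits (t, m) (\<tau>, j, 4)" for t m using hitsD(2,3)[of t m \<tau> j 4] by auto
  then show ?thesis by (auto simp: records_def)
qed

text \<open>The score is independent of the other components, so counting cells amounts to counting a list of 90
  pairs.\<close>

lemma cells_product: "cells = {..<56} \<times> set (filter (\<lambda>(i, n). n = 5 \<or> ndice i + n \<le> 5)
    (List.product cfgs [1, 2, 3, 4, 5]))"
  by (auto simp: cells_iff set_cfgs)

lemma card_cells:
  "card cells = 5040" "card {c \<in> cells. 4 \<le> snd (snd c)} = 2576"
proof -
  let ?L = "List.product cfgs [1, 2, 3, 4, 5 :: nat]"
  have d: "distinct cfgs" by code_simp
  have dL: "distinct ?L" by (intro distinct_product d) simp
  have l: "length (filter (\<lambda>(i, n). n = 5 \<or> ndice i + n \<le> 5) ?L) = 90"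
    "length (filter (\<lambda>(i, n). 4 \<le> n \<and> (n = 5 \<or> ndice i + n \<le> 5)) ?L) = 46" by code_simp+
  show "card cells = 5040"
    unfolding cells_product card_cartesian_product
    using distinct_card[OF distinct_filter[OF dL]] l by simp
  have "{c \<in> cells. 4 \<le> snd (snd c)} =
      {..<56} \<times> set (filter (\<lambda>(i, n). 4 \<le> n \<and> (n = 5 \<or> ndice i + n \<le> 5)) ?L)"
    unfolding cells_product by auto
  then show "card {c \<in> cells. 4 \<le> snd (snd c)} = 2576"
    using distinct_card[OF distinct_filter[OF dL]] l by (simp only: card_cartesian_product card_lessThan)
qed

theorem algorithm_correct:
  assumes "distinct cs" "set cs = configs" "cnt A = (\<lambda>c. 0)"
    and "\<And>\<tau> i n. 56 \<le> \<tau> \<Longrightarrow> val A (\<tau>, i, n) = real \<tau>"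
    and c: "(\<tau>, i, n) \<in> cells" and ok: "n = 5 \<or> score i \<le> \<tau>"
  shows "opt_value (cell_state (\<tau>, i, n)) = ennreal (val (algorithm cs A) (\<tau>, i, n)) \<and>
    arg (algorithm cs A) (\<tau>, i, n) \<in> opt_actions (cell_state (\<tau>, i, n))"
proof -
  let ?B = "algorithm cs A"
  note inv = invariant_algorithm[OF assms(1-4)]
  have c': "\<tau> < 56" "i \<in> configs" "n \<in> {1..5}" using c by (simp_all add: cells_iff)
  have pr: "(t, m) \<in> processed 0 0" if "t < 56" "m \<in> {1..5}" for t m
    using that by (auto simp: processed_def)
  have st: "stored (processed 0 0) ?B (\<tau>, i, n)" using invariant_cell[OF inv c] pr[OF c'(1,3)] by simp
  show ?thesis
  proof (cases "\<tau> = 0")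
    case True
    then have "n = 5" using ok score_pos[OF c'(2)] by simp
    then show ?thesis using st True by (simp add: stored_def value_Init Roll_Init)
  next
    case False
    then have x: "St \<tau> i n \<in> states" and cell: "cell_state (\<tau>, i, n) = St \<tau> i n"
      using c' by (auto simp: St_states)
    show ?thesis
    proof (cases "n = 5")
      case True
      then show ?thesis
        using st x by (simp add: stored_def cell opt_value_eq opt_actions_iff vopt_five c' False)
    next
      case n: False
      have s: "score i \<le> \<tau>" using ok n by simp
      have v: "val ?B (\<tau>, i, n) = vopt \<tau> i n"
        by (rule stored_vopt[OF inv c pr[OF c'(1,3)] n s]) (use c' pr in auto)
      have "arg ?B (\<tau>, i, n) \<in> opt_actions (St \<tau> i n)"
      proof -
        from st n consider "arg ?B (\<tau>, i, n) = Stop" "vopt \<tau> i n = real \<tau>"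
          | "arg ?B (\<tau>, i, n) = Roll" "vopt \<tau> i n = rollv \<tau> n"
          | k t m where "k \<in> configs" "ndice k + m \<le> 5" "hit_by k t m (\<tau>, i, n)"
            "arg ?B (\<tau>, i, n) = Move k" "vopt \<tau> i n = rollv t m"
          unfolding stored_def v by auto
        then show ?thesis
        proof cases
          case 1
          then show ?thesis by (simp add: opt_actions_iff[OF x])
        next
          case 2
          then show ?thesis by (simp add: opt_actions_iff[OF x])
        next
          case 3
          have h: "k \<prec> i" "ndice i < ndice k + m" "\<tau> = t + score i - score k" "n = m + ndice k - ndice i"
            using 3(3) by (simp_all add: hit_by.simps)
          have k: "k \<in> moves \<tau> i n"
            using 3(1,2) h s c' n score_pos[OF 3(1)] smaller_ndice[OF h(1)] by (auto simp: moves_iff)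
          have e: "\<tau> + score k - score i = t" "n + ndice i - ndice k = m"
            using h smaller_score[OF h(1)] by simp_all
          have "t < 56" using c'(1) h(3) smaller_score[OF h(1)] by linarith
          then have "vopt \<tau> i n \<le> vopt t k m" using vopt_ge_roll 3(5) by metis
          then have "worth (St \<tau> i n) (Move k) = vopt \<tau> i n"
            using vopt_move_le[OF c'(1) k] by (simp only: worth.simps e)
          then show ?thesis
            using k unfolding opt_actions_iff[OF x] 3(4) Move_actions value_fn.simps by blast
        qed
      qed
      then show ?thesis unfolding cell by (simp add: opt_value_eq[OF x] v)
    qed
  qed
qed

text \<open>Cells with four or five dice receive no offers (\<open>records_four\<close>), and these are already more than half
  of all cells.\<close>

theorem algorithm_efficient:
  assumes "distinct cs" "set cs = configs" "cnt A = (\<lambda>c. 0)"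
    and "\<And>\<tau> i n. 56 \<le> \<tau> \<Longrightarrow> val A (\<tau>, i, n) = real \<tau>"
  shows "card cells < 2 * card {c \<in> cells. cnt (algorithm cs A) c = 1}"
    and "c \<in> cells \<Longrightarrow> cnt (algorithm cs A) c \<in> {1..3}"
proof -
  let ?B = "algorithm cs A"
  note inv = invariant_algorithm[OF assms]
  have st: "stored (processed 0 0) ?B (\<tau>, i, n)" if "(\<tau>, i, n) \<in> cells" for \<tau> i n
  proof -
    have "(\<tau>, n) \<in> processed 0 0" using that by (auto simp: processed_def cells_iff)
    then show ?thesis using invariant_cell[OF inv that] by simp
  qed
  have "{c \<in> cells. 4 \<le> snd (snd c)} \<subseteq> {c \<in> cells. cnt ?B c = 1}"
  proof
    fix c assume c: "c \<in> {c \<in> cells. 4 \<le> snd (snd c)}"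
    obtain \<tau> i n where c3: "c = (\<tau>, i, n)" by (metis prod_cases3)
    have "n = 4 \<or> n = 5" using c by (auto simp: c3 cells_iff)
    then show "c \<in> {c \<in> cells. cnt ?B c = 1}"
      using st[of \<tau> i n] c by (auto simp: c3 stored_def records_four)
  qed
  moreover have "finite {c \<in> cells. cnt ?B c = 1}"
    by (rule finite_subset[of _ cells]) (auto simp: cells_product)
  ultimately have "2576 \<le> card {c \<in> cells. cnt ?B c = 1}"
    unfolding card_cells(2)[symmetric] by (rule card_mono[rotated])
  then show "card cells < 2 * card {c \<in> cells. cnt ?B c = 1}" by (simp add: card_cells)
  show "cnt ?B c \<in> {1..3}" if c: "c \<in> cells"
  proof -
    obtain \<tau> i n where c3: "c = (\<tau>, i, n)" by (metis prod_cases3)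
    show ?thesis
    proof (cases "n = 5")
      case True
      then show ?thesis using st[of \<tau> i n] c by (simp add: c3 stored_def)
    next
      case False
      have "card (processed 0 0 \<inter> records c) \<le> card (records c)"
        using card_records(1)[of \<tau> i n] c False by (intro card_mono) (auto simp: c3)
      also have "\<dots> \<le> 2" using card_records(2)[of \<tau> i n] c False by (simp add: c3)
      finally show ?thesis using st[of \<tau> i n] c False by (simp add: c3 stored_def)
    qed
  qed
qed

section \<open>The theorem\<close>

theorem theorem4p1:
  shows
    "\<comment> \<open>existence of a pure stationary optimal strategy\<close>
     (\<exists>g. (\<forall>x\<in>states. g x \<in> actions x) \<and>
        (\<forall>x\<in>states. total_reward x (pure_stationary g) = opt_value x)) \<and>
     \<comment> \<open>states with at least 56 chips\<close>
     (\<forall>\<tau> i n. St \<tau> i n \<in> states \<and> 56 \<le> \<tau> \<longrightarrow>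
        opt_value (St \<tau> i n) = of_nat \<tau> \<and> opt_actions (St \<tau> i n) = {Stop}) \<and>
     \<comment> \<open>exactness and efficiency of the algorithm\<close>
     (\<forall>cs A. distinct cs \<and> set cs = configs \<and> cnt A = (\<lambda>c. 0) \<and>
          (\<forall>\<tau> i n. 56 \<le> \<tau> \<longrightarrow> val A (\<tau>, i, n) = real \<tau>) \<longrightarrow>
        (let B = algorithm cs A in
          (\<forall>\<tau> i n. (\<tau>, i, n) \<in> cells \<and> (n = 5 \<or> score i \<le> \<tau>) \<longrightarrow>
             opt_value (cell_state (\<tau>, i, n)) = ennreal (val B (\<tau>, i, n)) \<and>
             arg B (\<tau>, i, n) \<in> opt_actions (cell_state (\<tau>, i, n))) \<and>
          card cells < 2 * card {c \<in> cells. cnt B c = 1} \<and>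
          (\<forall>c\<in>cells. cnt B c \<in> {1..3}))) \<and>
     \<comment> \<open>the value of the game\<close>
     rounds_to 6 (opt_value Init) 5.872019 \<and>
     \<comment> \<open>the table\<close>
     table_column 5 configs (\<lambda>i. Roll) 0
       [5.872, 6.607, 7.355, 8.107, 8.883, 9.713, 10.553, 11.394, 12.235, 13.077,
        13.918, 14.779, 15.655, 16.534, 17.413, 18.291, 19.170, 20.060, 20.972, 21.893,
        22.814, 23.734, 24.655, 25.576, 26.497, 27.418, 28.339, 29.260, 30.181, 31.102,
        32.022, 32.943, 33.864, 34.785, 35.706, 36.627, 37.548, 38.469, 39.390, 40.312,
        41.233, 42.154, 43.075, 43.997, 44.919, 45.840, 46.762, 47.684, 48.607, 49.529,
        50.452, 51.375, 52.298, 53.221, 54.144, 55.066] \<and>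
     table_column 4 (configs_upto 1) (\<lambda>i. Roll) 1
       [4.338, 5.021, 5.743, 6.476, 7.212, 8.001, 8.840, 9.679, 10.517, 11.357, 12.196,
        13.035, 13.875, 14.715, 15.554, 16.394, 17.234, 18.073] \<and>
     table_column 3 {(2, 0, 0), (1, 1, 0)} (resign {#SFive#}) 2
       [4.338, 5.021, 5.743, 6.476, 7.212, 8.001, 8.840, 9.679, 10.517, 11.357, 12.196,
        13.035] \<and>
     table_column 3 {(0, 2, 0)} (resign {#SOne#}) 4
       [5.021, 5.743, 6.476, 7.212, 8.001] \<and>
     table_column 3 (configs_upto 2 - {(2, 0, 0), (1, 1, 0), (0, 2, 0)}) (\<lambda>i. Roll) 2
       [3.447, 4.123, 4.837, 5.552, 6.266] \<and>
     table_column 2 {(2, 1, 0)} (resign {#SFive, SFive#}) 4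
       [5.021, 5.743, 6.476, 7.212, 8.001] \<and>
     table_column 2 {(1, 2, 0)} (resign {#SFive, SOne#}) 5
       [5.021] \<and>
     table_column 2 {(2, 0, 0), (1, 1, 0)} (resign {#SFive#}) 3
       [3.447, 4.123] \<and>
     table_column 2 {(1, 0, 0)} (\<lambda>i. Roll) 3
       [3.173] \<and>
     (\<forall>\<tau> i n. reachable (St \<tau> i n) \<and> \<tau> < 56 \<and>
          (n = 1 \<or> n = 2 \<and> i \<notin> {(2, 1, 0), (1, 2, 0), (2, 0, 0), (1, 1, 0), (1, 0, 0)}) \<longrightarrow>
        opt_value (St \<tau> i n) = of_nat \<tau> \<and> opt_actions (St \<tau> i n) = {Stop}) \<and>
     \<comment> \<open>moves that are never optimal\<close>
     (\<forall>\<tau> i n R. St \<tau> i n \<in> states \<and> (n = 5 \<or> i \<in> configs_upto (5 - n)) \<and>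
          R \<in> {{#SOne, SOne#}, {#SFive, SFive, SOne#}, {#SFive, SOne, SOne#},
            {#SOne, SOne, SOne#}, {#Triple 2#}, {#Triple 3#}, {#Triple 4#},
            {#SFive, SFive, SFive#}, {#Triple 6#}} \<and> R \<subset># combs i \<longrightarrow>
        resign R i \<notin> opt_actions (St \<tau> i n))"
proof (intro conjI allI impI)
  show "\<exists>g. (\<forall>x\<in>states. g x \<in> actions x) \<and>
      (\<forall>x\<in>states. total_reward x (pure_stationary g) = opt_value x)"
    using policy_actions total_reward_policy_eq by blast
next
  fix \<tau> i n assume "St \<tau> i n \<in> states \<and> 56 \<le> \<tau>"
  then show "opt_value (St \<tau> i n) = of_nat \<tau>" "opt_actions (St \<tau> i n) = {Stop}"
    using opt_actions_large by blast+
next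
  fix cs :: "cfg list" and A :: arrays assume "distinct cs \<and> set cs = configs \<and> cnt A = (\<lambda>c. 0) \<and>
    (\<forall>\<tau> i n. 56 \<le> \<tau> \<longrightarrow> val A (\<tau>, i, n) = real \<tau>)"
  then have A: "distinct cs" "set cs = configs" "cnt A = (\<lambda>c. 0)"
      "\<And>\<tau> i n. 56 \<le> \<tau> \<Longrightarrow> val A (\<tau>, i, n) = real \<tau>"
    by blast+
  show "let B = algorithm cs A in
      (\<forall>\<tau> i n. (\<tau>, i, n) \<in> cells \<and> (n = 5 \<or> score i \<le> \<tau>) \<longrightarrow>
         opt_value (cell_state (\<tau>, i, n)) = ennreal (val B (\<tau>, i, n)) \<and>
         arg B (\<tau>, i, n) \<in> opt_actions (cell_state (\<tau>, i, n))) \<and>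
      card cells < 2 * card {c \<in> cells. cnt B c = 1} \<and>
      (\<forall>c\<in>cells. cnt B c \<in> {1..3})"
    unfolding Let_def using algorithm_correct[OF A] algorithm_efficient[OF A] by blast
next
  have "\<bar>rollv 0 5 - 5.872019\<bar> \<le> 1 / 2000000"
    using nano_error[of 0 5] by (simp add: nano_simps abs_le_iff)
  then show "rounds_to 6 (opt_value Init) 5.872019"
    unfolding rounds_to_def value_Init by (intro exI[of _ "rollv 0 5"]) (simp add: rollv_nonneg)
next
  show "table_column 5 configs (\<lambda>i. Roll) 0
      [5.872, 6.607, 7.355, 8.107, 8.883, 9.713, 10.553, 11.394, 12.235, 13.077,
        13.918, 14.779, 15.655, 16.534, 17.413, 18.291, 19.170, 20.060, 20.972, 21.893,
        22.814, 23.734, 24.655, 25.576, 26.497, 27.418, 28.339, 29.260, 30.181, 31.102,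
        32.022, 32.943, 33.864, 34.785, 35.706, 36.627, 37.548, 38.469, 39.390, 40.312,
        41.233, 42.154, 43.075, 43.997, 44.919, 45.840, 46.762, 47.684, 48.607, 49.529,
        50.452, 51.375, 52.298, 53.221, 54.144, 55.066]"
    by (rule table_5) (simp_all add: nano_simps small_nat)
  show "table_column 4 (configs_upto 1) (\<lambda>i. Roll) 1
       [4.338, 5.021, 5.743, 6.476, 7.212, 8.001, 8.840, 9.679, 10.517, 11.357, 12.196,
        13.035, 13.875, 14.715, 15.554, 16.394, 17.234, 18.073]"
    by (rule table_4) (simp_all add: nano_simps small_nat)
  show "table_column 3 {(2, 0, 0), (1, 1, 0)} (resign {#SFive#}) 2
       [4.338, 5.021, 5.743, 6.476, 7.212, 8.001, 8.840, 9.679, 10.517, 11.357, 12.196,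
        13.035]"
    by (rule table_3_five) (simp_all add: nano_simps small_nat)
  show "table_column 3 {(0, 2, 0)} (resign {#SOne#}) 4 [5.021, 5.743, 6.476, 7.212, 8.001]"
    by (rule table_3_one) (simp_all add: nano_simps small_nat)
  show "table_column 3 (configs_upto 2 - {(2, 0, 0), (1, 1, 0), (0, 2, 0)}) (\<lambda>i. Roll) 2
       [3.447, 4.123, 4.837, 5.552, 6.266]"
    by (rule table_3_other) (simp_all add: nano_simps small_nat)
  show "table_column 2 {(2, 1, 0)} (resign {#SFive, SFive#}) 4 [5.021, 5.743, 6.476, 7.212, 8.001]"
    by (rule table_2_two_fives) (simp_all add: nano_simps small_nat)
  show "table_column 2 {(1, 2, 0)} (resign {#SFive, SOne#}) 5 [5.021]"
    by (rule table_2_five_one) (simp_all add: nano_simps small_nat)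
  show "table_column 2 {(2, 0, 0), (1, 1, 0)} (resign {#SFive#}) 3 [3.447, 4.123]"
    by (rule table_2_five) (simp_all add: nano_simps small_nat)
  show "table_column 2 {(1, 0, 0)} (\<lambda>i. Roll) 3 [3.173]"
    by (rule table_2_one_five) (simp_all add: nano_simps small_nat)
next
  fix \<tau> i n assume "reachable (St \<tau> i n) \<and> \<tau> < 56 \<and>
    (n = 1 \<or> n = 2 \<and> i \<notin> {(2, 1, 0), (1, 2, 0), (2, 0, 0), (1, 1, 0), (1, 0, 0)})"
  then show "opt_value (St \<tau> i n) = of_nat \<tau>" "opt_actions (St \<tau> i n) = {Stop}"
    using stop_few_dice by blast+
next
  fix \<tau> i n R assume "St \<tau> i n \<in> states \<and> (n = 5 \<or> i \<in> configs_upto (5 - n)) \<and>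
      R \<in> {{#SOne, SOne#}, {#SFive, SFive, SOne#}, {#SFive, SOne, SOne#},
        {#SOne, SOne, SOne#}, {#Triple 2#}, {#Triple 3#}, {#Triple 4#},
        {#SFive, SFive, SFive#}, {#Triple 6#}} \<and> R \<subset># combs i"
  then show "resign R i \<notin> opt_actions (St \<tau> i n)"
    using resign_not_optimal by blast
qed

end
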